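(* Let $n \in \mathbb{N}$ with $n \geqslant 136$, and let $\mathcal{G}$ be a collection of ordered graphs on $[n]$. If $|\mathcal{G}| < n$, then $|\partial \mathcal{G}| \geqslant |\mathcal{G}|$.
   Context: An ordered graph is a graph together with a linear order on its vertex set; an ordered graph with $n$ vertices is identified with an ordered graph on $[n]=\{1,\ldots,n\}$ with the usual order (two ordered graphs are equal if the unique order-preserving bijection between their vertex sets is a graph isomorphism). For an ordered graph $G$ and $v \in V(G)$, $G - v$ is the ordered graph induced on $V(G)\setminus\{v\}$ with the inherited order. The shadow of $G$ is $\partial G = \{G - v : v \in V(G)\}$, and for a collection $\mathcal{G}$ of ordered graphs, $\partial\mathcal{G} = \bigcup_{G \in \mathcal{G}} \partial G$. *)

theory Defs
  imports "Graph_Theory.Pair_Digraph"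
begin

text \<open>
  Simple graphs are the \<^locale>\<open>pair_graph\<close>s of the AFP: finite, loop-free, and with a symmetric set
  of arcs, so that an edge \<open>uv\<close> is the pair of arcs \<open>(u, v)\<close>, \<open>(v, u)\<close>.  An ordered graph is such a
  graph whose vertices are elements of a linearly ordered type, with the order inherited from it.
\<close>

definition ordered_graphs :: "nat \<Rightarrow> nat pair_pre_digraph set" where
  "ordered_graphs n = {G. pair_graph G \<and> pverts G = {1..n}}"

definition ordered_iso ::
    "'a::linorder pair_pre_digraph \<Rightarrow> 'b::linorder pair_pre_digraph \<Rightarrow> bool" where
  "ordered_iso G H \<longleftrightarrow> (\<exists>f. bij_betw f (pverts G) (pverts H) \<and> strict_mono_on (pverts G) f \<and>
     (\<forall>u\<in>pverts G. \<forall>v\<in>pverts G. (u, v) \<in> parcs G \<longleftrightarrow> (f u, f v) \<in> parcs H))"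

text \<open>
  The order-preserving bijection from a finite set \<open>V\<close> to \<open>{1..card V}\<close>.
\<close>

definition rank_in :: "'a::linorder set \<Rightarrow> 'a \<Rightarrow> nat" where
  "rank_in V v = card {u \<in> V. u \<le> v}"

text \<open>
  The graph on \<open>{1..m}\<close>, \<open>m\<close> the number of vertices, with which an ordered graph is identified;
  see \<open>relabel_unique\<close> and \<open>relabel_eq_iff\<close> below.
\<close>

definition relabel :: "'a::linorder pair_pre_digraph \<Rightarrow> nat pair_pre_digraph" where
  "relabel G = \<lparr> pverts = {1..card (pverts G)},
     parcs = map_prod (rank_in (pverts G)) (rank_in (pverts G)) ` parcs G \<rparr>"

definition delete_vertex :: "'a pair_pre_digraph \<Rightarrow> 'a \<Rightarrow> 'a pair_pre_digraph" where
  "delete_vertex G v = \<lparr> pverts = pverts G - {v}, parcs = {(a, b) \<in> parcs G. a \<noteq> v \<and> b \<noteq> v} \<rparr>"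

text \<open>
  Vertex-deleted subgraphs that are equal as ordered graphs count once, hence the relabelling.
\<close>

definition shadow :: "'a::linorder pair_pre_digraph \<Rightarrow> nat pair_pre_digraph set" where
  "shadow G = {relabel (delete_vertex G v) | v. v \<in> pverts G}"

definition shadow_family :: "'a::linorder pair_pre_digraph set \<Rightarrow> nat pair_pre_digraph set" where
  "shadow_family \<G> = (\<Union>G\<in>\<G>. shadow G)"


lemma with_proj_delete_vertex:
  "with_proj (delete_vertex G v) = pre_digraph.del_vert (with_proj G) v"
  by (auto simp: with_proj_def delete_vertex_def pre_digraph.del_vert_def)

lemma pair_graph_iff:
  "pair_graph G \<longleftrightarrow> finite (pverts G) \<and> parcs G \<subseteq> pverts G \<times> pverts G \<and>
     sym (parcs G) \<and> (\<forall>v. (v, v) \<notin> parcs G)"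
proof
  assume "pair_graph G"
  then interpret pair_graph G .
  show "finite (pverts G) \<and> parcs G \<subseteq> pverts G \<times> pverts G \<and>
     sym (parcs G) \<and> (\<forall>v. (v, v) \<notin> parcs G)"
    using pair_finite_verts wellformed' pair_sym_arcs no_loops'
    by (simp add: symmetric_def) (metis mem_Sigma_iff subrelI)
next
  assume *: "finite (pverts G) \<and> parcs G \<subseteq> pverts G \<times> pverts G \<and>
     sym (parcs G) \<and> (\<forall>v. (v, v) \<notin> parcs G)"
  then have "finite (parcs G)"
    by (meson finite_SigmaI finite_subset)
  with * show "pair_graph G"
    by unfold_locales (auto simp: symmetric_def)
qed

lemma pair_graph_delete_vertex: "pair_graph G \<Longrightarrow> pair_graph (delete_vertex G v)"
  by (auto simp: pair_graph_iff delete_vertex_def sym_def)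

lemma rank_in_strict_mono: "finite V \<Longrightarrow> strict_mono_on V (rank_in V)"
proof (rule strict_mono_onI)
  fix u v assume "finite V" "u \<in> V" "v \<in> V" "u < v"
  then have "{w \<in> V. w \<le> u} \<subseteq> {w \<in> V. w \<le> v}" "v \<in> {w \<in> V. w \<le> v}" "v \<notin> {w \<in> V. w \<le> u}"
    by auto
  then have "{w \<in> V. w \<le> u} \<subset> {w \<in> V. w \<le> v}" by blast
  with \<open>finite V\<close> show "rank_in V u < rank_in V v"
    unfolding rank_in_def by (intro psubset_card_mono) auto
qed

lemma rank_in_bij:
  assumes "finite V"
  shows "bij_betw (rank_in V) V {1..card V}"
proof -
  have inj: "inj_on (rank_in V) V"
    using rank_in_strict_mono[OF assms] by (rule strict_mono_on_imp_inj_on)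
  have "rank_in V ` V \<subseteq> {1..card V}"
  proof
    fix k assume "k \<in> rank_in V ` V"
    then obtain v where v: "v \<in> V" "k = card {u \<in> V. u \<le> v}" by (auto simp: rank_in_def)
    then have "0 < k" using assms by (auto simp: card_gt_0_iff)
    moreover have "k \<le> card V" unfolding v(2) by (rule card_mono) (use assms in auto)
    ultimately show "k \<in> {1..card V}" by auto
  qed
  then have "rank_in V ` V = {1..card V}"
    using inj by (intro card_subset_eq) (auto simp: card_image)
  with inj show ?thesis by (simp add: bij_betw_def)
qed

lemma rank_in_transfer:
  assumes "bij_betw f V W" "strict_mono_on V f" "v \<in> V"
  shows "rank_in W (f v) = rank_in V v"
proof -
  have "{w \<in> W. w \<le> f v} = f ` {u \<in> V. u \<le> v}"
    using assms by (auto simp: bij_betw_def strict_mono_on_less_eq)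
  moreover have "inj_on f {u \<in> V. u \<le> v}"
    using assms(1) by (auto simp: bij_betw_def inj_on_def)
  ultimately show ?thesis by (simp add: rank_in_def card_image)
qed

lemma relabel_arc_iff:
  assumes "pair_graph G" "u \<in> pverts G" "v \<in> pverts G"
  shows "(rank_in (pverts G) u, rank_in (pverts G) v) \<in> parcs (relabel G) \<longleftrightarrow> (u, v) \<in> parcs G"
proof -
  have "inj_on (rank_in (pverts G)) (pverts G)"
    using assms rank_in_bij by (auto simp: pair_graph_iff bij_betw_def)
  moreover have "parcs G \<subseteq> pverts G \<times> pverts G"
    using assms by (simp add: pair_graph_iff)
  ultimately show ?thesis
    using assms(2,3) by (auto simp: relabel_def inj_on_eq_iff subset_iff)
qed

lemma ordered_iso_relabel:
  assumes "pair_graph G"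
  shows "ordered_iso G (relabel G)"
proof -
  have fin: "finite (pverts G)" using assms by (simp add: pair_graph_iff)
  have "bij_betw (rank_in (pverts G)) (pverts G) (pverts (relabel G))"
    using rank_in_bij[OF fin] by (simp add: relabel_def)
  with rank_in_strict_mono[OF fin] relabel_arc_iff[OF assms] show ?thesis
    unfolding ordered_iso_def by blast
qed

lemma relabel_in_ordered_graphs:
  assumes "pair_graph G"
  shows "relabel G \<in> ordered_graphs (card (pverts G))"
proof -
  have fin: "finite (pverts G)" and sub: "parcs G \<subseteq> pverts G \<times> pverts G"
    and sym: "sym (parcs G)" and irr: "\<And>v. (v, v) \<notin> parcs G"
    using assms by (auto simp: pair_graph_iff)
  note bij = rank_in_bij[OF fin]
  have "parcs (relabel G) \<subseteq> {1..card (pverts G)} \<times> {1..card (pverts G)}"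
  proof
    fix e assume "e \<in> parcs (relabel G)"
    then obtain a b where ab: "(a, b) \<in> parcs G"
      "e = (rank_in (pverts G) a, rank_in (pverts G) b)"
      by (auto simp: relabel_def)
    then have "a \<in> pverts G" "b \<in> pverts G" using sub by auto
    then show "e \<in> {1..card (pverts G)} \<times> {1..card (pverts G)}"
      using ab(2) bij_betwE[OF bij] by blast
  qed
  moreover have "sym (parcs (relabel G))"
    using sym by (force simp: relabel_def sym_def)
  moreover have "(v, v) \<notin> parcs (relabel G)" for v
    using sub irr bij_betw_imp_inj_on[OF bij] by (auto simp: relabel_def dest: inj_onD)
  ultimately show ?thesis by (simp add: ordered_graphs_def pair_graph_iff relabel_def)
qed

lemma relabel_eq_iff:
  assumes G: "pair_graph G" and H: "pair_graph H"
  shows "relabel G = relabel H \<longleftrightarrow> ordered_iso G H"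
proof
  assume "ordered_iso G H"
  then obtain f where f: "bij_betw f (pverts G) (pverts H)" "strict_mono_on (pverts G) f"
    "\<And>u v. u \<in> pverts G \<Longrightarrow> v \<in> pverts G \<Longrightarrow> (u, v) \<in> parcs G \<longleftrightarrow> (f u, f v) \<in> parcs H"
    unfolding ordered_iso_def by blast
  have GV: "parcs G \<subseteq> pverts G \<times> pverts G" and HV: "parcs H \<subseteq> pverts H \<times> pverts H"
    using G H by (auto simp: pair_graph_iff)
  have "parcs H = map_prod f f ` parcs G"
  proof (intro set_eqI iffI)
    fix e assume e: "e \<in> parcs H"
    then have "fst e \<in> f ` pverts G" "snd e \<in> f ` pverts G"
      using HV f(1) by (auto simp: bij_betw_def)
    then obtain u v where "u \<in> pverts G" "v \<in> pverts G" "e = (f u, f v)"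
      by (metis imageE prod.collapse)
    with f(3) e show "e \<in> map_prod f f ` parcs G" by force
  qed (use f(3) GV in auto)
  moreover have "map_prod (rank_in (pverts H)) (rank_in (pverts H)) ` map_prod f f ` parcs G =
      map_prod (rank_in (pverts G)) (rank_in (pverts G)) ` parcs G"
    unfolding image_image using GV rank_in_transfer[OF f(1,2)] by (intro image_cong) auto
  ultimately show "relabel G = relabel H"
    using bij_betw_same_card[OF f(1)] by (simp add: relabel_def)
next
  assume eq: "relabel G = relabel H"
  define g where "g = inv_into (pverts H) (rank_in (pverts H))"
  have card: "card (pverts G) = card (pverts H)"
    using arg_cong[OF eq, of "\<lambda>G. card (pverts G)"] by (simp add: relabel_def)
  have fin: "finite (pverts G)" "finite (pverts H)" using G H by (auto simp: pair_graph_iff)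
  note bG = rank_in_bij[OF fin(1)] and bH = rank_in_bij[OF fin(2)]
  have bg: "bij_betw g {1..card (pverts H)} (pverts H)"
    unfolding g_def by (rule bij_betw_inv_into[OF bH])
  have bij: "bij_betw (g \<circ> rank_in (pverts G)) (pverts G) (pverts H)"
    using bG bg unfolding card by (rule bij_betw_trans)
  have rg: "rank_in (pverts H) (g (rank_in (pverts G) u)) = rank_in (pverts G) u"
    if "u \<in> pverts G" for u
    unfolding g_def using bij_betwE[OF bG] that card
    by (intro bij_betw_inv_into_right[OF bH]) auto
  have gin: "g (rank_in (pverts G) u) \<in> pverts H" if "u \<in> pverts G" for u
    using bij_betwE[OF bij] that by auto
  have mono: "strict_mono_on (pverts G) (g \<circ> rank_in (pverts G))"
  proof (rule strict_mono_onI)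
    fix u v assume uv: "u \<in> pverts G" "v \<in> pverts G" "u < v"
    then have "rank_in (pverts G) u < rank_in (pverts G) v"
      using rank_in_strict_mono[OF fin(1)] by (simp add: strict_mono_on_def)
    then show "(g \<circ> rank_in (pverts G)) u < (g \<circ> rank_in (pverts G)) v"
      using strict_mono_on_less[OF rank_in_strict_mono[OF fin(2)]] uv gin rg by force
  qed
  have "(u, v) \<in> parcs G \<longleftrightarrow> (g (rank_in (pverts G) u), g (rank_in (pverts G) v)) \<in> parcs H"
    if "u \<in> pverts G" "v \<in> pverts G" for u v
    using relabel_arc_iff[OF G that] relabel_arc_iff[OF H gin[OF that(1)] gin[OF that(2)]]
      rg that eq by simp
  with bij mono show "ordered_iso G H" unfolding ordered_iso_def by force
qed

lemma relabel_ordered_graphs: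
  assumes "G \<in> ordered_graphs n"
  shows "relabel G = G"
proof -
  have V: "pverts G = {1..n}" and sub: "parcs G \<subseteq> {1..n} \<times> {1..n}"
    using assms by (auto simp: ordered_graphs_def pair_graph_iff)
  have rank: "rank_in {1..n} v = v" if "v \<in> {1..n}" for v
  proof -
    have "{u \<in> {1..n}. u \<le> v} = {1..v}" using that by auto
    then show ?thesis by (simp add: rank_in_def)
  qed
  have "map_prod (rank_in {1..n}) (rank_in {1..n}) ` parcs G = (\<lambda>e. e) ` parcs G"
    using sub rank by (intro image_cong) auto
  then show ?thesis by (simp add: relabel_def V)
qed

lemma relabel_unique:
  assumes "pair_graph G" "H \<in> ordered_graphs n" "ordered_iso G H"
  shows "H = relabel G"
  using assms relabel_eq_iff[of G H] relabel_ordered_graphs[of H n]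
  by (simp add: ordered_graphs_def)

lemma finite_ordered_graphs: "finite (ordered_graphs n)"
proof (rule finite_subset)
  show "ordered_graphs n \<subseteq> (\<lambda>E. \<lparr> pverts = {1..n}, parcs = E \<rparr>) ` Pow ({1..n} \<times> {1..n})"
  proof
    fix G assume G: "G \<in> ordered_graphs n"
    then have "G = \<lparr> pverts = {1..n}, parcs = parcs G \<rparr>" by (simp add: ordered_graphs_def)
    moreover have "parcs G \<in> Pow ({1..n} \<times> {1..n})"
      using G by (auto simp: ordered_graphs_def pair_graph_iff)
    ultimately show "G \<in> (\<lambda>E. \<lparr> pverts = {1..n}, parcs = E \<rparr>) ` Pow ({1..n} \<times> {1..n})"
      by blast
  qed
qed simp

lemma shadow_family_subset:
  assumes "\<G> \<subseteq> ordered_graphs n"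
  shows "shadow_family \<G> \<subseteq> ordered_graphs (n - 1)"
proof
  fix H assume "H \<in> shadow_family \<G>"
  then obtain G v where G: "G \<in> \<G>" "v \<in> pverts G" "H = relabel (delete_vertex G v)"
    by (auto simp: shadow_family_def shadow_def)
  then have "pair_graph G" "pverts G = {1..n}" using assms by (auto simp: ordered_graphs_def)
  then show "H \<in> ordered_graphs (n - 1)"
    using relabel_in_ordered_graphs[OF pair_graph_delete_vertex[of G v]] G(2,3)
    by (simp add: delete_vertex_def)
qed

end

theory Submission
  imports Defs "HOL-Library.Multiset"
begin

text \<open>Take a counterexample \<open>F\<close> of least cardinality. By minimality every \<open>S \<subseteq> F\<close>, \<open>S \<noteq> {}\<close>, has fewer than
  \<open>|S|\<close> shadows that are not shadows of \<open>F - S\<close>, and two distinct graphs share at most 8 shadows.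

  Call consecutive vertices twins if exchanging them is an automorphism, and cut each graph into
  its maximal intervals of twins, the blocks. Fix \<open>g \<in> F\<close> with the largest number \<open>s\<close> of block ends, and
  consider the graphs arising from it by redistributing the \<open>e = n - s\<close> remaining vertices over
  the blocks with at least two vertices; they correspond to multisets of size \<open>e\<close>. A shadow of the same
  kind has no other parents in \<open>F\<close>, so the multisets belonging to \<open>F\<close> have fewer shadows than elements.
  A nonzero kernel vector of the inclusion matrix then shows that there are at least \<open>e + 1\<close> of
  them and, if there are at most \<open>2 e - 2\<close>, that they include all \<open>a\<^sup>ib\<^sup>j\<close> with \<open>i + j = e\<close> for some \<open>a \<noteq> b\<close>.

  If \<open>e \<le> 1\<close>, three graphs already have too many shadows. If \<open>2 \<le> e \<le> n / 2\<close>, Cauchy-Schwarz and the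
  bound 8 do the same for \<open>e + 1\<close> graphs. If \<open>e > n / 2\<close>, the two-block family \<open>a\<^sup>ib\<^sup>j\<close> is in \<open>F\<close>, and its
  members have further shadows with fewer block ends. The few graphs of \<open>F\<close> outside the family correspond one
  to one to these shadows, by deleting a vertex in the middle of the only long block. Hence the family extends
  inside \<open>F\<close> to the cases where one of the two blocks shrinks, and the shadows of these graphs are too many.\<close>

section \<open>Deletion and blocks\<close>

text \<open>Block ends are the right measure because a deletion never increases their number and
  keeps it only if the shadow also arises from a vertex with twins on both sides
  (\<open>del_cases\<close>). Hence a parent with no more block ends than its shadow is obtained by
  enlarging a block (\<open>blow_parent\<close>), and on the top level deletion of a vertex becomes
  division of monomials, open to linear algebra. Two labels allow a kernel vector with
  \<open>e + 1\<close> elements in its support, three labels force at least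
  \<open>2 * e - 1\<close>; with fewer than \<open>n\<close> graphs this gap decides as soon as
  \<open>e > n / 2\<close>. The complementary range \<open>e \<le> n / 2\<close> accounts for the
  constant: for \<open>n = 136\<close> the inequality \<open>cubic_pos\<close> is tightest at
  \<open>e = n / 2 = 68\<close>, where it amounts to \<open>e * (e - 67) + 68 > 0\<close>. For large
  \<open>e\<close> the obstacle is that the \<open>e + 1\<close> graphs of a two-block family have
  only \<open>e\<close> shadows of their own kind, so on this level nothing is contradictory. The
  single missing shadow has to be found among those with fewer block ends, where blocks may merge
  and different members of the family may have equal shadows.\<close>

text \<open>An ordered graph is represented by its adjacency relation on \<open>{..<n}\<close>, vertices being counted from \<open>0\<close>
  and the relation being false elsewhere; \<open>skip v\<close> enumerates the vertices other than \<open>v\<close>. The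
  relation \<open>twin g p\<close> concerns \<open>p\<close> and \<open>p + 1\<close>; a block is a maximal interval of successive twins, and \<open>mid\<close> holds at
  the vertices that are neither first nor last in their block.\<close>

definition skip :: "nat \<Rightarrow> nat \<Rightarrow> nat" where
  "skip v i = (if i < v then i else Suc i)"

definition adjs :: "nat \<Rightarrow> (nat \<Rightarrow> nat \<Rightarrow> bool) set" where
  "adjs n = {g. \<forall>i j. g i j \<longrightarrow> i < n \<and> j < n \<and> i \<noteq> j \<and> g j i}"

definition del :: "(nat \<Rightarrow> nat \<Rightarrow> bool) \<Rightarrow> nat \<Rightarrow> nat \<Rightarrow> nat \<Rightarrow> bool" where
  "del g v = (\<lambda>i j. g (skip v i) (skip v j))"

definition shad :: "nat \<Rightarrow> (nat \<Rightarrow> nat \<Rightarrow> bool) \<Rightarrow> (nat \<Rightarrow> nat \<Rightarrow> bool) set" where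
  "shad n g = del g ` {..<n}"

definition twin :: "(nat \<Rightarrow> nat \<Rightarrow> bool) \<Rightarrow> nat \<Rightarrow> bool" where
  "twin g p \<longleftrightarrow> (\<forall>x. x \<noteq> p \<longrightarrow> x \<noteq> Suc p \<longrightarrow> g p x = g (Suc p) x)"

definition mid :: "nat \<Rightarrow> (nat \<Rightarrow> nat \<Rightarrow> bool) \<Rightarrow> nat \<Rightarrow> bool" where
  "mid n g y \<longleftrightarrow> 0 < y \<and> Suc y < n \<and> twin g (y - 1) \<and> twin g y"

definition ends :: "nat \<Rightarrow> (nat \<Rightarrow> nat \<Rightarrow> bool) \<Rightarrow> nat set" where
  "ends n g = {y. y < n \<and> \<not> mid n g y}"

lemma skip_simps [simp]:
  "i < v \<Longrightarrow> skip v i = i" "v \<le> i \<Longrightarrow> skip v i = Suc i"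
  by (auto simp: skip_def)

lemma skip_neq [simp]: "skip v i \<noteq> v" "v \<noteq> skip v i"
  by (auto simp: skip_def)

lemma skip_inj [simp]: "skip v i = skip v j \<longleftrightarrow> i = j"
  by (auto simp: skip_def)

lemma skip_less_iff: "v < n \<Longrightarrow> skip v i < n \<longleftrightarrow> i < n - 1"
  by (auto simp: skip_def)

lemma skip_surj: "y \<noteq> v \<Longrightarrow> \<exists>x. skip v x = y"
  by (rule exI[of _ "if y < v then y else y - 1"]) (auto simp: skip_def)

lemma adjsD: "g \<in> adjs n \<Longrightarrow> g i j \<Longrightarrow> i < n \<and> j < n \<and> i \<noteq> j \<and> g j i"
  by (auto simp: adjs_def)

lemma adjs_sym: "g \<in> adjs n \<Longrightarrow> g i j = g j i"
  by (auto simp: adjs_def)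

lemma adjs_irrefl [simp]: "g \<in> adjs n \<Longrightarrow> \<not> g i i"
  by (auto simp: adjs_def)

lemma del_adjs:
  assumes "g \<in> adjs n" "v < n"
  shows "del g v \<in> adjs (n - 1)"
  using assms skip_less_iff[of v n] by (auto simp: adjs_def del_def)

lemma finite_adjs: "finite (adjs n)"
proof -
  have "adjs n \<subseteq> (\<lambda>S i j. (i, j) \<in> S) ` Pow ({..<n} \<times> {..<n})"
  proof
    fix g assume "g \<in> adjs n"
    then have "{(i, j). g i j} \<in> Pow ({..<n} \<times> {..<n})" by (auto simp: adjs_def)
    moreover have "g = (\<lambda>i j. (i, j) \<in> {(i, j). g i j})" by simp
    ultimately show "g \<in> (\<lambda>S i j. (i, j) \<in> S) ` Pow ({..<n} \<times> {..<n})" by (rule rev_image_eqI)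
  qed
  then show ?thesis by (rule finite_subset) simp
qed

lemma finite_shad [simp]: "finite (shad n g)"
  by (simp add: shad_def)

lemma finite_ends [simp]: "finite (ends n g)"
  by (simp add: ends_def)

lemma twinD: "twin g p \<Longrightarrow> x \<noteq> p \<Longrightarrow> x \<noteq> Suc p \<Longrightarrow> g p x = g (Suc p) x"
  by (auto simp: twin_def)

lemma twinD':
  assumes "g \<in> adjs n" "twin g p" "x \<noteq> p" "x \<noteq> Suc p"
  shows "g x p = g x (Suc p)"
  using twinD[OF assms(2-4)] adjs_sym[OF assms(1)] by metis

lemma del_twin:
  assumes g: "g \<in> adjs n" and t: "twin g p"
  shows "del g (Suc p) = del g p"
proof (intro ext)
  fix i j
  consider "i = p" "j = p" | "i = p" "j \<noteq> p" | "i \<noteq> p" "j = p" | "i \<noteq> p" "j \<noteq> p" by blast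
  then show "del g (Suc p) i j = del g p i j"
  proof cases
    case 1 then show ?thesis using g by (auto simp: del_def)
  next
    case 2
    then have "skip (Suc p) j = skip p j" "skip p j \<noteq> p" "skip p j \<noteq> Suc p" by (auto simp: skip_def)
    then show ?thesis using 2 twinD[OF t, of "skip p j"] by (simp add: del_def)
  next
    case 3
    then have "skip (Suc p) i = skip p i" "skip p i \<noteq> p" "skip p i \<noteq> Suc p" by (auto simp: skip_def)
    then show ?thesis using 3 twinD'[OF g t, of "skip p i"] by (simp add: del_def)
  next
    case 4
    then have "skip (Suc p) i = skip p i" "skip (Suc p) j = skip p j" by (auto simp: skip_def)
    then show ?thesis by (simp add: del_def)
  qed
qed

lemma del_twins:
  assumes g: "g \<in> adjs n" and t: "\<And>p. u \<le> p \<Longrightarrow> p < v \<Longrightarrow> twin g p" and "u \<le> v"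
  shows "del g v = del g u"
  using \<open>u \<le> v\<close> t
proof (induction v rule: dec_induct)
  case (step m)
  have "del g (Suc m) = del g m" using del_twin[OF g] step by simp
  then show ?case using step by simp
qed simp

text \<open>On \<open>[u, w)\<close> the two enumerations differ by one,
  \<open>skip u i = Suc i\<close> and \<open>skip w i = i\<close>; elsewhere they agree. One index
  in this interval yields a shift of a row, two indices yield a shift along the diagonal
  (\<open>del_eq_diag\<close>).\<close>

lemma del_eq_shift:
  assumes g: "g \<in> adjs n" and e: "del g u = del g w" and "u \<le> i" "i < w" "x < u \<or> w < x"
  shows "g i x = g (Suc i) x"
proof (cases "x < u")
  case True
  then show ?thesis using fun_cong[OF fun_cong[OF e], of i x] assms by (simp add: del_def)
next
  case False
  then show ?thesis using fun_cong[OF fun_cong[OF e], of i "x - 1"] assms by (simp add: del_def)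
qed

lemma del_eq_diag:
  assumes e: "del g u = del g w" and "u \<le> i" "i < w" "u \<le> j" "j < w"
  shows "g (Suc i) (Suc j) = g i j"
  using fun_cong[OF fun_cong[OF e], of i j] assms by (simp add: del_def)

text \<open>Inside \<open>[u, w]\<close> the graph is invariant under the shift, and the vertex \<open>v\<close> splits the interval
  into two intervals each of which is homogeneous towards the other one.\<close>

lemma del_eq_three:
  assumes g: "g \<in> adjs n" and uv: "u < v" and vw: "v < w"
    and e1: "del g u = del g v" and e2: "del g v = del g w"
  shows "twin g (v - 1)" "twin g v"
proof -
  have e: "del g u = del g w" using e1 e2 by simp
  have low: "g v x = g (Suc v) x" if "x < v" for x
    using del_eq_shift[OF g e2 order.refl vw] that by blast
  have high: "g (v - 1) x = g v x" if "v < x" for x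
    using del_eq_shift[OF g e1, of "v - 1" x] that uv by auto
  have diag: "g (Suc i) (Suc j) = g i j" if "u \<le> i" "i < w" "u \<le> j" "j < w" for i j
    using del_eq_diag[OF e] that by blast
  have out: "g i x = g (Suc i) x" if "u \<le> i" "i < w" "x < u \<or> w < x" for i x
    using del_eq_shift[OF g e] that by blast
  show "twin g (v - 1)"
    unfolding twin_def
  proof (intro allI impI)
    fix x assume x: "x \<noteq> v - 1" "x \<noteq> Suc (v - 1)"
    consider "v < x" | "x < u" | "u \<le> x" "x < v - 1" using x uv by linarith
    then show "g (v - 1) x = g (Suc (v - 1)) x"
    proof cases
      case 1 then show ?thesis using high uv by simp
    next
      case 2 then show ?thesis using out[of "v - 1" x] uv vw by simp
    next
      case 3
      \<comment> \<open>The pair is moved one step along the diagonal, \<open>v\<close> is replaced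
        by \<open>v + 1\<close>, and the pair is moved back.\<close>
      have "g (v - 1) x = g v (Suc x)" using diag[of "v - 1" x] 3 uv vw by simp
      also have "\<dots> = g (Suc v) (Suc x)" using low 3 by simp
      also have "\<dots> = g v x" using diag[of v x] 3 uv vw by simp
      finally show ?thesis using uv by simp
    qed
  qed
  show "twin g v"
    unfolding twin_def
  proof (intro allI impI)
    fix x assume x: "x \<noteq> v" "x \<noteq> Suc v"
    consider "x < v" | "w < x" | "x \<le> w" "Suc v < x" using x uv by linarith
    then show "g v x = g (Suc v) x"
    proof cases
      case 1 then show ?thesis using low by simp
    next
      case 2 then show ?thesis using out[of v x] uv vw by simp
    next
      case 3
      have "g v x = g (v - 1) (x - 1)" using diag[of "v - 1" "x - 1"] 3 uv vw by simp
      also have "\<dots> = g v (x - 1)" using high 3 by simp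
      also have "\<dots> = g (Suc v) x" using diag[of v "x - 1"] 3 uv vw by simp
      finally show ?thesis .
    qed
  qed
qed

lemma del_eq_three_mid:
  assumes g: "g \<in> adjs n" and uv: "u < v" and vw: "v < w" and "w < n"
    and "del g u = del g v" "del g v = del g w"
  shows "mid n g v"
  using del_eq_three[OF g uv vw] assms by (auto simp: mid_def)

lemma card_le_double:
  assumes "finite A" "\<And>y. y \<in> A \<Longrightarrow> card {x \<in> A. f x = f y} \<le> 2"
  shows "card A \<le> 2 * card (f ` A)"
proof -
  have "A = (\<Union>b\<in>f ` A. {x \<in> A. f x = b})" by auto
  then have "card A \<le> (\<Sum>b\<in>f ` A. card {x \<in> A. f x = b})"
    using card_UN_le[of "f ` A" "\<lambda>b. {x \<in> A. f x = b}"] assms(1) by simp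
  also have "\<dots> \<le> (\<Sum>b\<in>f ` A. 2)" using assms(2) by (intro sum_mono) auto
  finally show ?thesis by simp
qed

lemma obtain_three:
  fixes S :: "nat set"
  assumes "3 \<le> card S"
  obtains a b c where "a \<in> S" "b \<in> S" "c \<in> S" "a < b" "b < c"
proof -
  have fin: "finite S" using assms by (cases "finite S") auto
  have ne: "S \<noteq> {}" using assms by auto
  define a where "a = Min S"
  define c where "c = Max S"
  have "card S - card {a, c} \<le> card (S - {a, c})" by (rule diff_card_le_card_Diff) simp
  moreover have "card {a, c} \<le> 2" by (simp add: card_insert_if)
  ultimately have "0 < card (S - {a, c})" using assms by linarith
  then have "S - {a, c} \<noteq> {}" by (metis card.empty less_irrefl)
  then obtain b where b: "b \<in> S" "b \<noteq> a" "b \<noteq> c" by blast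
  have "a \<le> b" "b \<le> c" using b fin by (simp_all add: a_def c_def)
  then have "a < b" "b < c" using b by simp_all
  moreover have "a \<in> S" "c \<in> S" using fin ne by (simp_all add: a_def c_def)
  ultimately show ?thesis using that b by blast
qed

text \<open>Of three vertices with the same deletion the middle one has twins on both sides, so each
  deletion comes from at most two block ends.\<close>

lemma ends_le_shad:
  assumes g: "g \<in> adjs n"
  shows "card (ends n g) \<le> 2 * card (shad n g)"
proof -
  have "card (ends n g) \<le> 2 * card (del g ` ends n g)"
  proof (rule card_le_double)
    fix y assume y: "y \<in> ends n g"
    show "card {x \<in> ends n g. del g x = del g y} \<le> 2"
    proof (rule ccontr)
      assume "\<not> ?thesis"
      then have "3 \<le> card {x \<in> ends n g. del g x = del g y}" by simp
      from obtain_three[OF this] obtain a b c where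
        "a < b" "b < c" "b \<in> ends n g" "c \<in> ends n g" "del g a = del g b" "del g b = del g c"
        by (smt (verit) mem_Collect_eq)
      then show False using del_eq_three_mid[OF g, of a b c] by (auto simp: ends_def)
    qed
  qed simp
  also have "\<dots> \<le> 2 * card (shad n g)"
    by (intro mult_le_mono2 card_mono) (auto simp: shad_def ends_def)
  finally show ?thesis .
qed

text \<open>Only the test vertex \<open>v\<close> is lost, and it is replaceable: towards pairs
  before it \<open>v + 1\<close> behaves like \<open>v\<close>, towards pairs after it
  \<open>v - 1\<close> does. The pair that closes up around \<open>v\<close> consists of two twins
  of \<open>v\<close>.\<close>

lemma twin_del:
  assumes g: "g \<in> adjs n" and v: "twin g (v - 1)" "twin g v" "0 < v"
  shows "twin (del g v) x \<longleftrightarrow> (if Suc x < v then twin g x else if Suc x = v then True else twin g (Suc x))"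
proof -
  define u where "u = v - 1"
  have vu: "v = Suc u" using v(3) by (simp add: u_def)
  have tu: "twin g u" and tv: "twin g (Suc u)" using v vu by auto
  have a: "g u y = g (Suc u) y" if "y \<noteq> u" "y \<noteq> Suc u" for y using twinD[OF tu] that by blast
  have b: "g (Suc u) y = g (Suc (Suc u)) y" if "y \<noteq> Suc u" "y \<noteq> Suc (Suc u)" for y
    using twinD[OF tv] that by blast
  note s = adjs_sym[OF g]
  have dt: "twin (del g v) x \<longleftrightarrow> (\<forall>y. y \<noteq> v \<longrightarrow> y \<noteq> skip v x \<longrightarrow> y \<noteq> skip v (Suc x) \<longrightarrow>
      g (skip v x) y = g (skip v (Suc x)) y)"
    unfolding twin_def del_def using skip_surj[of _ v] by (metis skip_inj skip_neq(1))
  consider "Suc x < v" | "Suc x = v" | "v \<le> x" by linarith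
  then show ?thesis
  proof cases
    case 1
    have "g x v = g x (Suc v)" "g (Suc x) v = g (Suc x) (Suc v)"
      using b[of x] b[of "Suc x"] 1 s vu by (metis Suc_inject less_Suc_eq less_irrefl not_less_eq)+
    moreover have "Suc v \<noteq> x" "Suc v \<noteq> Suc x" using 1 by auto
    ultimately have "twin (del g v) x \<longleftrightarrow> twin g x"
      unfolding dt using 1 by (auto simp: twin_def)
    then show ?thesis using 1 by simp
  next
    case 2
    then have "twin (del g v) x" unfolding dt using a b vu by auto
    then show ?thesis using 2 by simp
  next
    case 3
    have "g (Suc x) v = g (Suc x) u" "g (Suc (Suc x)) v = g (Suc (Suc x)) u"
      using a[of "Suc x"] a[of "Suc (Suc x)"] 3 s vu by (metis Suc_leD not_less_eq_eq)+
    moreover have "u \<noteq> v" "u \<noteq> Suc x" "u \<noteq> Suc (Suc x)" using vu 3 by auto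
    ultimately have "twin (del g v) x \<longleftrightarrow> twin g (Suc x)"
      unfolding dt using 3 by (auto simp: twin_def)
    then show ?thesis using 3 by simp
  qed
qed

text \<open>The block of \<open>v\<close> has at least three vertices, hence keeps two ends.\<close>

lemma ends_del_mid:
  assumes g: "g \<in> adjs n" and m: "mid n g v"
  shows "card (ends (n - 1) (del g v)) = card (ends n g)"
proof -
  have v: "twin g (v - 1)" "twin g v" "0 < v" "Suc v < n" using m by (auto simp: mid_def)
  note td = twin_del[OF g v(1-3)]
  have mm: "mid (n - 1) (del g v) x \<longleftrightarrow> mid n g (skip v x)" for x
  proof -
    consider "Suc x < v" | "Suc x = v" | "x = v" | "v < x" by linarith
    then show ?thesis
    proof cases
      case 1 then show ?thesis using v by (auto simp: mid_def td)
    next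
      case 2 then show ?thesis using v by (cases x) (auto simp: mid_def td)
    next
      case 3 then show ?thesis using v by (auto simp: mid_def td)
    next
      case 4 then show ?thesis using v by (auto simp: mid_def td)
    qed
  qed
  have "ends n g = skip v ` ends (n - 1) (del g v)"
  proof (intro set_eqI iffI)
    fix y assume y: "y \<in> ends n g"
    then have "y \<noteq> v" using m by (auto simp: ends_def)
    then obtain x where "skip v x = y" using skip_surj by blast
    then show "y \<in> skip v ` ends (n - 1) (del g v)"
      using y mm v skip_less_iff[of v n x] by (auto simp: ends_def)
  next
    fix y assume "y \<in> skip v ` ends (n - 1) (del g v)"
    then show "y \<in> ends n g" using mm v skip_less_iff[of v n] by (auto simp: ends_def)
  qed
  then show ?thesis by (simp add: card_image inj_on_def)
qed

lemma twin_del_far: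
  assumes "twin g p" "v \<noteq> p" "v \<noteq> Suc p" "skip v x = p"
  shows "twin (del g v) x"
proof -
  have "skip v (Suc x) = Suc p" using assms by (auto simp: skip_def split: if_splits)
  then show ?thesis using assms unfolding twin_def del_def by (metis skip_inj)
qed

text \<open>Twins other than \<open>v\<close> stay twins, so a mid vertex can become a block end
  only if it is a neighbour of \<open>v\<close>. The hypotheses exclude this, and the end
  \<open>v\<close> itself disappears.\<close>

lemma ends_del_less:
  assumes g: "g \<in> adjs n" and v: "v < n"
    and nm: "\<not> mid n g v" "\<not> mid n g (Suc v)" "0 < v \<Longrightarrow> \<not> mid n g (v - 1)"
  shows "card (ends (n - 1) (del g v)) < card (ends n g)"
proof -
  have "skip v ` ends (n - 1) (del g v) \<subseteq> ends n g - {v}"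
  proof
    fix y assume "y \<in> skip v ` ends (n - 1) (del g v)"
    then obtain x where x: "x < n - 1" "\<not> mid (n - 1) (del g v) x" "y = skip v x"
      by (auto simp: ends_def)
    have "y < n" using x v skip_less_iff by auto
    moreover have "\<not> mid n g y"
    proof
      assume m: "mid n g y"
      have ne: "y \<noteq> v" "y \<noteq> Suc v" using m nm x(3) by auto
      have ne3: "Suc y \<noteq> v"
      proof
        assume "Suc y = v"
        then have "v - 1 = y" "0 < v" by auto
        with m nm(3) show False by simp
      qed
      have y0: "0 < y" "Suc y < n" "twin g (y - 1)" "twin g y" using m by (auto simp: mid_def)
      have "twin (del g v) x"
        using twin_del_far[OF y0(4) ne(1)[symmetric] ne3[symmetric] x(3)[symmetric]] .
      have x0: "0 < x" using x(3) ne ne3 y0 by (cases x) (auto simp: skip_def split: if_splits)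
      have "skip v (x - 1) = y - 1" using x(3) ne ne3 y0 x0 by (auto simp: skip_def split: if_splits)
      moreover have "v \<noteq> y - 1" "v \<noteq> Suc (y - 1)" using ne ne3 y0(1) by auto
      ultimately have "twin (del g v) (x - 1)" using twin_del_far[OF y0(3)] by blast
      have "Suc x < n - 1" using x(3) ne ne3 y0 v by (auto simp: skip_def split: if_splits)
      then show False using x(2) x0 \<open>twin (del g v) x\<close> \<open>twin (del g v) (x - 1)\<close> by (simp add: mid_def)
    qed
    ultimately show "y \<in> ends n g - {v}" using x by (simp add: ends_def)
  qed
  moreover have "v \<in> ends n g" using v nm by (simp add: ends_def)
  ultimately have "skip v ` ends (n - 1) (del g v) \<subset> ends n g" by blast
  then have "card (skip v ` ends (n - 1) (del g v)) < card (ends n g)"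
    by (intro psubset_card_mono) auto
  then show ?thesis by (simp add: card_image inj_on_def)
qed

text \<open>A neighbour of a mid vertex is its twin and has the same deletion. So a shadow that does
  not lose block ends is the deletion of a mid vertex, which can be put back
  (\<open>blow_insert\<close>).\<close>

lemma del_cases:
  assumes g: "g \<in> adjs n" and v: "v < n"
  obtains (less) "card (ends (n - 1) (del g v)) < card (ends n g)"
        "\<not> mid n g v" "\<not> mid n g (Suc v)" "0 < v \<Longrightarrow> \<not> mid n g (v - 1)"
    | (mid) y where "mid n g y" "del g v = del g y" "v \<le> Suc y" "y \<le> Suc v"
proof (cases "mid n g v \<or> mid n g (Suc v) \<or> (0 < v \<and> mid n g (v - 1))")
  case False
  then show ?thesis using ends_del_less[OF g v] less by blast
next
  case True
  then consider "mid n g v" | "mid n g (Suc v)" | "0 < v" "mid n g (v - 1)" by blast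
  then show ?thesis
  proof cases
    case 1 then show ?thesis using mid by auto
  next
    case 2
    then show ?thesis using mid[of "Suc v"] del_twin[OF g, of v] by (auto simp: mid_def)
  next
    case 3
    then show ?thesis using mid[of "v - 1"] del_twin[OF g, of "v - 1"] by (auto simp: mid_def)
  qed
qed

lemma ends_del_le:
  assumes "g \<in> adjs n" "v < n"
  shows "card (ends (n - 1) (del g v)) \<le> card (ends n g)"
  by (rule del_cases[OF assms]) (use ends_del_mid[OF assms(1)] in auto)

section \<open>Multisets with a small shadow\<close>

text \<open>Gaussian elimination: the equation \<open>b\<close>, with a nonzero coefficient at
  \<open>c\<close>, removes the unknown \<open>c\<close> from the other equations.\<close>

lemma kernel_exists:
  fixes M :: "'b \<Rightarrow> 'a \<Rightarrow> real"
  assumes "finite B" "finite A" "card B < card A"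
  shows "\<exists>g. (\<exists>a\<in>A. g a \<noteq> 0) \<and> (\<forall>a. a \<notin> A \<longrightarrow> g a = 0) \<and> (\<forall>b\<in>B. (\<Sum>a\<in>A. M b a * g a) = 0)"
  using assms
proof (induction B arbitrary: A M rule: finite_induct)
  case empty
  then obtain a where "a \<in> A" by fastforce
  then show ?case by (intro exI[of _ "\<lambda>x. if x = a then 1 else 0"]) auto
next
  case (insert b B)
  show ?case
  proof (cases "\<forall>a\<in>A. M b a = 0")
    case True
    have "card B < card A" using insert by simp
    then obtain g where g: "\<exists>a\<in>A. g a \<noteq> 0" "\<forall>a. a \<notin> A \<longrightarrow> g a = 0" "\<forall>b\<in>B. (\<Sum>a\<in>A. M b a * g a) = 0"
      using insert.IH[of A M] insert.prems by blast
    then show ?thesis using True by (intro exI[of _ g]) auto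
  next
    case False
    then obtain c where c: "c \<in> A" "M b c \<noteq> 0" by blast
    define A' where "A' = A - {c}"
    define M' where "M' = (\<lambda>d a. M d a - M d c * M b a / M b c)"
    have fin: "finite A'" "card B < card A'" using insert c by (auto simp: A'_def)
    then obtain g where g: "\<exists>a\<in>A'. g a \<noteq> 0" "\<forall>a. a \<notin> A' \<longrightarrow> g a = 0"
        "\<forall>d\<in>B. (\<Sum>a\<in>A'. M' d a * g a) = 0"
      using insert.IH[of A' M'] by blast
    define t where "t = - (\<Sum>a\<in>A'. M b a * g a) / M b c"
    define h where "h = g(c := t)"
    have split: "(\<Sum>a\<in>A. M d a * h a) = M d c * t + (\<Sum>a\<in>A'. M d a * g a)" for d
    proof -
      have "(\<Sum>a\<in>A. M d a * h a) = M d c * h c + (\<Sum>a\<in>A'. M d a * h a)"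
        using c insert.prems by (simp add: A'_def sum.remove)
      moreover have "(\<Sum>a\<in>A'. M d a * h a) = (\<Sum>a\<in>A'. M d a * g a)"
        by (rule sum.cong) (auto simp: h_def A'_def)
      ultimately show ?thesis by (simp add: h_def)
    qed
    have "(\<Sum>a\<in>A. M d a * h a) = 0" if "d \<in> insert b B" for d
    proof (cases "d = b")
      case True
      then show ?thesis using c by (simp add: split t_def)
    next
      case False
      then have "(\<Sum>a\<in>A'. M' d a * g a) = 0" using g that by blast
      then have "(\<Sum>a\<in>A'. M d a * g a) = M d c / M b c * (\<Sum>a\<in>A'. M b a * g a)"
        by (simp add: M'_def left_diff_distrib sum_subtractf sum_distrib_left mult.assoc)
      then show ?thesis by (simp add: split t_def)
    qed
    moreover have "\<exists>a\<in>A. h a \<noteq> 0" using g by (auto simp: h_def A'_def)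
    moreover have "\<forall>a. a \<notin> A \<longrightarrow> h a = 0" using g c by (auto simp: h_def A'_def)
    ultimately show ?thesis by blast
  qed
qed

text \<open>Kernel vectors of the inclusion matrix between multisets of sizes \<open>e - 1\<close> and \<open>e\<close> over \<open>V\<close>.\<close>

definition ker :: "'a set \<Rightarrow> nat \<Rightarrow> ('a multiset \<Rightarrow> real) \<Rightarrow> bool" where
  "ker V e g \<longleftrightarrow> finite V \<and> (\<forall>\<alpha>. g \<alpha> \<noteq> 0 \<longrightarrow> size \<alpha> = e \<and> set_mset \<alpha> \<subseteq> V) \<and>
     (\<forall>\<beta>. (\<Sum>i\<in>V. g (add_mset i \<beta>)) = 0)"

definition supp :: "('a multiset \<Rightarrow> real) \<Rightarrow> 'a multiset set" where
  "supp g = {\<alpha>. g \<alpha> \<noteq> 0}"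

definition vars :: "('a multiset \<Rightarrow> real) \<Rightarrow> 'a set" where
  "vars g = \<Union> (set_mset ` supp g)"

text \<open>The formal quotient by \<open>z\<close>, if multisets are read as monomials. It leads
  from kernel vectors to kernel vectors of one degree less (\<open>ker_link\<close>), which drives
  the inductions on \<open>e\<close>.\<close>

definition link :: "'a \<Rightarrow> ('a multiset \<Rightarrow> real) \<Rightarrow> 'a multiset \<Rightarrow> real" where
  "link z g = (\<lambda>\<gamma>. g (add_mset z \<gamma>))"

lemma finite_msets_size: "finite V \<Longrightarrow> finite {\<alpha>. size \<alpha> = e \<and> set_mset \<alpha> \<subseteq> V}"
proof -
  assume "finite V"
  have "{\<alpha>. size \<alpha> = e \<and> set_mset \<alpha> \<subseteq> V} \<subseteq> mset ` {xs. set xs \<subseteq> V \<and> length xs = e}"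
  proof
    fix \<alpha> assume a: "\<alpha> \<in> {\<alpha>. size \<alpha> = e \<and> set_mset \<alpha> \<subseteq> V}"
    obtain xs where "mset xs = \<alpha>" using ex_mset by blast
    then show "\<alpha> \<in> mset ` {xs. set xs \<subseteq> V \<and> length xs = e}" using a by (force intro: rev_image_eqI)
  qed
  then show ?thesis using finite_lists_length_eq[OF \<open>finite V\<close>] finite_surj by blast
qed

lemma finite_supp: "ker V e g \<Longrightarrow> finite (supp g)"
  by (rule finite_subset[OF _ finite_msets_size[of V e]]) (auto simp: ker_def supp_def)

lemma ker_link: "ker V (Suc e) g \<Longrightarrow> ker V e (link z g)"
  unfolding ker_def link_def by (fastforce simp: add_mset_commute)

lemma supp_link: "{\<alpha> \<in> supp g. z \<in># \<alpha>} = add_mset z ` supp (link z g)"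
  by (auto simp: supp_def link_def image_iff) (metis insert_DiffM)

lemma card_supp_link: "card {\<alpha> \<in> supp g. z \<in># \<alpha>} = card (supp (link z g))"
  by (simp add: supp_link card_image inj_on_def)

lemma card_supp_split:
  assumes "ker V e g"
  shows "card (supp g) = card (supp (link z g)) + card {\<alpha> \<in> supp g. z \<notin># \<alpha>}"
proof -
  have "supp g = {\<alpha> \<in> supp g. z \<in># \<alpha>} \<union> {\<alpha> \<in> supp g. z \<notin># \<alpha>}" by auto
  moreover have "finite (supp g)" using assms by (rule finite_supp)
  ultimately show ?thesis
    using card_Un_disjoint[of "{\<alpha> \<in> supp g. z \<in># \<alpha>}" "{\<alpha> \<in> supp g. z \<notin># \<alpha>}"]
    by (auto simp: card_supp_link)
qed

text \<open>A vanishing sum cannot have exactly one nonzero term.\<close>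

lemma ker_swap:
  assumes k: "ker V e g" and a: "\<alpha> \<in> supp g" "i \<in># \<alpha>"
  shows "\<exists>j. j \<noteq> i \<and> add_mset j (\<alpha> - {#i#}) \<in> supp g"
proof (rule ccontr)
  assume n: "\<not> ?thesis"
  have fin: "finite V" and iV: "i \<in> V" and z: "(\<Sum>j\<in>V. g (add_mset j (\<alpha> - {#i#}))) = 0"
    using k a by (auto simp: ker_def supp_def)
  have "(\<Sum>j\<in>V. g (add_mset j (\<alpha> - {#i#}))) = g \<alpha> + (\<Sum>j\<in>V - {i}. g (add_mset j (\<alpha> - {#i#})))"
    using fin iV a(2) by (simp add: sum.remove[of V i])
  also have "(\<Sum>j\<in>V - {i}. g (add_mset j (\<alpha> - {#i#}))) = 0"
    using n by (intro sum.neutral) (auto simp: supp_def)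
  finally show False using z a by (simp add: supp_def)
qed

text \<open>An element of the support with the fewest copies of \<open>z\<close> has none, since
  \<open>ker_swap\<close> would replace one of them by another label.\<close>

lemma ker_avoid:
  assumes k: "ker V e g" and ne: "supp g \<noteq> {}"
  shows "{\<alpha> \<in> supp g. z \<notin># \<alpha>} \<noteq> {}"
proof -
  obtain \<alpha> where a: "\<alpha> \<in> supp g" "\<And>\<beta>. \<beta> \<in> supp g \<Longrightarrow> count \<alpha> z \<le> count \<beta> z"
    using ex_has_least_nat[of "\<lambda>x. x \<in> supp g" _ "\<lambda>x. count x z"] ne by blast
  have "z \<notin># \<alpha>"
  proof
    assume z: "z \<in># \<alpha>"
    obtain j where j: "j \<noteq> z" "add_mset j (\<alpha> - {#z#}) \<in> supp g" using ker_swap[OF k a(1) z] by blast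
    have "count (add_mset j (\<alpha> - {#z#})) z = count \<alpha> z - 1" using j(1) by simp
    moreover have "0 < count \<alpha> z" using z by simp
    ultimately show False using a(2)[OF j(2)] by linarith
  qed
  then show ?thesis using a by blast
qed

lemma supp_link_nonempty: "z \<in> vars g \<Longrightarrow> supp (link z g) \<noteq> {}"
  using supp_link[of g z] by (auto simp: vars_def)

text \<open>The elements containing \<open>z\<close> are counted by the link of \<open>z\<close>, of
  degree one less, and at least one element avoids \<open>z\<close>.\<close>

lemma card_supp_ge:
  assumes "ker V e g" "supp g \<noteq> {}"
  shows "Suc e \<le> card (supp g)"
  using assms
proof (induction e arbitrary: g)
  case 0
  then show ?case using finite_supp[OF 0(1)] by (simp add: Suc_le_eq card_gt_0_iff)
next
  case (Suc e)
  then obtain \<alpha> where a: "\<alpha> \<in> supp g" by blast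
  then have "size \<alpha> = Suc e" using Suc.prems(1) by (simp add: ker_def supp_def)
  then have "\<alpha> \<noteq> {#}" by auto
  then obtain z where "z \<in># \<alpha>" by (rule multiset_nonemptyE)
  then have z: "z \<in> vars g" using a by (auto simp: vars_def)
  have "Suc e \<le> card (supp (link z g))"
    using Suc.IH[OF ker_link[OF Suc.prems(1)] supp_link_nonempty[OF z]] .
  moreover have "0 < card {\<alpha> \<in> supp g. z \<notin># \<alpha>}"
    using ker_avoid[OF Suc.prems] finite_supp[OF Suc.prems(1)] by (simp add: card_gt_0_iff)
  ultimately show ?case using card_supp_split[OF Suc.prems(1), of z] by simp
qed

definition two_mset :: "'a \<Rightarrow> nat \<Rightarrow> 'a \<Rightarrow> nat \<Rightarrow> 'a multiset" where
  "two_mset a i b j = replicate_mset i a + replicate_mset j b"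

text \<open>There are only \<open>e + 1\<close> monomials of degree \<open>e\<close> in
  \<open>a\<close> and \<open>b\<close>, and \<open>card_supp_ge\<close> requires all of
  them.\<close>

lemma two_vars:
  assumes k: "ker V e g" and ne: "supp g \<noteq> {}" and v: "vars g \<subseteq> {a, b}" "a \<noteq> b"
  shows "supp g = (\<lambda>i. two_mset a i b (e - i)) ` {..e}"
proof (rule card_subset_eq)
  show "supp g \<subseteq> (\<lambda>i. two_mset a i b (e - i)) ` {..e}"
  proof
    fix \<alpha> assume a: "\<alpha> \<in> supp g"
    have sz: "size \<alpha> = e" using a k by (simp add: ker_def supp_def)
    have st: "set_mset \<alpha> \<subseteq> {a, b}" using a v by (auto simp: vars_def)
    have c0: "count \<alpha> x = 0" if "x \<noteq> a" "x \<noteq> b" for x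
      using st that by (auto simp: count_eq_zero_iff)
    have eq: "\<alpha> = two_mset a (count \<alpha> a) b (count \<alpha> b)"
      using c0 v(2) by (intro multiset_eqI) (auto simp: two_mset_def)
    then have "size \<alpha> = count \<alpha> a + count \<alpha> b" by (metis size_replicate_mset size_union two_mset_def)
    then have "count \<alpha> b = e - count \<alpha> a" "count \<alpha> a \<le> e" using sz by auto
    then show "\<alpha> \<in> (\<lambda>i. two_mset a i b (e - i)) ` {..e}" using eq by auto
  qed
  have "card ((\<lambda>i. two_mset a i b (e - i)) ` {..e}) \<le> Suc e" 
    using card_image_le[of "{..e}" "\<lambda>i. two_mset a i b (e - i)"] by simp
  then show "card (supp g) = card ((\<lambda>i. two_mset a i b (e - i)) ` {..e})"
    using card_supp_ge[OF k ne] card_mono[OF _ \<open>supp g \<subseteq> _\<close>] by simp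
qed simp

section \<open>Supports with a single element avoiding a label\<close>

lemma finite_submsets: "finite {\<delta>. \<delta> \<subseteq># \<alpha>}"
proof -
  have "{\<delta>. \<delta> \<subseteq># \<alpha>} \<subseteq> (\<Union>e\<le>size \<alpha>. {\<delta>. size \<delta> = e \<and> set_mset \<delta> \<subseteq> set_mset \<alpha>})"
    by (auto dest: mset_subset_eqD size_mset_mono)
  then show ?thesis by (rule finite_subset) (simp add: finite_msets_size)
qed

text \<open>The number of divisors of a monomial. It is at least \<open>2 * (k + 1)\<close> for
  \<open>x^k * w\<close>, and each further factor \<open>w\<close> brings at least two new divisors:
  the whole product and the product divided by some \<open>u \<noteq> w\<close>.\<close>

lemma card_submsets:
  assumes "2 \<le> card (set_mset \<alpha>)"
  shows "2 * size \<alpha> \<le> card {\<delta>. \<delta> \<subseteq># \<alpha>}"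
  using assms
proof (induction \<alpha>)
  case (add w \<alpha>)
  show ?case
  proof (cases "2 \<le> card (set_mset \<alpha>)")
    case True
    have "\<exists>u \<in> set_mset \<alpha>. u \<noteq> w"
    proof (rule ccontr)
      assume "\<not> ?thesis"
      then have "set_mset \<alpha> \<subseteq> {w}" by auto
      then show False using True card_mono[of "{w}" "set_mset \<alpha>"] by simp
    qed
    then obtain u where u: "u \<in># \<alpha>" "u \<noteq> w" by blast
    define \<gamma> where "\<gamma> = add_mset w (\<alpha> - {#u#})"
    have g: "\<gamma> \<subseteq># add_mset w \<alpha>" by (simp add: \<gamma>_def)
    have ng: "\<not> \<gamma> \<subseteq># \<alpha>" and ng': "\<not> add_mset w \<alpha> \<subseteq># \<alpha>"
      using mset_subset_eq_count[of \<gamma> \<alpha> w] mset_subset_eq_count[of "add_mset w \<alpha>" \<alpha> w] u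
      by (auto simp: \<gamma>_def)
    have "0 < count \<alpha> u" using u by simp
    then have "count \<gamma> u < count (add_mset w \<alpha>) u" using u(2) by (simp add: \<gamma>_def)
    then have "\<gamma> \<noteq> add_mset w \<alpha>" by auto
    have "\<alpha> \<subseteq># add_mset w \<alpha>" by (simp add: subseteq_mset_def)
    then have "\<delta> \<subseteq># add_mset w \<alpha>" if "\<delta> \<subseteq># \<alpha>" for \<delta> using that by (rule subset_mset.order_trans[rotated])
    then have "{\<delta>. \<delta> \<subseteq># \<alpha>} \<union> {\<gamma>, add_mset w \<alpha>} \<subseteq> {\<delta>. \<delta> \<subseteq># add_mset w \<alpha>}"
      using g by blast
    then have "card ({\<delta>. \<delta> \<subseteq># \<alpha>} \<union> {\<gamma>, add_mset w \<alpha>}) \<le> card {\<delta>. \<delta> \<subseteq># add_mset w \<alpha>}"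
      by (intro card_mono finite_submsets)
    moreover have "card ({\<delta>. \<delta> \<subseteq># \<alpha>} \<union> {\<gamma>, add_mset w \<alpha>}) = card {\<delta>. \<delta> \<subseteq># \<alpha>} + 2"
      using ng ng' \<open>\<gamma> \<noteq> add_mset w \<alpha>\<close> by (subst card_Un_disjoint) (auto simp: finite_submsets)
    ultimately show ?thesis using add.IH[OF True] by simp
  next
    case False
    have "card (insert w (set_mset \<alpha>)) \<le> Suc (card (set_mset \<alpha>))" by (rule card_insert_le_m1) simp_all
    then have "card (set_mset \<alpha>) = 1" using add.prems False by simp
    then obtain x where x: "set_mset \<alpha> = {x}" by (rule card_1_singletonE)
    have wx: "w \<noteq> x" using add.prems x by auto
    define k where "k = size \<alpha>"
    have al: "\<alpha> = replicate_mset k x" using x set_mset_subset_singletonD[of \<alpha> x] by (simp add: k_def)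
    let ?f = "\<lambda>(i, c). replicate_mset i x + replicate_mset c w"
    have "inj_on ?f ({..k} \<times> {..1})"
    proof (rule inj_onI, clarify)
      fix i c i' c' assume e: "replicate_mset i x + replicate_mset c w = replicate_mset i' x + replicate_mset c' w"
      show "i = i' \<and> c = c'"
        using arg_cong[OF e, of "\<lambda>m. count m x"] arg_cong[OF e, of "\<lambda>m. count m w"] wx by simp
    qed
    moreover have "?f ` ({..k} \<times> {..1}) \<subseteq> {\<delta>. \<delta> \<subseteq># add_mset w \<alpha>}"
      using wx by (auto simp: al subseteq_mset_def)
    ultimately have "card ({..k} \<times> {..1::nat}) \<le> card {\<delta>. \<delta> \<subseteq># add_mset w \<alpha>}"
      using card_mono[OF finite_submsets] by (metis card_image)
    then show ?thesis by (simp add: k_def)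
  qed
qed simp

text \<open>The kernel equation at \<open>\<delta> + replicate_mset k z\<close> expresses the value
  with \<open>k + 1\<close> copies of \<open>z\<close> by values with \<open>k\<close> copies. The
  nonzero ones among these have the same sign, so nothing cancels, and the support has exactly one
  element for each submultiset of \<open>\<alpha>\<close>.\<close>

lemma ker_unique_avoid:
  assumes k: "ker V e g" and one: "{\<alpha> \<in> supp g. z \<notin># \<alpha>} = {\<alpha>}" and zV: "z \<in> V"
    and d: "z \<notin># \<delta>" "size \<delta> + k = e"
  shows "if \<delta> \<subseteq># \<alpha> then 0 < (-1) ^ k * g \<alpha> * g (\<delta> + replicate_mset k z) else g (\<delta> + replicate_mset k z) = 0"
  using d
proof (induction k arbitrary: \<delta>)
  case 0
  have a: "\<alpha> \<in> supp g" "z \<notin># \<alpha>" using one by auto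
  have sa: "size \<alpha> = e" using a k by (simp add: ker_def supp_def)
  show ?case
  proof (cases "\<delta> \<subseteq># \<alpha>")
    case True
    then have "\<delta> = \<alpha>" using 0 sa mset_subset_size[of \<delta> \<alpha>] by (auto simp: subset_mset.le_less)
    moreover have "0 < g \<alpha> * g \<alpha>" using a by (simp add: supp_def flip: power2_eq_square)
    ultimately show ?thesis using True by simp
  next
    case False
    then have "\<delta> \<noteq> \<alpha>" by auto
    then have "\<delta> \<notin> supp g" using one 0 by auto
    then show ?thesis using False by (simp add: supp_def)
  qed
next
  case (Suc k)
  have fin: "finite V" using assms by (simp add: ker_def)
  have a: "\<alpha> \<in> supp g" "z \<notin># \<alpha>" using one by auto
  have sa: "size \<alpha> = e" "set_mset \<alpha> \<subseteq> V" using a \<open>ker V e g\<close> by (simp_all add: ker_def supp_def)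
  let ?s = "\<lambda>i. g (add_mset i \<delta> + replicate_mset k z)"
  have "(\<Sum>i\<in>V. g (add_mset i (\<delta> + replicate_mset k z))) = 0" using assms by (simp add: ker_def)
  then have "g (\<delta> + replicate_mset (Suc k) z) + (\<Sum>i\<in>V - {z}. ?s i) = 0"
    using fin zV by (simp add: sum.remove[of V z])
  then have eq: "g (\<delta> + replicate_mset (Suc k) z) = - (\<Sum>i\<in>V - {z}. ?s i)" by simp
  have IH: "if add_mset i \<delta> \<subseteq># \<alpha> then 0 < (-1) ^ k * g \<alpha> * ?s i else ?s i = 0" if "i \<noteq> z" for i
    using Suc.IH[of "add_mset i \<delta>"] Suc.prems that by simp
  show ?case
  proof (cases "\<delta> \<subseteq># \<alpha>")
    case True
    obtain \<gamma> where ga: "\<alpha> = \<delta> + \<gamma>" using True by (auto simp: mset_subset_eq_exists_conv)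
    then have "\<gamma> \<noteq> {#}" using sa Suc.prems by auto
    then obtain i \<gamma>' where "\<gamma> = add_mset i \<gamma>'" by (meson multiset_cases)
    then have i: "add_mset i \<delta> \<subseteq># \<alpha>" using ga by simp
    then have "i \<in># \<alpha>" by (rule mset_subset_eqD) simp
    then have iV: "i \<in> V - {z}" using sa a by auto
    have "0 < (\<Sum>i\<in>V - {z}. (-1) ^ k * g \<alpha> * ?s i)"
    proof (rule sum_pos2[of _ i])
      show "0 < (-1) ^ k * g \<alpha> * ?s i" using IH[of i] iV i by simp
      show "0 \<le> (-1) ^ k * g \<alpha> * ?s j" if "j \<in> V - {z}" for j
        using IH[of j] that by (cases "add_mset j \<delta> \<subseteq># \<alpha>") auto
    qed (use fin iV in auto)
    then have "0 < (-1) ^ k * g \<alpha> * (\<Sum>i\<in>V - {z}. ?s i)" by (simp add: sum_distrib_left)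
    then show ?thesis using True by (simp only: eq) simp
  next
    case False
    moreover have "\<delta> \<subseteq># add_mset i \<delta>" for i by (simp add: subseteq_mset_def)
    ultimately have "\<not> add_mset i \<delta> \<subseteq># \<alpha>" for i using subset_mset.order_trans by blast
    then have "(\<Sum>i\<in>V - {z}. ?s i) = 0" using IH by (intro sum.neutral) auto
    then show ?thesis using False by (simp only: eq) simp
  qed
qed

text \<open>By \<open>ker_unique_avoid\<close> the support corresponds to the submultisets of
  \<open>\<alpha>\<close>. Apart from \<open>z\<close> all labels occur in \<open>\<alpha>\<close>,
  so it has at least two of them and \<open>card_submsets\<close> applies.\<close>

lemma card_supp_unique_avoid:
  assumes k: "ker V e g" and one: "{\<alpha> \<in> supp g. z \<notin># \<alpha>} = {\<alpha>}" and zV: "z \<in> V"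
    and v: "3 \<le> card (vars g)"
  shows "2 * e \<le> card (supp g)"
proof -
  have a: "\<alpha> \<in> supp g" "z \<notin># \<alpha>" using one by auto
  have sa: "size \<alpha> = e" using a k by (simp add: ker_def supp_def)
  have "vars g \<subseteq> insert z (set_mset \<alpha>)"
  proof
    fix x assume "x \<in> vars g"
    then obtain \<xi> where xi: "\<xi> \<in> supp g" "x \<in># \<xi>" by (auto simp: vars_def)
    define \<delta> where "\<delta> = filter_mset (\<lambda>y. y \<noteq> z) \<xi>"
    have e: "\<xi> = \<delta> + replicate_mset (count \<xi> z) z" by (intro multiset_eqI) (simp add: \<delta>_def)
    have zd: "z \<notin># \<delta>" by (simp add: \<delta>_def)
    have "size \<delta> + count \<xi> z = e"
      using arg_cong[OF e, of size] xi k by (simp add: ker_def supp_def)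
    from ker_unique_avoid[OF k one zV zd this] have "\<delta> \<subseteq># \<alpha>"
      using xi e by (auto simp: supp_def split: if_splits)
    then have "set_mset \<delta> \<subseteq> set_mset \<alpha>" by (rule set_mset_mono)
    moreover have "x = z \<or> x \<in># \<delta>" using xi by (simp add: \<delta>_def)
    ultimately show "x \<in> insert z (set_mset \<alpha>)" by auto
  qed
  then have "3 \<le> card (insert z (set_mset \<alpha>))" using v card_mono[of "insert z (set_mset \<alpha>)" "vars g"] by simp
  then have "2 \<le> card (set_mset \<alpha>)" using a by (simp add: card_insert_if)
  then have "2 * e \<le> card {\<delta>. \<delta> \<subseteq># \<alpha>}" using card_submsets sa by blast
  also have "\<dots> \<le> card (supp g)"
  proof (rule card_inj_on_le[OF _ _ finite_supp[OF k]])
    let ?f = "\<lambda>\<delta>. \<delta> + replicate_mset (e - size \<delta>) z"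
    have zd: "z \<notin># \<delta>" if "\<delta> \<subseteq># \<alpha>" for \<delta> using that a(2) mset_subset_eqD by metis
    show "inj_on ?f {\<delta>. \<delta> \<subseteq># \<alpha>}"
    proof (rule inj_on_inverseI[where g = "filter_mset (\<lambda>y. y \<noteq> z)"])
      fix \<delta> assume "\<delta> \<in> {\<delta>. \<delta> \<subseteq># \<alpha>}"
      then have "z \<notin># \<delta>" using zd by simp
      then show "filter_mset (\<lambda>y. y \<noteq> z) (\<delta> + replicate_mset (e - size \<delta>) z) = \<delta>"
        by (intro multiset_eqI) (auto simp: count_eq_zero_iff)
    qed
    show "?f ` {\<delta>. \<delta> \<subseteq># \<alpha>} \<subseteq> supp g"
    proof clarify
      fix \<delta> assume d: "\<delta> \<subseteq># \<alpha>"
      then have "size \<delta> + (e - size \<delta>) = e" using sa size_mset_mono by fastforce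
      from ker_unique_avoid[OF k one zV zd[OF d] this] show "?f \<delta> \<in> supp g" using d by (auto simp: supp_def)
    qed
  qed
  finally show ?thesis .
qed


lemma two_mset_mem: "x \<in># two_mset a i b j \<longleftrightarrow> (0 < i \<and> x = a) \<or> (0 < j \<and> x = b)"
  by (auto simp: two_mset_def)

lemma vars_link_sub: "vars (link z g) \<subseteq> vars g"
  by (force simp: vars_def supp_def link_def)

lemma vars_linkI: "add_mset z \<gamma> \<in> supp g \<Longrightarrow> x \<in># \<gamma> \<Longrightarrow> x \<in> vars (link z g)"
  by (auto simp: vars_def supp_def link_def)

lemma finite_vars: "ker V e g \<Longrightarrow> finite (vars g)"
  using finite_supp[of V e g] by (simp add: vars_def)

lemma card_vars_ge2:
  assumes k: "ker V e g" and ne: "supp g \<noteq> {}" and e: "1 \<le> e"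
  shows "2 \<le> card (vars g)"
proof (rule ccontr)
  assume "\<not> ?thesis"
  then have "card (vars g) \<le> 1" by simp
  then obtain a where a: "vars g \<subseteq> {a}" using finite_vars[OF k]
    by (metis card_1_singletonE card_eq_0_iff empty_subsetI le_neq_implies_less less_one order_refl)
  have "supp g \<subseteq> {replicate_mset e a}"
  proof
    fix \<alpha> assume al: "\<alpha> \<in> supp g"
    then have "set_mset \<alpha> \<subseteq> {a}" using a by (auto simp: vars_def)
    moreover have "size \<alpha> = e" using al k by (simp add: ker_def supp_def)
    ultimately show "\<alpha> \<in> {replicate_mset e a}" using set_mset_subset_singletonD by fastforce
  qed
  then have "card (supp g) \<le> 1" using card_mono[of "{replicate_mset e a}"] by simp
  then show False using card_supp_ge[OF k ne] e by simp
qed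

text \<open>If no link has three variables, every link is the full two-variable family of its degree, which
  forces the variables to come in pairs and the supports of two such pairs to be disjoint.\<close>

lemma card_supp_three_vars:
  assumes k: "ker V e g" and v: "3 \<le> card (vars g)"
  shows "2 * e \<le> Suc (card (supp g))"
  using k v
proof (induction e arbitrary: g)
  case (Suc e)
  note k = Suc.prems(1)
  have fin: "finite (supp g)" using finite_supp[OF k] .
  have ne: "supp g \<noteq> {}" using Suc.prems(2) by (auto simp: vars_def)
  have vV: "vars g \<subseteq> V" using k by (auto simp: vars_def ker_def supp_def)
  \<comment> \<open>Induction over a link with three labels works if two elements avoid
    \<open>z\<close>, which pays for the increase of \<open>2 * e\<close> by two. A single avoiding
    element is the case of \<open>card_supp_unique_avoid\<close>.\<close>
  consider (small) "e < 2"
    | (one) z \<alpha> where "z \<in> vars g" "{\<alpha> \<in> supp g. z \<notin># \<alpha>} = {\<alpha>}"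
    | (link) z where "z \<in> vars g" "3 \<le> card (vars (link z g))" "2 \<le> card {\<alpha> \<in> supp g. z \<notin># \<alpha>}"
    | (none) "2 \<le> e" "\<And>z. z \<in> vars g \<Longrightarrow> card (vars (link z g)) \<le> 2"
  proof -
    have pos: "1 \<le> card {\<alpha> \<in> supp g. z \<notin># \<alpha>}" for z
      using ker_avoid[OF k ne, of z] fin by (simp add: Suc_le_eq card_gt_0_iff)
    have ge: "2 \<le> card {\<alpha> \<in> supp g. z \<notin># \<alpha>}" if "card {\<alpha> \<in> supp g. z \<notin># \<alpha>} \<noteq> 1" for z
      using pos[of z] that by linarith
    show ?thesis
    proof (cases "e < 2 \<or> (\<forall>z \<in> vars g. card (vars (link z g)) \<le> 2)")
      case True then show ?thesis using small none by (meson not_less)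
    next
      case False
      then obtain z where "z \<in> vars g" "\<not> card (vars (link z g)) \<le> 2" by blast
      then have z: "z \<in> vars g" "3 \<le> card (vars (link z g))" by simp_all
      show ?thesis
      proof (cases "card {\<alpha> \<in> supp g. z \<notin># \<alpha>} = 1")
        case True
        then obtain \<alpha> where "{\<alpha> \<in> supp g. z \<notin># \<alpha>} = {\<alpha>}" by (rule card_1_singletonE)
        then show ?thesis using one z by blast
      next
        case False
        then show ?thesis using link z ge by blast
      qed
    qed
  qed
  then show ?case
  proof cases
    case small
    then show ?thesis using card_supp_ge[OF k ne] by simp
  next
    case one
    then show ?thesis using card_supp_unique_avoid[OF k one(2) _ Suc.prems(2)] vV by auto
  next
    case link
    have "2 * e \<le> Suc (card (supp (link z g)))" using Suc.IH[OF ker_link[OF k] link(2)] .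
    then show ?thesis using card_supp_split[OF k, of z] link(3) by simp
  next
    case none
    have full: "\<exists>u v. u \<noteq> v \<and> vars (link z g) = {u, v} \<and> (\<forall>i\<le>e. add_mset z (two_mset u i v (e - i)) \<in> supp g)"
      if z: "z \<in> vars g" for z
    proof -
      note kl = ker_link[OF k, of z] and nl = supp_link_nonempty[OF z]
      have "card (vars (link z g)) = 2" using card_vars_ge2[OF kl nl] none(1) none(2)[OF z] by simp
      then obtain u v where uv: "vars (link z g) = {u, v}" "u \<noteq> v" by (auto simp: card_2_iff)
      then have "supp (link z g) = (\<lambda>i. two_mset u i v (e - i)) ` {..e}" using two_vars[OF kl nl] by simp
      then have "two_mset u i v (e - i) \<in> supp (link z g)" if "i \<le> e" for i using that by simp
      then have "add_mset z (two_mset u i v (e - i)) \<in> supp g" if "i \<le> e" for i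
        using that by (simp add: supp_def link_def)
      then show ?thesis using uv by blast
    qed
    \<comment> \<open>Otherwise \<open>z * u^e\<close> and \<open>z * u * v^(e - 1)\<close> would
      put the three labels \<open>z\<close>, \<open>u\<close>, \<open>v\<close> into the link of
      \<open>u\<close>.\<close>
    have self: "z \<in> vars (link z g)" if z: "z \<in> vars g" for z
    proof (rule ccontr)
      assume nz: "z \<notin> vars (link z g)"
      obtain u v where uv: "u \<noteq> v" "vars (link z g) = {u, v}"
        and f: "\<And>i. i \<le> e \<Longrightarrow> add_mset z (two_mset u i v (e - i)) \<in> supp g" using full[OF z] by blast
      have "two_mset u e v 0 = add_mset u (two_mset u (e - 1) v 0)"
        using none(1) by (cases e) (simp_all add: two_mset_def)
      then have su: "add_mset u (add_mset z (two_mset u (e - 1) v 0)) \<in> supp g"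
        using f[of e] by (simp add: add_mset_commute[of u z])
      have "two_mset u 1 v (e - 1) = add_mset u (two_mset u 0 v (e - 1))"
        by (simp add: two_mset_def)
      then have sv: "add_mset u (add_mset z (two_mset u 0 v (e - 1))) \<in> supp g"
        using f[of 1] none(1) by (simp add: add_mset_commute[of u z])
      have "z \<in> vars (link u g)" by (rule vars_linkI[OF su]) simp
      moreover have "u \<in> vars (link u g)"
        by (rule vars_linkI[OF su]) (use none(1) in \<open>simp add: two_mset_mem\<close>)
      moreover have "v \<in> vars (link u g)"
        by (rule vars_linkI[OF sv]) (use none(1) in \<open>simp add: two_mset_mem\<close>)
      ultimately have "{z, u, v} \<subseteq> vars (link u g)" by blast
      then have "card {z, u, v} \<le> card (vars (link u g))"
        by (rule card_mono[OF finite_vars[OF ker_link[OF k]]])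
      moreover have "card {z, u, v} = 3" using nz uv by auto
      moreover have "u \<in> vars g" using uv vars_link_sub[of z g] by blast
      ultimately show False using none(2)[of u] by simp
    qed
    obtain z where z: "z \<in> vars g" using Suc.prems(2) by fastforce
    have cz: "card (vars (link z g)) \<le> 2" using none(2)[OF z] .
    have "\<not> vars g \<subseteq> vars (link z g)"
      using cz Suc.prems(2) card_mono[OF finite_vars[OF ker_link[OF k]], of "vars g" z] by linarith
    then obtain x where x: "x \<in> vars g" "x \<notin> vars (link z g)" by blast
    have "x \<noteq> z" using x self[OF z] by blast
    then have disj: "{\<alpha> \<in> supp g. z \<in># \<alpha>} \<inter> {\<alpha> \<in> supp g. x \<in># \<alpha>} = {}"
    proof -
      have False if a: "\<alpha> \<in> supp g" "z \<in># \<alpha>" "x \<in># \<alpha>" for \<alpha>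
      proof -
        have "add_mset z (\<alpha> - {#z#}) \<in> supp g" "x \<in># \<alpha> - {#z#}" using a \<open>x \<noteq> z\<close> by (simp_all add: in_diff_count)
        then show False using vars_linkI[of z "\<alpha> - {#z#}" g x] x by blast
      qed
      then show ?thesis by blast
    qed
    have "Suc e \<le> card (supp (link y g))" if "y \<in> vars g" for y
      using card_supp_ge[OF ker_link[OF k] supp_link_nonempty[OF that]] .
    from this[OF z] this[OF x(1)]
    have "2 * Suc e \<le> card {\<alpha> \<in> supp g. z \<in># \<alpha>} + card {\<alpha> \<in> supp g. x \<in># \<alpha>}"
      by (simp add: card_supp_link)
    also have "\<dots> = card ({\<alpha> \<in> supp g. z \<in># \<alpha>} \<union> {\<alpha> \<in> supp g. x \<in># \<alpha>})"
      using disj fin by (intro card_Un_disjoint[symmetric]) auto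
    also have "\<dots> \<le> card (supp g)" using fin by (intro card_mono) auto
    finally show ?thesis by simp
  qed
qed simp

text \<open>With fewer shadows than elements the inclusion matrix of \<open>A\<close> has a nonzero
  kernel vector; extended by zero it satisfies \<open>ker\<close>, and its support lies in
  \<open>A\<close>. If \<open>card A \<le> 2 * e - 2\<close>, the bound of
  \<open>card_supp_three_vars\<close> leaves only two labels, and \<open>two_vars\<close> gives the
  whole family.\<close>

lemma mset_family:
  assumes fin: "finite A" and sz: "\<And>\<alpha>. \<alpha> \<in> A \<Longrightarrow> size \<alpha> = e"
    and small: "card {\<beta>. \<exists>p. add_mset p \<beta> \<in> A} < card A"
  shows "Suc e \<le> card A"
    and "card A + 2 \<le> 2 * e \<Longrightarrow> \<exists>a b. a \<noteq> b \<and> (\<forall>i\<le>e. two_mset a i b (e - i) \<in> A)"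
proof -
  define V where "V = \<Union> (set_mset ` A)"
  define B where "B = {\<beta>. \<exists>p. add_mset p \<beta> \<in> A}"
  have fV: "finite V" using fin by (simp add: V_def)
  have memV: "p \<in> V" if "add_mset p \<beta> \<in> A" for p \<beta>
    unfolding V_def using that by (intro UN_I[of "add_mset p \<beta>"]) simp_all
  have "B \<subseteq> (\<Union>\<alpha>\<in>A. (\<lambda>p. \<alpha> - {#p#}) ` V)"
  proof
    fix \<beta> assume "\<beta> \<in> B"
    then obtain p where p: "add_mset p \<beta> \<in> A" by (auto simp: B_def)
    then have "p \<in> V" by (rule memV)
    moreover have "\<beta> = add_mset p \<beta> - {#p#}" by simp
    ultimately show "\<beta> \<in> (\<Union>\<alpha>\<in>A. (\<lambda>p. \<alpha> - {#p#}) ` V)" using p by blast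
  qed
  then have fB: "finite B" by (rule finite_subset) (use fin fV in auto)
  define M :: "'a multiset \<Rightarrow> 'a multiset \<Rightarrow> real" where "M = (\<lambda>\<beta> \<alpha>. of_bool (\<exists>p. \<alpha> = add_mset p \<beta>))"
  obtain g where g: "\<exists>a\<in>A. g a \<noteq> 0" "\<And>a. a \<notin> A \<Longrightarrow> g a = 0" "\<And>b. b \<in> B \<Longrightarrow> (\<Sum>a\<in>A. M b a * g a) = 0"
    using kernel_exists[OF fB fin, of M] small by (auto simp: B_def)
  have sA: "supp g \<subseteq> A" using g(2) by (auto simp: supp_def)
  have ne: "supp g \<noteq> {}" using g(1) by (auto simp: supp_def)
  have "(\<Sum>i\<in>V. g (add_mset i \<beta>)) = 0" for \<beta>
  proof (cases "\<beta> \<in> B")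
    case True
    have "(\<Sum>i\<in>V. g (add_mset i \<beta>)) = (\<Sum>\<alpha>\<in>(\<lambda>i. add_mset i \<beta>) ` V. g \<alpha>)"
      by (simp add: sum.reindex inj_on_def)
    also have "\<dots> = (\<Sum>\<alpha>\<in>A \<inter> (\<lambda>i. add_mset i \<beta>) ` V. g \<alpha>)"
      using g(2) fV by (intro sum.mono_neutral_right) auto
    also have "\<dots> = (\<Sum>\<alpha>\<in>A \<inter> (\<lambda>i. add_mset i \<beta>) ` V. M \<beta> \<alpha> * g \<alpha>)"
      by (intro sum.cong) (auto simp: M_def)
    also have "\<dots> = (\<Sum>\<alpha>\<in>A. M \<beta> \<alpha> * g \<alpha>)"
      using fin memV by (intro sum.mono_neutral_left) (auto simp: M_def)
    finally show ?thesis using g(3)[OF True] by simp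
  next
    case False
    then show ?thesis using g(2) by (intro sum.neutral) (auto simp: B_def)
  qed
  moreover have "size \<alpha> = e \<and> set_mset \<alpha> \<subseteq> V" if "g \<alpha> \<noteq> 0" for \<alpha>
  proof -
    have "\<alpha> \<in> A" using that g(2) by blast
    then show ?thesis using sz by (auto simp: V_def)
  qed
  ultimately have k: "ker V e g" using fV by (simp add: ker_def)
  have cA: "card (supp g) \<le> card A" using sA fin by (rule card_mono[rotated])
  then show "Suc e \<le> card A" using card_supp_ge[OF k ne] by simp
  assume c: "card A + 2 \<le> 2 * e"
  have "\<not> 3 \<le> card (vars g)" using card_supp_three_vars[OF k] c cA by linarith
  moreover have "2 \<le> card (vars g)" using card_vars_ge2[OF k ne] c by simp
  ultimately have "card (vars g) = 2" by simp
  then obtain a b where ab: "vars g = {a, b}" "a \<noteq> b" by (auto simp: card_2_iff)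
  then have "supp g = (\<lambda>i. two_mset a i b (e - i)) ` {..e}" using two_vars[OF k ne] by simp
  then show "\<exists>a b. a \<noteq> b \<and> (\<forall>i\<le>e. two_mset a i b (e - i) \<in> A)" using ab sA by blast
qed

section \<open>Common shadows of two graphs\<close>

lemma obtain_four:
  fixes S :: "nat set"
  assumes "4 \<le> card S"
  obtains a b c d where "a \<in> S" "b \<in> S" "c \<in> S" "d \<in> S" "a < b" "b < c" "c < d"
proof -
  have fin: "finite S" using assms by (cases "finite S") auto
  have ne: "S \<noteq> {}" using assms by auto
  define a where "a = Min S"
  have aS: "a \<in> S" using fin ne by (simp add: a_def)
  then have "3 \<le> card (S - {a})" using assms by simp
  then obtain b c d where bcd: "b \<in> S - {a}" "c \<in> S - {a}" "d \<in> S - {a}" "b < c" "c < d"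
    by (rule obtain_three)
  have "a \<le> b" using bcd fin by (simp add: a_def)
  then have "a < b" using bcd by auto
  then show ?thesis using that aS bcd by blast
qed

text \<open>The case \<open>v < u\<close> is treated by exchanging the graphs. With
  \<open>u \<le> v\<close>, the interval \<open>[u, v]\<close> contains an end of every pair of
  vertices on which the graphs differ (\<open>common_hit\<close>).\<close>

definition common :: "(nat \<Rightarrow> nat \<Rightarrow> bool) \<Rightarrow> (nat \<Rightarrow> nat \<Rightarrow> bool) \<Rightarrow> nat \<Rightarrow> nat \<Rightarrow> bool" where
  "common g g' u v \<longleftrightarrow> u \<le> v \<and> del g u = del g' v"

lemma common_eq:
  assumes "common g g' u v"
  shows "g (skip u x) (skip u y) = g' (skip v x) (skip v y)"
proof -
  have "del g u x y = del g' v x y" using assms by (simp add: common_def)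
  then show ?thesis by (simp add: del_def)
qed

text \<open>In the rectangle \<open>x < p \<le> y\<close> the position of \<open>u\<close> decides
  only about the row in \<open>g\<close>, and the position of \<open>v\<close> only about the column
  in \<open>g'\<close>. This decoupling is the reason for grouping the pairs \<open>(u, v)\<close>
  by a common point \<open>p\<close>.\<close>

lemma common_low:
  assumes "common g g' u v" "u \<le> p" "p \<le> v" "x < p" "p \<le> y" "u \<le> x"
  shows "g (Suc x) (Suc y) = g' x (if v \<le> y then Suc y else y)"
  using common_eq[OF assms(1), of x y] assms by auto

lemma common_high:
  assumes "common g g' u v" "u \<le> p" "p \<le> v" "x < p" "p \<le> y" "x < u"
  shows "g x (Suc y) = g' x (if v \<le> y then Suc y else y)"
  using common_eq[OF assms(1), of x y] assms by auto

lemma common_hit: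
  assumes "common g g' u v" "g x y \<noteq> g' x y"
  shows "(u \<le> x \<and> x \<le> v) \<or> (u \<le> y \<and> y \<le> v)"
proof (rule ccontr)
  assume n: "\<not> ?thesis"
  define r where "r z = (if z < u then z else z - 1)" for z
  have "skip u (r z) = z \<and> skip v (r z) = z" if "\<not> (u \<le> z \<and> z \<le> v)" for z
    using that assms(1) by (auto simp: r_def skip_def common_def)
  then show False using common_eq[OF assms(1), of "r x" "r y"] n assms(2) by metis
qed

text \<open>The two deletions differ at some \<open>x < y\<close>. Seen in \<open>g\<close>, one of
  these indices lies in \<open>[u1, u2)\<close>; seen in \<open>g'\<close>, one lies between
  \<open>v1\<close> and \<open>v2\<close>. As \<open>p\<close> separates the two ranges, these are
  \<open>x\<close> and \<open>y\<close> in this order.\<close>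

lemma common_sep:
  assumes g: "g \<in> adjs n" and c1: "common g g' u1 v1" and c2: "common g g' u2 v2"
    and u: "u1 < u2" "u2 \<le> p" and v: "p \<le> v1" "p \<le> v2" and ne: "del g u1 \<noteq> del g u2"
  obtains i j where "u1 \<le> i" "i < u2" "p \<le> j" "(v1 \<le> j \<and> j < v2) \<or> (v2 \<le> j \<and> j < v1)"
    "g (Suc i) (Suc j) \<noteq> g i (Suc j)"
proof -
  have "\<exists>x y. x < y \<and> del g u1 x y \<noteq> del g u2 x y"
  proof -
    obtain x y where xy: "del g u1 x y \<noteq> del g u2 x y" using ne by blast
    have "x \<noteq> y" using xy adjs_irrefl[OF g] by (auto simp: del_def)
    moreover have "del g u1 y x \<noteq> del g u2 y x" using xy adjs_sym[OF g] by (metis del_def)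
    ultimately show ?thesis using xy by (metis linorder_neqE_nat)
  qed
  then obtain x y where xy: "x < y" "del g u1 x y \<noteq> del g u2 x y" by blast
  have U: "(u1 \<le> x \<and> x < u2) \<or> (u1 \<le> y \<and> y < u2)"
  proof (rule ccontr)
    assume "\<not> ?thesis"
    then have "skip u1 x = skip u2 x" "skip u1 y = skip u2 y" using u by (auto simp: skip_def)
    then show False using xy by (simp add: del_def)
  qed
  have xy': "del g' v1 x y \<noteq> del g' v2 x y" using xy(2) c1 c2 by (simp add: common_def)
  have V: "p \<le> y \<and> ((v1 \<le> y \<and> y < v2) \<or> (v2 \<le> y \<and> y < v1)) \<or>
      p \<le> x \<and> ((v1 \<le> x \<and> x < v2) \<or> (v2 \<le> x \<and> x < v1))"
  proof (rule ccontr)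
    assume n: "\<not> ?thesis"
    have "skip v1 x = skip v2 x" "skip v1 y = skip v2 y" using n v by (auto simp: skip_def)
    then show False using xy' by (simp add: del_def)
  qed
  have "u1 \<le> x" "x < u2" "p \<le> y" "(v1 \<le> y \<and> y < v2) \<or> (v2 \<le> y \<and> y < v1)" using U V xy(1) u v by auto
  moreover from this have "g (Suc x) (Suc y) \<noteq> g x (Suc y)" using xy(2) u by (simp add: del_def)
  ultimately show ?thesis using that by blast
qed

text \<open>At the entry found by \<open>common_sep\<close> the second and the third pair read the
  same entry of \<open>g\<close>, so \<open>v2\<close> and \<open>v3\<close> are on the same side of
  \<open>j\<close> and \<open>v1\<close> is on the other. In \<open>common_mono2\<close> the first
  and the second pair agree in this way; together they force four pairs into a monotone
  chain.\<close>

lemma common_mono1: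
  assumes g: "g \<in> adjs n" and c: "common g g' u1 v1" "common g g' u2 v2" "common g g' u3 v3"
    and u: "u1 < u2" "u2 < u3" "u3 \<le> p" and v: "p \<le> v1" "p \<le> v2" "p \<le> v3" and ne: "del g u1 \<noteq> del g u2"
  shows "v1 < v2 \<and> v1 < v3 \<or> v2 < v1 \<and> v3 < v1"
proof -
  have u2: "u2 \<le> p" using u by simp
  obtain i j where ij: "u1 \<le> i" "i < u2" "p \<le> j" "(v1 \<le> j \<and> j < v2) \<or> (v2 \<le> j \<and> j < v1)"
    "g (Suc i) (Suc j) \<noteq> g i (Suc j)" using common_sep[OF g c(1,2) u(1) u2 v(1,2) ne] .
  have h: "u1 \<le> p" "i < p" "i < u3" using u ij by auto
  note a = common_low[OF c(1) h(1) v(1) h(2) ij(3,1)] and b = common_high[OF c(2) u2 v(2) h(2) ij(3,2)]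
    and d = common_high[OF c(3) u(3) v(3) h(2) ij(3) h(3)]
  show ?thesis using a b d ij(4,5) by (cases "v1 \<le> j"; cases "v2 \<le> j"; cases "v3 \<le> j") auto
qed

lemma common_mono2:
  assumes g: "g \<in> adjs n" and c: "common g g' u1 v1" "common g g' u2 v2" "common g g' u3 v3"
    and u: "u1 < u2" "u2 < u3" "u3 \<le> p" and v: "p \<le> v1" "p \<le> v2" "p \<le> v3" and ne: "del g u2 \<noteq> del g u3"
  shows "v2 < v3 \<and> v1 < v3 \<or> v3 < v2 \<and> v3 < v1"
proof -
  have u2: "u2 \<le> p" using u by simp
  obtain i j where ij: "u2 \<le> i" "i < u3" "p \<le> j" "(v2 \<le> j \<and> j < v3) \<or> (v3 \<le> j \<and> j < v2)"
    "g (Suc i) (Suc j) \<noteq> g i (Suc j)" using common_sep[OF g c(2,3) u(2) u(3) v(2,3) ne] .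
  have h: "u1 \<le> p" "i < p" "u1 \<le> i" using u ij by auto
  note a = common_low[OF c(1) h(1) v(1) h(2) ij(3) h(3)] and b = common_low[OF c(2) u2 v(2) h(2) ij(3,1)]
    and d = common_high[OF c(3) u(3) v(3) h(2) ij(3) ij(2)]
  show ?thesis using a b d ij(4,5) by (cases "v1 \<le> j"; cases "v2 \<le> j"; cases "v3 \<le> j") auto
qed

lemma const_step:
  fixes f :: "nat \<Rightarrow> bool"
  assumes "\<And>y. a \<le> y \<Longrightarrow> y < b \<Longrightarrow> f (Suc y) = f y" and "a \<le> y" "y \<le> b"
  shows "f y = f a"
  using assms(2,3)
proof (induction y rule: dec_induct)
  case (step m) then show ?case using assms(1)[of m] by simp
qed simp

text \<open>Along an increasing chain the rectangle between the second and the third pair is constant on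
  antidiagonals, and the neighbouring rectangles make it constant on its boundary.\<close>

lemma no_chain_increasing:
  assumes g: "g \<in> adjs n"
    and c: "common g g' u1 v1" "common g g' u2 v2" "common g g' u3 v3" "common g g' u4 v4"
    and u: "u1 < u2" "u2 < u3" "u3 < u4" "u4 \<le> p" and v: "p \<le> v1" "v1 < v2" "v2 < v3" "v3 < v4"
    and ne: "del g u2 \<noteq> del g u3"
  shows False
proof -
  have up: "u1 \<le> p" "u2 \<le> p" "u3 \<le> p" and vp: "p \<le> v2" "p \<le> v3" "p \<le> v4" using u v by auto
  note l1 = common_low[OF c(1) up(1) v(1)] and l2 = common_low[OF c(2) up(2) vp(1)]
  note h2 = common_high[OF c(2) up(2) vp(1)] and h3 = common_high[OF c(3) up(3) vp(2)]
    and h4 = common_high[OF c(4) u(4) vp(3)]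
  obtain a where a: "u2 = Suc a" using u(1) by (cases u2) auto
  have a0: "u1 \<le> a" "a < p" "a < u2" "a < u3" "a < u4" using a u by auto
  have A: "g u2 (Suc y) = g' a y \<and> g' a (Suc y) = g' a y" if "v2 \<le> y" "y < v3" for y
    using l1[of a y] h2[of a y] h3[of a y] a a0 that v by auto
  have cst: "g' a y = g' a v2" if "v2 \<le> y" "y \<le> v3" for y
    by (rule const_step[of v2 v3]) (use A that in auto)
  have B: "g u2 (Suc v3) = g' a v2"
    using l1[of a v3] h3[of a v3] h4[of a v3] a a0 v cst[of v3] by auto
  have C: "g (Suc x) (Suc v3) = g x (Suc v3) \<and> g' x v3 = g x (Suc v3)" if "u2 \<le> x" "x < u3" for x
    using l2[of x v3] h3[of x v3] h4[of x v3] that u v by auto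
  have C': "g x (Suc v3) = g' a v2" if "u2 \<le> x" "x \<le> u3" for x
    using const_step[of u2 u3 "\<lambda>x. g x (Suc v3)"] C B that by auto
  have claim: "\<forall>y. v2 \<le> y \<longrightarrow> y < v3 \<longrightarrow> g x (Suc y) = g' a v2" if "u2 \<le> x" "x \<le> u3" for x
    using that
  proof (induction x rule: dec_induct)
    case base
    show ?case
    proof (intro allI impI)
      fix y assume y: "v2 \<le> y" "y < v3"
      show "g u2 (Suc y) = g' a v2" using A[OF y] cst[OF y(1)] y(2) by simp
    qed
  next
    case (step x)
    show ?case
    proof (intro allI impI)
      fix y assume y: "v2 \<le> y" "y < v3"
      have "g (Suc x) (Suc y) = g' x (Suc y)" using l2[of x y] step.hyps step.prems u y vp by simp
      also have "\<dots> = g' a v2"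
      proof (cases "Suc y = v3")
        case True
        then show ?thesis using C[of x] C'[of x] step.hyps step.prems by simp
      next
        case False
        then have "g x (Suc (Suc y)) = g' x (Suc y)" using h3[of x "Suc y"] step.hyps step.prems u y vp by simp
        then show ?thesis using step.IH step.hyps step.prems y False by simp
      qed
      finally show "g (Suc x) (Suc y) = g' a v2" .
    qed
  qed
  obtain i j where ij: "u2  \<le> i" "i < u3" "p \<le> j" "(v2 \<le> j \<and> j < v3) \<or> (v3 \<le> j \<and> j < v2)"
    "g (Suc i) (Suc j) \<noteq> g i (Suc j)" using common_sep[OF g c(2,3) u(2) up(3) vp(1,2) ne] .
  have "u2 \<le> Suc i" "Suc i \<le> u3" "i \<le> u3" using ij by auto
  then show False using claim[of i] claim[of "Suc i"] ij v by auto
qed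

text \<open>Here the entries are constant on diagonals instead of antidiagonals, and the boundary
  with a constant value consists of the row \<open>u2\<close> and the column
  \<open>v3\<close>.\<close>

lemma no_chain_decreasing:
  assumes g: "g \<in> adjs n"
    and c: "common g g' u1 v1" "common g g' u2 v2" "common g g' u3 v3" "common g g' u4 v4"
    and u: "u1 < u2" "u2 < u3" "u3 < u4" "u4 \<le> p" and v: "p \<le> v4" "v4 < v3" "v3 < v2" "v2 < v1"
    and ne: "del g u2 \<noteq> del g u3"
  shows False
proof -
  have up: "u1 \<le> p" "u2 \<le> p" "u3 \<le> p" and vp: "p \<le> v1" "p \<le> v2" "p \<le> v3" using u v by auto
  note l1 = common_low[OF c(1) up(1) vp(1)] and l2 = common_low[OF c(2) up(2) vp(2)]
  note h2 = common_high[OF c(2) up(2) vp(2)] and h3 = common_high[OF c(3) up(3) vp(3)]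
    and h4 = common_high[OF c(4) u(4) v(1)]
  obtain a where a: "u2 = Suc a" using u(1) by (cases u2) auto
  obtain w where w: "v3 = Suc w" using v(2) by (cases v3) auto
  have a0: "u1 \<le> a" "a < p" "a < u2" "a < u3" "a < u4" using a u by auto
  have w0: "p \<le> w" "w < v1" "w < v2" "w < v3" "v4 \<le> w" using w v by auto
  have A: "g u2 (Suc y) = g' a y \<and> g' a (Suc y) = g' a y" if "v3 \<le> y" "y < v2" for y
    using l1[of a y] h2[of a y] h3[of a y] a a0 that v by auto
  have cst: "g' a y = g' a v3" if "v3 \<le> y" "y \<le> v2" for y
    by (rule const_step[of v3 v2]) (use A that in auto)
  have B: "g u2 v3 = g' a v3"
    using l1[of a w] h3[of a w] h4[of a w] a a0 w w0 by auto
  have C: "g (Suc x) v3 = g x v3 \<and> g' x v3 = g x v3" if "u2 \<le> x" "x < u3" for x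
    using l2[of x w] h3[of x w] h4[of x w] that u w w0 by auto
  have C': "g x v3 = g' a v3" if "u2 \<le> x" "x \<le> u3" for x
    using const_step[of u2 u3 "\<lambda>x. g x v3"] C B that by auto
  have claim: "\<forall>y. v3 \<le> y \<longrightarrow> y < v2 \<longrightarrow> g x (Suc y) = g' a v3" if "u2 \<le> x" "x \<le> u3" for x
    using that
  proof (induction x rule: dec_induct)
    case base
    show ?case
    proof (intro allI impI)
      fix y assume y: "v3 \<le> y" "y < v2"
      show "g u2 (Suc y) = g' a v3" using A[OF y] cst[OF y(1)] y(2) by simp
    qed
  next
    case (step x)
    show ?case
    proof (intro allI impI)
      fix y assume y: "v3 \<le> y" "y < v2"
      have "g (Suc x) (Suc y) = g' x y" using l2[of x y] step.hyps step.prems u y vp by simp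
      also have "\<dots> = g' a v3"
      proof (cases "y = v3")
        case True
        then show ?thesis using C[of x] C'[of x] step.hyps step.prems by simp
      next
        case False
        then obtain z where z: "y = Suc z" "v3 \<le> z" using y by (cases y) auto
        then have "g x (Suc z) = g' x (Suc z)" using h3[of x z] step.hyps step.prems u y vp by simp
        then show ?thesis using step.IH step.hyps step.prems y z by simp
      qed
      finally show "g (Suc x) (Suc y) = g' a v3" .
    qed
  qed
  obtain i j where ij: "u2  \<le> i" "i < u3" "p \<le> j" "(v2 \<le> j \<and> j < v3) \<or> (v3 \<le> j \<and> j < v2)"
    "g (Suc i) (Suc j) \<noteq> g i (Suc j)" using common_sep[OF g c(2,3) u(2) up(3) vp(2,3) ne] .
  have "u2 \<le> Suc i" "Suc i \<le> u3" "i \<le> u3" using ij by auto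
  then show False using claim[of i] claim[of "Suc i"] ij v by auto
qed

text \<open>For four pairs the values \<open>v\<close> would form a monotone chain by
  \<open>common_mono1\<close> and \<open>common_mono2\<close>, and neither kind of chain
  exists.\<close>

lemma card_cluster:
  assumes g: "g \<in> adjs n"
    and S: "\<And>u v. (u, v) \<in> S \<Longrightarrow> common g g' u v \<and> u \<le> p \<and> p \<le> v"
    and inj: "inj_on (\<lambda>s. del g (fst s)) S"
  shows "card S \<le> 3"
proof (rule ccontr)
  assume "\<not> ?thesis"
  then have "4 \<le> card S" by simp
  moreover have "inj_on fst S" using inj by (auto simp: inj_on_def)
  ultimately have "4 \<le> card (fst ` S)" by (simp add: card_image)
  then obtain u1 u2 u3 u4 where "u1 \<in> fst ` S" "u2 \<in> fst ` S" "u3 \<in> fst ` S" "u4 \<in> fst ` S"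
    and u: "u1 < u2" "u2 < u3" "u3 < u4" by (rule obtain_four)
  then obtain v1 v2 v3 v4 where s: "(u1, v1) \<in> S" "(u2, v2) \<in> S" "(u3, v3) \<in> S" "(u4, v4) \<in> S" by auto
  have ne: "del g u \<noteq> del g u'" if "(u, v) \<in> S" "(u', v') \<in> S" "u \<noteq> u'" for u v u' v'
    using inj_onD[OF inj, of "(u, v)" "(u', v')"] that by auto
  note n12 = ne[OF s(1,2) less_imp_neq[OF u(1)]] and n23 = ne[OF s(2,3) less_imp_neq[OF u(2)]]
    and n34 = ne[OF s(3,4) less_imp_neq[OF u(3)]]
  note c = S[OF s(1)] S[OF s(2)] S[OF s(3)] S[OF s(4)]
  have m1: "v1 < v2 \<and> v1 < v3 \<or> v2 < v1 \<and> v3 < v1"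
    by (rule common_mono1[OF g, of g' u1 v1 u2 v2 u3 v3 p]) (use c u n12 in auto)
  have m2: "v2 < v3 \<and> v1 < v3 \<or> v3 < v2 \<and> v3 < v1"
    by (rule common_mono2[OF g, of g' u1 v1 u2 v2 u3 v3 p]) (use c u n23 in auto)
  have m3: "v3 < v4 \<and> v2 < v4 \<or> v4 < v3 \<and> v4 < v2"
    by (rule common_mono2[OF g, of g' u2 v2 u3 v3 u4 v4 p]) (use c u n34 in auto)
  have m4: "v2 < v3 \<and> v2 < v4 \<or> v3 < v2 \<and> v4 < v2"
    by (rule common_mono1[OF g, of g' u2 v2 u3 v3 u4 v4 p]) (use c u n23 in auto)
  consider "v1 < v2" "v2 < v3" "v3 < v4" | "v4 < v3" "v3 < v2" "v2 < v1" using m1 m2 m3 m4 by linarith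
  then show False
  proof cases
    case 1 then show False using no_chain_increasing[OF g, of g' u1 v1 u2 v2 u3 v3 u4 v4 p] c u n23 by auto
  next
    case 2 then show False using no_chain_decreasing[OF g, of g' u1 v1 u2 v2 u3 v3 u4 v4 p] c u n23 by auto
  qed
qed

section \<open>Pairs around the two ends of a differing entry\<close>

lemma ex_min_nat:
  fixes f :: "'a \<Rightarrow> nat"
  assumes "0 < card A"
  obtains x where "x \<in> A" "\<And>y. y \<in> A \<Longrightarrow> f x \<le> f y"
proof -
  obtain x0 where "x0 \<in> A" using assms by (metis card_gt_0_iff ex_in_conv)
  then show ?thesis using ex_has_least_nat[of "\<lambda>x. x \<in> A" x0 f] that by blast
qed

lemma ex_max_nat:
  fixes f :: "'a \<Rightarrow> nat"
  assumes "0 < card A"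
  obtains x where "x \<in> A" "\<And>y. y \<in> A \<Longrightarrow> f y \<le> f x"
proof -
  have "finite (f ` A)" "f ` A \<noteq> {}" using assms by (auto simp: card_gt_0_iff)
  then have "Max (f ` A) \<in> f ` A" "\<And>y. y \<in> A \<Longrightarrow> f y \<le> Max (f ` A)" by auto
  then show ?thesis using that by (metis imageE)
qed

text \<open>The crossing yields a new difference of the graphs, at \<open>(i, Suc j)\<close>, whose
  \<open>i\<close> lies before every interval starting at \<open>u2\<close> or later. Hence the
  intervals of all pairs but the first contain \<open>Suc j\<close>, and \<open>card_cluster\<close>
  leaves at most four pairs in total.\<close>

lemma no_crossing_left:
  assumes g: "g \<in> adjs n" and fin: "finite S"
    and S: "\<And>u v. (u, v) \<in> S \<Longrightarrow> common g g' u v"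
    and inj: "inj_on (\<lambda>s. del g (fst s)) S" and card: "5 \<le> card S"
    and s1: "(u1, v1) \<in> S" and s2: "(u2, v2) \<in> S" and u: "u1 < u2" "u2 \<le> p" and v: "p \<le> v1" "v1 < v2"
    and others: "\<And>u v. (u, v) \<in> S \<Longrightarrow> (u, v) \<noteq> (u1, v1) \<Longrightarrow> (u, v) \<noteq> (u2, v2) \<Longrightarrow> u2 \<le> u \<or> u \<le> p \<and> v2 \<le> v"
  shows False
proof -
  have ne: "del g u1 \<noteq> del g u2" using inj_onD[OF inj _ s1 s2] u by auto
  have pv: "p \<le> v2" using v by simp
  obtain i j where ij: "u1 \<le> i" "i < u2" "p \<le> j" "(v1 \<le> j \<and> j < v2) \<or> (v2 \<le> j \<and> j < v1)"
    "g (Suc i) (Suc j) \<noteq> g i (Suc j)"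
    using common_sep[OF g S[OF s1] S[OF s2] u v(1) pv ne] .
  have j: "v1 \<le> j" "j < v2" using ij(4) v by auto
  have "u1 \<le> p" "i < p" using u ij by auto
  from common_low[OF S[OF s1] this(1) v(1) this(2) ij(3,1)]
  have D: "g i (Suc j) \<noteq> g' i (Suc j)" using ij(5) j by simp
  define T where "T = S - {(u1, v1)}"
  have "u \<le> Suc j \<and> Suc j \<le> v" if t: "(u, v) \<in> T" for u v
  proof -
    have uv: "(u, v) \<in> S" "(u, v) \<noteq> (u1, v1)" using t by (auto simp: T_def)
    show ?thesis
    proof (cases "(u, v) = (u2, v2)")
      case True
      then show ?thesis using u ij(3) j by auto
    next
      case False
      then consider "u2 \<le> u" | "u \<le> p" "v2 \<le> v" using others[OF uv] by blast
      then show ?thesis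
      proof cases
        case 1
        then show ?thesis using common_hit[OF S[OF uv(1)] D] ij(2) by auto
      next
        case 2
        then show ?thesis using ij(3) j by auto
      qed
    qed
  qed
  then have "card T \<le> 3"
    using card_cluster[OF g, of T g' "Suc j"] S inj by (auto simp: T_def intro: inj_on_subset)
  then show False using card s1 fin by (simp add: T_def)
qed

text \<open>As for \<open>no_crossing_left\<close>, with the two ends exchanged: the intervals of
  all pairs but the last contain \<open>i\<close>.\<close>

lemma no_crossing_right:
  assumes g: "g \<in> adjs n" and fin: "finite S"
    and S: "\<And>u v. (u, v) \<in> S \<Longrightarrow> common g g' u v"
    and inj: "inj_on (\<lambda>s. del g (fst s)) S" and card: "5 \<le> card S"
    and s3: "(u3, v3) \<in> S" and s4: "(u4, v4) \<in> S" and u: "u3 < u4" "u4 \<le> q" and v: "q \<le> v3" "v3 < v4"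
    and others: "\<And>u v. (u, v) \<in> S \<Longrightarrow> (u, v) \<noteq> (u3, v3) \<Longrightarrow> (u, v) \<noteq> (u4, v4) \<Longrightarrow> v < q \<or> u \<le> u3 \<and> q \<le> v"
  shows False
proof -
  have ne: "del g u3 \<noteq> del g u4" using inj_onD[OF inj _ s3 s4] u by auto
  have qv: "q \<le> v4" using v by simp
  obtain i j where ij: "u3 \<le> i" "i < u4" "q \<le> j" "(v3 \<le> j \<and> j < v4) \<or> (v4 \<le> j \<and> j < v3)"
    "g (Suc i) (Suc j) \<noteq> g i (Suc j)"
    using common_sep[OF g S[OF s3] S[OF s4] u v(1) qv ne] .
  have j: "v3 \<le> j" "j < v4" using ij(4) v by auto
  have iq: "u3 \<le> q" "i < q" using u ij by auto
  from common_low[OF S[OF s3] this(1) v(1) this(2) ij(3,1)]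
  have D: "g i (Suc j) \<noteq> g' i (Suc j)" using ij(5) j by simp
  define T where "T = S - {(u4, v4)}"
  have "u \<le> i \<and> i \<le> v" if t: "(u, v) \<in> T" for u v
  proof -
    have uv: "(u, v) \<in> S" "(u, v) \<noteq> (u4, v4)" using t by (auto simp: T_def)
    show ?thesis
    proof (cases "(u, v) = (u3, v3)")
      case True
      then show ?thesis using u v ij iq by auto
    next
      case False
      then consider "v < q" | "u \<le> u3" "q \<le> v" using others[OF uv(1) _ uv(2)] by blast
      then show ?thesis
      proof cases
        case 1
        then show ?thesis using common_hit[OF S[OF uv(1)] D] ij(3) by auto
      next
        case 2
        then show ?thesis using ij iq by auto
      qed
    qed
  qed
  then have "card T \<le> 3"
    using card_cluster[OF g, of T g' i] S inj by (auto simp: T_def intro: inj_on_subset)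
  then show False using card s4 fin by (simp add: T_def)
qed

text \<open>Two nested pairs to the left and two nested pairs to the right: all differences between the graphs
  lie in the product of the inner intervals, where both graphs turn out to be constant.\<close>

lemma no_nested:
  assumes g: "g \<in> adjs n" and g': "g' \<in> adjs n"
    and c: "common g g' u1 v1" "common g g' u2 v2" "common g g' u3 v3" "common g g' u4 v4"
    and p: "u1 < u2" "u2 \<le> p" "p \<le> v2" "v2 < v1" "v1 < q" "p < u3"
    and q: "u3 < u4" "u4 \<le> q" "q \<le> v4" "v4 < v3"
    and ne: "del g u1 \<noteq> del g u2" "del g u3 \<noteq> del g u4" and D: "g p q \<noteq> g' p q"
  shows False
proof -
  have up: "u1 \<le> p" "p \<le> v1" "u3 \<le> q" "q \<le> v3" using p q by auto
  obtain i j where ij: "u1 \<le> i" "i < u2" "p \<le> j" "(v1 \<le> j \<and> j < v2) \<or> (v2 \<le> j \<and> j < v1)"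
    "g (Suc i) (Suc j) \<noteq> g i (Suc j)"
    using common_sep[OF g c(1,2) p(1,2) up(2) p(3) ne(1)] .
  \<comment> \<open>Otherwise the third pair would read \<open>g i (Suc j)\<close> as
    \<open>g' i j\<close>, just as the first pair reads \<open>g (Suc i) (Suc j)\<close>.\<close>
  have v2u3: "v2 < u3"
  proof (rule ccontr)
    assume "\<not> ?thesis"
    then have h: "v2 \<le> j" "j < v1" "u3 \<le> j" "i < p" "i < u3" "j < v3" "i < v3" using ij(4) p q ij(2) by auto
    have "g (Suc i) (Suc j) = g' i j" using common_low[OF c(1) up(1,2) h(4) ij(3,1)] h by simp
    moreover have "g i (Suc j) = g' i j" using common_eq[OF c(3), of i j] h by simp
    ultimately show False using ij(5) by simp
  qed
  obtain k l where kl: "u3 \<le> k" "k < u4" "q \<le> l" "(v3 \<le> l \<and> l < v4) \<or> (v4 \<le> l \<and> l < v3)"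
    "g (Suc k) (Suc l) \<noteq> g k (Suc l)"
    using common_sep[OF g c(3,4) q(1,2) up(4) q(3) ne(2)] .
  have v1u4: "v1 < u4"
  proof (rule ccontr)
    assume "\<not> ?thesis"
    then have h: "v4 \<le> l" "l < v3" "k < v1" "k < q" "u1 \<le> k" "v1 \<le> l" "u1 \<le> l" using kl p q by auto
    have "g k (Suc l) = g' k (Suc l)" using common_high[OF c(4) q(2,3) h(4) kl(3,2)] h by simp
    moreover have "g (Suc k) (Suc l) = g' k (Suc l)" using common_eq[OF c(1), of k l] h by simp
    ultimately show False using kl(5) by simp
  qed
  have same: "g x y = g' x y" if "x < y" "\<not> (u2 \<le> x \<and> x \<le> v2 \<and> u4 \<le> y \<and> y \<le> v4)" for x y
    using common_hit[OF c(2), of x y] common_hit[OF c(4), of x y] that p(4) v1u4 by linarith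
  have left: "g' x y = g (Suc x) y" if "u1 \<le> x" "x < v1" "v1 < y" for x y
    using common_eq[OF c(1), of x "y - 1"] that up p by simp
  have right: "g' x y = g x (Suc y)" if "x < u3" "u3 \<le> y" "y < v3" for x y
    using common_eq[OF c(3), of x y] that by simp
  obtain a where a: "u2 = Suc a" using p(1) by (cases u2) auto
  define c where "c = g a u4"
  have row: "g a y = c" if "u4 \<le> y" "y \<le> Suc v4" for y
    unfolding c_def
  proof (rule const_step[of u4 "Suc v4"])
    fix y assume y: "u4 \<le> y" "y < Suc v4"
    have "g a y = g' a y" using same[of a y] y a p v1u4 by simp
    also have "\<dots> = g a (Suc y)" using right[of a y] y a p q v2u3 by simp
    finally show "g a (Suc y) = g a y" by simp
  qed (use that in auto)
  have col: "g x (Suc v4) = c" if "a \<le> x" "x \<le> v1" for x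
  proof -
    have "g x (Suc v4) = g a (Suc v4)"
    proof (rule const_step[of a v1 "\<lambda>x. g x (Suc v4)"])
      fix x assume x: "a \<le> x" "x < v1"
      have "g x (Suc v4) = g' x (Suc v4)" using same[of x "Suc v4"] x v1u4 q by simp
      also have "\<dots> = g (Suc x) (Suc v4)" using left[of x "Suc v4"] x a p q v1u4 by simp
      finally show "g (Suc x) (Suc v4) = g x (Suc v4)" by simp
    qed (use that in auto)
    then show ?thesis using row[of "Suc v4"] q by simp
  qed
  \<comment> \<open>Here \<open>g (Suc x) y\<close> equals \<open>g' x y\<close>, which equals
    \<open>g x (Suc y)\<close>; so the value \<open>c\<close> spreads along antidiagonals from the
    row \<open>a\<close> and the column \<open>Suc v4\<close>.\<close>
  have claim: "\<forall>y. u4 \<le> y \<longrightarrow> y \<le> Suc v4 \<longrightarrow> g x y = c" if "a \<le> x" "x \<le> Suc v2" for x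
    using that
  proof (induction x rule: dec_induct)
    case base
    then show ?case using row by blast
  next
    case (step x)
    show ?case
    proof (intro allI impI)
      fix y assume y: "u4 \<le> y" "y \<le> Suc v4"
      show "g (Suc x) y = c"
      proof (cases "y = Suc v4")
        case True
        then show ?thesis using col[of "Suc x"] step.hyps step.prems p by simp
      next
        case False
        have "g (Suc x) y = g' x y" using left[of x y] step.hyps step.prems a p y v1u4 by simp
        also have "\<dots> = g x (Suc y)" using right[of x y] step.hyps step.prems y False v2u3 q by simp
        also have "\<dots> = c" using step.IH step.prems y False by simp
        finally show ?thesis .
      qed
    qed
  qed
  have "g p q = c" using claim[of p] p q a by simp
  moreover have "g' p q = g (Suc p) q" using left[of p q] p by simp
  moreover have "g (Suc p) q = c" using claim[of "Suc p"] p q a by simp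
  ultimately show False using D by simp
qed

text \<open>Every interval contains an end of a fixed differing entry \<open>(p, q)\<close>, and
  each end lies in at most three intervals. Of five pairs, therefore, two contain only
  \<open>p\<close> and two only \<open>q\<close>. These are chosen with extreme \<open>u\<close>, so
  that crossing is excluded; the nested position contradicts \<open>no_nested\<close>.\<close>

lemma card_common_le:
  assumes g: "g \<in> adjs n" and g': "g' \<in> adjs n" and neq: "g \<noteq> g'" and fin: "finite S"
    and S: "\<And>u v. (u, v) \<in> S \<Longrightarrow> common g g' u v"
    and inj: "inj_on (\<lambda>s. del g (fst s)) S"
  shows "card S \<le> 4"
proof (rule ccontr)
  assume "\<not> ?thesis"
  then have card: "5 \<le> card S" by simp
  have "\<exists>p q. p < q \<and> g p q \<noteq> g' p q"
  proof -
    obtain x y where xy: "g x y \<noteq> g' x y" using neq by blast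
    then have "x \<noteq> y" using g g' by auto
    then show ?thesis using xy adjs_sym[OF g, of x y] adjs_sym[OF g', of x y] by (metis linorder_neqE_nat)
  qed
  then obtain p q where pq: "p < q" "g p q \<noteq> g' p q" by blast
  define Sp where "Sp = {s \<in> S. fst s \<le> p \<and> p \<le> snd s}"
  define Sq where "Sq = {s \<in> S. fst s \<le> q \<and> q \<le> snd s}"
  have cp: "card Sp \<le> 3" by (rule card_cluster[OF g]) (use S inj in \<open>auto simp: Sp_def intro: inj_on_subset\<close>)
  have cq: "card Sq \<le> 3" by (rule card_cluster[OF g]) (use S inj in \<open>auto simp: Sq_def intro: inj_on_subset\<close>)
  have un: "s \<in> Sp \<or> s \<in> Sq" if "s \<in> S" for s
    using common_hit[OF S pq(2), of "fst s" "snd s"] that by (auto simp: Sp_def Sq_def)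
  have fst_inj: "s = t" if "s \<in> S" "t \<in> S" "fst s = fst t" for s t
    using inj_onD[OF inj, of s t] that by simp
  have fsub: "Sp \<subseteq> S" "Sq \<subseteq> S" by (auto simp: Sp_def Sq_def)
  have "card S - card Sq \<le> card (S - Sq)" "card S - card Sp \<le> card (S - Sp)"
    by (rule diff_card_le_card_Diff, use fin fsub in \<open>auto intro: finite_subset\<close>)+
  then have c2: "2 \<le> card (S - Sq)" "2 \<le> card (S - Sp)" using card cp cq by linarith+
  have "0 < card (S - Sq)" using c2 by simp
  then obtain s1 where s1: "s1 \<in> S - Sq" "\<And>s. s \<in> S - Sq \<Longrightarrow> fst s1 \<le> fst s"
    by (rule ex_min_nat[where f = fst]) blast
  have "0 < card (S - Sq - {s1})" using c2 s1(1) by simp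
  then obtain s2 where s2: "s2 \<in> S - Sq - {s1}" "\<And>s. s \<in> S - Sq - {s1} \<Longrightarrow> fst s2 \<le> fst s"
    by (rule ex_min_nat[where f = fst]) blast
  have "0 < card (S - Sp)" using c2 by simp
  then obtain s4 where s4: "s4 \<in> S - Sp" "\<And>s. s \<in> S - Sp \<Longrightarrow> fst s \<le> fst s4"
    by (rule ex_max_nat[where f = fst]) blast
  have "0 < card (S - Sp - {s4})" using c2 s4(1) by simp
  then obtain s3 where s3: "s3 \<in> S - Sp - {s4}" "\<And>s. s \<in> S - Sp - {s4} \<Longrightarrow> fst s \<le> fst s3"
    by (rule ex_max_nat[where f = fst]) blast
  obtain u1 v1 u2 v2 u3 v3 u4 v4 where e: "s1 = (u1, v1)" "s2 = (u2, v2)" "s3 = (u3, v3)" "s4 = (u4, v4)"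
    by (metis surj_pair)
  have P: "u \<le> p \<and> p \<le> v \<and> v < q" if "(u, v) \<in> S - Sq" for u v
    using un[of "(u, v)"] that pq by (auto simp: Sp_def Sq_def)
  have Q: "p < u \<and> u \<le> q \<and> q \<le> v" if "(u, v) \<in> S - Sp" for u v
    using un[of "(u, v)"] that pq by (auto simp: Sp_def Sq_def)
  have p1: "u1 \<le> p" "p \<le> v1" "v1 < q" and p2: "u2 \<le> p" "p \<le> v2" "v2 < q"
    using P s1(1) s2(1) e by auto
  have q3: "p < u3" "u3 \<le> q" "q \<le> v3" and q4: "p < u4" "u4 \<le> q" "q \<le> v4"
    using Q s3(1) s4(1) e by auto
  have mem: "(u1, v1) \<in> S" "(u2, v2) \<in> S" "(u3, v3) \<in> S" "(u4, v4) \<in> S"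
    using s1 s2 s3 s4 e by auto
  note c = S[OF mem(1)] S[OF mem(2)] S[OF mem(3)] S[OF mem(4)]
  have "u1 \<noteq> u2" using fst_inj[of s1 s2] s1 s2 e by auto
  then have u12: "u1 < u2" using s1(2)[of s2] s2 e by auto
  have "u3 \<noteq> u4" using fst_inj[of s3 s4] s3 s4 e by auto
  then have u34: "u3 < u4" using s4(2)[of s3] s3 e by auto
  have ne12: "del g u1 \<noteq> del g u2" using inj_onD[OF inj _ mem(1,2)] u12 by auto
  have ne34: "del g u3 \<noteq> del g u4" using inj_onD[OF inj _ mem(3,4)] u34 by auto
  have "v1 \<noteq> v2" using ne12 c by (auto simp: common_def)
  moreover have "\<not> v1 < v2"
  proof
    assume lt: "v1 < v2"
    show False
    proof (rule no_crossing_left[OF g fin S inj card mem(1,2) u12 p2(1) p1(2) lt])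
      fix u v assume uv: "(u, v) \<in> S" "(u, v) \<noteq> (u1, v1)" "(u, v) \<noteq> (u2, v2)"
      show "u2 \<le> u \<or> u \<le> p \<and> v2 \<le> v"
      proof (cases "(u, v) \<in> Sq")
        case True
        then show ?thesis using Q[of u v] uv p2 by (cases "(u, v) \<in> Sp") (auto simp: Sp_def Sq_def)
      next
        case False
        then show ?thesis using s2(2)[of "(u, v)"] uv e by auto
      qed
    qed
  qed
  ultimately have v21: "v2 < v1" by simp
  have "v3 \<noteq> v4" using ne34 c by (auto simp: common_def)
  moreover have "\<not> v3 < v4"
  proof
    assume lt: "v3 < v4"
    show False
    proof (rule no_crossing_right[OF g fin S inj card mem(3,4) u34 q4(2) q3(3) lt])
      fix u v assume uv: "(u, v) \<in> S" "(u, v) \<noteq> (u3, v3)" "(u, v) \<noteq> (u4, v4)"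
      show "v < q \<or> u \<le> u3 \<and> q \<le> v"
      proof (cases "(u, v) \<in> Sp")
        case True
        then show ?thesis using P[of u v] uv q3 by (cases "(u, v) \<in> Sq") (auto simp: Sp_def Sq_def)
      next
        case False
        then show ?thesis using s3(2)[of "(u, v)"] Q[of u v] uv e by auto
      qed
    qed
  qed
  ultimately have v43: "v4 < v3" by simp
  show False
    by (rule no_nested[OF g g' c u12 p2(1,2) v21 p1(3) q3(1) u34 q4(2,3) v43 ne12 ne34 pq(2)])
qed

lemma card_shad_common:
  assumes g: "g \<in> adjs n" and g': "g' \<in> adjs n" and neq: "g \<noteq> g'"
  shows "card {h. \<exists>u v. u \<le> v \<and> u < n \<and> v < n \<and> h = del g u \<and> h = del g' v} \<le> 4"
proof -
  let ?H = "{h. \<exists>u v. u \<le> v \<and> u < n \<and> v < n \<and> h = del g u \<and> h = del g' v}"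
  have "\<exists>s. fst s \<le> snd s \<and> snd s < n \<and> h = del g (fst s) \<and> h = del g' (snd s)" if "h \<in> ?H" for h
    using that by force
  note ex = this
  define f where "f h = (SOME s. fst s \<le> snd s \<and> snd s < n \<and> h = del g (fst s) \<and> h = del g' (snd s))" for h
  have f: "fst (f h) \<le> snd (f h) \<and> snd (f h) < n \<and> h = del g (fst (f h)) \<and> h = del g' (snd (f h))"
    if "h \<in> ?H" for h
    unfolding f_def by (rule someI_ex[OF ex[OF that]])
  have fin: "finite ?H" by (rule finite_subset[of _ "shad n g"]) (auto simp: shad_def)
  have inj: "inj_on (\<lambda>s. del g (fst s)) (f ` ?H)"
  proof (rule inj_onI)
    fix s t assume "s \<in> f ` ?H" "t \<in> f ` ?H" and e: "del g (fst s) = del g (fst t)"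
    then obtain h k where hk: "h \<in> ?H" "s = f h" "k \<in> ?H" "t = f k" by blast
    then have "h = k" using f[of h] f[of k] e by simp
    then show "s = t" using hk by simp
  qed
  have "inj_on f ?H"
  proof (rule inj_onI)
    fix h k assume "h \<in> ?H" "k \<in> ?H" "f h = f k"
    then show "h = k" using f[of h] f[of k] by simp
  qed
  then have "card ?H = card (f ` ?H)" by (simp add: card_image)
  also have "\<dots> \<le> 4"
  proof (rule card_common_le[OF g g' neq _ _ inj])
    show "finite (f ` ?H)" using fin by (rule finite_imageI)
    fix u v assume "(u, v) \<in> f ` ?H"
    then obtain h where "h \<in> ?H" "(u, v) = f h" by (rule imageE)
    then show "common g g' u v" using f[of h] by (metis common_def fst_conv snd_conv)
  qed
  finally show ?thesis .
qed

text \<open>The bound is 4 for each order of the two deleted positions.\<close>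

lemma card_shad_Int:
  assumes g: "g \<in> adjs n" and g': "g' \<in> adjs n" and neq: "g \<noteq> g'"
  shows "card (shad n g \<inter> shad n g') \<le> 8"
proof -
  let ?H = "\<lambda>g g'. {h. \<exists>u v. u \<le> v \<and> u < n \<and> v < n \<and> h = del g u \<and> h = del g' v}"
  have "shad n g \<inter> shad n g' \<subseteq> ?H g g' \<union> ?H g' g"
  proof
    fix h assume "h \<in> shad n g \<inter> shad n g'"
    then obtain u v where "u < n" "v < n" "h = del g u" "h = del g' v" by (auto simp: shad_def)
    moreover from this have "h \<in> ?H g g'" if "u \<le> v" using that by blast
    moreover from calculation(1-4) have "h \<in> ?H g' g" if "v \<le> u" using that by blast
    ultimately show "h \<in> ?H g g' \<union> ?H g' g" by (meson UnCI nat_le_linear)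
  qed
  moreover have "finite (?H g g' \<union> ?H g' g)"
    by (rule finite_subset[of _ "shad n g"]) (auto simp: shad_def)
  ultimately have "card (shad n g \<inter> shad n g') \<le> card (?H g g' \<union> ?H g' g)" by (intro card_mono)
  also have "\<dots> \<le> card (?H g g') + card (?H g' g)" by (rule card_Un_le)
  also have "\<dots> \<le> 8" using card_shad_common[OF g g' neq] card_shad_common[OF g' g neq[symmetric]] by simp
  finally show ?thesis .
qed

section \<open>Graphs given by block sizes\<close>

text \<open>In \<open>blow K \<mu>\<close> each label \<open>c\<close> is replaced by \<open>count \<mu> c\<close> successive vertices, whose adjacencies are given
  by \<open>K\<close>. The condition \<open>sep\<close> says that the last vertex with one label and the first with the next one are no twins, so
  that the labels are the blocks; then \<open>size (base \<mu>)\<close> is the number of block ends.\<close>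

definition pull :: "(nat \<Rightarrow> nat \<Rightarrow> bool) \<Rightarrow> nat list \<Rightarrow> nat \<Rightarrow> nat \<Rightarrow> bool" where
  "pull K w i j \<longleftrightarrow> i < length w \<and> j < length w \<and> i \<noteq> j \<and> K (w ! i) (w ! j)"

abbreviation word :: "nat multiset \<Rightarrow> nat list" where
  "word \<equiv> sorted_list_of_multiset"

definition blow :: "(nat \<Rightarrow> nat \<Rightarrow> bool) \<Rightarrow> nat multiset \<Rightarrow> nat \<Rightarrow> nat \<Rightarrow> bool" where
  "blow K \<mu> = pull K (word \<mu>)"

definition sep :: "(nat \<Rightarrow> nat \<Rightarrow> bool) \<Rightarrow> nat multiset \<Rightarrow> bool" where
  "sep K \<mu> \<longleftrightarrow> (\<forall>c d. c \<in># \<mu> \<longrightarrow> d \<in># \<mu> \<longrightarrow> c < d \<longrightarrow> (\<forall>x\<in>#\<mu>. \<not> (c < x \<and> x < d)) \<longrightarrow>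
     (\<exists>l\<in>#\<mu> - {#c, d#}. K c l \<noteq> K d l))"

definition base :: "nat multiset \<Rightarrow> nat multiset" where
  "base \<mu> = mset_set (set_mset \<mu>) + mset_set {x \<in> set_mset \<mu>. 2 \<le> count \<mu> x}"

lemma word_unique: "sorted w \<Longrightarrow> word (mset w) = w"
  by (simp add: sorted_list_of_multiset_mset sorted_sort_id)

lemma length_word [simp]: "length (word \<mu>) = size \<mu>"
  by (metis mset_sorted_list_of_multiset size_mset)

lemma set_word [simp]: "set (word \<mu>) = set_mset \<mu>"
  by (metis mset_sorted_list_of_multiset set_mset_mset)

lemma word_nth_in: "i < size \<mu> \<Longrightarrow> word \<mu> ! i \<in># \<mu>"
  by (metis length_word nth_mem set_word)

lemma word_pos: "p \<in># \<mu> \<Longrightarrow> \<exists>i < size \<mu>. word \<mu> ! i = p"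
  by (metis in_set_conv_nth length_word set_word)

lemma sorted_word [simp]: "sorted (word \<mu>)"
  by (rule sorted_sorted_list_of_multiset)

lemma word_mono: "i \<le> j \<Longrightarrow> j < size \<mu> \<Longrightarrow> word \<mu> ! i \<le> word \<mu> ! j"
  by (simp add: sorted_nth_mono)

lemma del_pull: "v < length w \<Longrightarrow> del (pull K w) v = pull K (take v w @ drop (Suc v) w)"
proof (intro ext)
  fix i j assume v: "v < length w"
  have nth: "(take v w @ drop (Suc v) w) ! k = w ! skip v k" if "k < length w - 1" for k
    using that v by (auto simp: nth_append skip_def min_def)
  then show "del (pull K w) v i j = pull K (take v w @ drop (Suc v) w) i j"
  proof (cases "i < length w - 1 \<and> j < length w - 1")
    case True
    then show ?thesis using v nth[of i] nth[of j] skip_less_iff[OF v] by (simp add: del_def pull_def min_def)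
  next
    case False
    then have "\<not> (skip v i < length w \<and> skip v j < length w)" using skip_less_iff[OF v] by blast
    moreover have "length (take v w @ drop (Suc v) w) = length w - 1" using v by simp
    ultimately show ?thesis using False unfolding del_def pull_def by metis
  qed
qed

lemma del_blow:
  assumes "v < size \<mu>"
  shows "del (blow K \<mu>) v = blow K (\<mu> - {#word \<mu> ! v#})"
proof -
  let ?w = "word \<mu>"
  let ?u = "take v ?w @ drop (Suc v) ?w"
  have e: "?w = take v ?w @ ?w ! v # drop (Suc v) ?w" using assms by (simp add: id_take_nth_drop)
  have s: "sorted ?u"
  proof -
    have "sorted (take v ?w @ ?w ! v # drop (Suc v) ?w)" using e sorted_word by metis
    then show ?thesis by (auto simp: sorted_append)
  qed
  have "mset ?u = \<mu> - {#?w ! v#}"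
  proof -
    have "\<mu> = mset (take v ?w @ ?w ! v # drop (Suc v) ?w)" using e mset_sorted_list_of_multiset by metis
    also have "\<dots> = add_mset (?w ! v) (mset ?u)" by simp
    finally show ?thesis by (metis add_mset_remove_trivial)
  qed
  then have "word (\<mu> - {#?w ! v#}) = ?u" using word_unique[OF s] by simp
  then show ?thesis using del_pull[of v ?w K] assms by (simp add: blow_def)
qed

lemma blow_shad: "p \<in># \<mu> \<Longrightarrow> size \<mu> = n \<Longrightarrow> blow K (\<mu> - {#p#}) \<in> shad n (blow K \<mu>)"
proof -
  assume "p \<in># \<mu>" and n: "size \<mu> = n"
  then obtain v where v: "v < size \<mu>" "word \<mu> ! v = p" using word_pos by blast
  then show ?thesis using del_blow[of v \<mu> K] n unfolding shad_def by (intro image_eqI[of _ _ v]) simp_all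
qed

lemma pull_adjs:
  assumes "\<And>c d. K c d = K d c"
  shows "pull K w \<in> adjs (length w)"
  using assms by (auto simp: adjs_def pull_def)

lemma blow_adjs:
  assumes "\<And>c d. K c d = K d c"
  shows "blow K \<mu> \<in> adjs (size \<mu>)"
  using pull_adjs[OF assms, where w = "word \<mu>"] by (simp add: blow_def)

lemma mset_remove_two:
  assumes "i < length w" "j < length w" "i \<noteq> j"
  shows "set_mset (mset w - {#w ! i, w ! j#}) = {w ! k | k. k < length w \<and> k \<noteq> i \<and> k \<noteq> j}"
proof -
  have "mset w = image_mset ((!) w) (mset_set {..<length w})"
    by (metis atLeast0LessThan map_nth mset_map mset_upt)
  also have "{..<length w} = insert i (insert j ({..<length w} - {i, j}))" using assms by auto
  also have "mset_set (insert i (insert j ({..<length w} - {i, j}))) = add_mset i (add_mset j (mset_set ({..<length w} - {i, j})))"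
    using assms by simp
  finally have "mset w - {#w ! i, w ! j#} = image_mset ((!) w) (mset_set ({..<length w} - {i, j}))" by simp
  then show ?thesis by auto
qed

lemma twin_blow:
  assumes "Suc i < size \<mu>"
  shows "twin (blow K \<mu>) i \<longleftrightarrow>
    (\<forall>l\<in>#\<mu> - {#word \<mu> ! i, word \<mu> ! Suc i#}. K (word \<mu> ! i) l = K (word \<mu> ! Suc i) l)"
proof -
  have "set_mset (\<mu> - {#word \<mu> ! i, word \<mu> ! Suc i#}) = {word \<mu> ! k | k. k < size \<mu> \<and> k \<noteq> i \<and> k \<noteq> Suc i}"
    using mset_remove_two[of i "word \<mu>" "Suc i"] assms by simp
  then show ?thesis using assms by (auto simp: twin_def blow_def pull_def)
qed

lemma sepD:
  assumes s: "sep K \<mu>" and i: "Suc i < size \<mu>"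
  shows "twin (blow K \<mu>) i \<longleftrightarrow> word \<mu> ! i = word \<mu> ! Suc i"
proof
  assume "word \<mu> ! i = word \<mu> ! Suc i"
  then show "twin (blow K \<mu>) i" using twin_blow[OF i] by simp
next
  assume t: "twin (blow K \<mu>) i"
  show "word \<mu> ! i = word \<mu> ! Suc i"
  proof (rule ccontr)
    assume ne: "word \<mu> ! i \<noteq> word \<mu> ! Suc i"
    have lt: "word \<mu> ! i < word \<mu> ! Suc i" using ne word_mono[of i "Suc i" \<mu>] i by simp
    have "\<not> (word \<mu> ! i < x \<and> x < word \<mu> ! Suc i)" if "x \<in># \<mu>" for x
    proof -
      obtain k where k: "k < size \<mu>" "word \<mu> ! k = x" using word_pos \<open>x \<in># \<mu>\<close> by blast
      show ?thesis
      proof (cases "k \<le> i")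
        case True then show ?thesis using word_mono[of k i \<mu>] k i by simp
      next
        case False then show ?thesis using word_mono[of "Suc i" k \<mu>] k i by simp
      qed
    qed
    moreover have "word \<mu> ! i \<in># \<mu>" "word \<mu> ! Suc i \<in># \<mu>" using i word_nth_in by simp_all
    ultimately have "\<exists>l\<in>#\<mu> - {#word \<mu> ! i, word \<mu> ! Suc i#}. K (word \<mu> ! i) l \<noteq> K (word \<mu> ! Suc i) l"
      using s lt unfolding sep_def by blast
    then show False using t twin_blow[OF i] by blast
  qed
qed

lemma word_adjacent:
  assumes "c \<in># \<mu>" "d \<in># \<mu>" "c < d" "\<forall>x\<in>#\<mu>. \<not> (c < x \<and> x < d)"
  obtains i where "Suc i < size \<mu>" "word \<mu> ! i = c" "word \<mu> ! Suc i = d"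
proof -
  obtain k where "k < size \<mu>" "word \<mu> ! k = d" using word_pos assms(2) by blast
  then obtain j where j: "j < size \<mu>" "word \<mu> ! j = d" and least: "\<And>k. k < j \<Longrightarrow> \<not> (k < size \<mu> \<and> word \<mu> ! k = d)"
    using exists_least_iff[of "\<lambda>k. k < size \<mu> \<and> word \<mu> ! k = d"] by blast
  obtain m where m: "m < size \<mu>" "word \<mu> ! m = c" using word_pos assms(1) by blast
  have "m < j" using word_mono[of j m \<mu>] m j assms(3) by (meson leD leI)
  then obtain i where i: "j = Suc i" "m \<le> i" by (cases j) auto
  have "word \<mu> ! i \<noteq> d" using least[of i] i j by simp
  then have "word \<mu> ! i < d" using word_mono[of i j \<mu>] i j by simp
  moreover have "c \<le> word \<mu> ! i" using word_mono[of m i \<mu>] m i j by simp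
  moreover have "word \<mu> ! i \<in># \<mu>" using word_nth_in i j by simp
  ultimately have "word \<mu> ! i = c" using assms(4) by force
  then show ?thesis using that[of i] i j by simp
qed

lemma sepI:
  assumes "\<And>i. Suc i < size \<mu> \<Longrightarrow> twin (blow K \<mu>) i \<Longrightarrow> word \<mu> ! i = word \<mu> ! Suc i"
  shows "sep K \<mu>"
  unfolding sep_def
proof (intro allI impI)
  fix c d assume a: "c \<in># \<mu>" "d \<in># \<mu>" "c < d" "\<forall>x\<in>#\<mu>. \<not> (c < x \<and> x < d)"
  obtain i where i: "Suc i < size \<mu>" "word \<mu> ! i = c" "word \<mu> ! Suc i = d" using word_adjacent[OF a] .
  then have "\<not> twin (blow K \<mu>) i" using assms[of i] a(3) by auto
  then show "\<exists>l\<in>#\<mu> - {#c, d#}. K c l \<noteq> K d l" using twin_blow[OF i(1)] i by auto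
qed

text \<open>In \<open>sep\<close> at most one copy of each label is removed, so only multiplicities
  capped at 2 matter. Above size two, blocks may be enlarged or shrunk freely.\<close>

lemma sep_cong:
  assumes s: "sep K \<mu>" and c: "\<And>x. min 2 (count \<mu> x) = min 2 (count \<mu>' x)"
  shows "sep K \<mu>'"
proof -
  have le: "k < count \<mu> x \<longleftrightarrow> k < count \<mu>' x" if "k < 2" for k x using c[of x] that by linarith
  have set: "x \<in># \<mu> \<longleftrightarrow> x \<in># \<mu>'" for x using le[of 0 x] by (simp add: count_greater_zero_iff)
  show ?thesis
    unfolding sep_def
  proof (intro allI impI)
    fix c d assume a: "c \<in># \<mu>'" "d \<in># \<mu>'" "c < d" "\<forall>x\<in>#\<mu>'. \<not> (c < x \<and> x < d)"
    then have "\<exists>l\<in>#\<mu> - {#c, d#}. K c l \<noteq> K d l" using s set unfolding sep_def by blast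
    then obtain l where l: "l \<in># \<mu> - {#c, d#}" "K c l \<noteq> K d l" by blast
    have "l \<in># \<mu>' - {#c, d#}"
    proof -
      have "count {#c, d#} l < count \<mu> l" using l(1) by (simp add: in_diff_count)
      moreover have "count {#c, d#} l < 2" using a(3) by auto
      ultimately have "count {#c, d#} l < count \<mu>' l" using le by blast
      then show ?thesis by (simp add: in_diff_count)
    qed
    then show "\<exists>l\<in>#\<mu>' - {#c, d#}. K c l \<noteq> K d l" using l(2) by blast
  qed
qed

text \<open>A block with one vertex has one end and every longer block has two; hence the
  cap.\<close>

lemma count_base: "count (base \<mu>) x = min 2 (count \<mu> x)"
proof -
  have "finite {x \<in> set_mset \<mu>. 2 \<le> count \<mu> x}" by simp
  moreover have "x \<in># \<mu> \<longleftrightarrow> 0 < count \<mu> x" by simp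
  ultimately show ?thesis unfolding base_def by (simp add: count_mset_set' del: count_greater_zero_iff)
qed

lemma base_sub: "base \<mu> \<subseteq># \<mu>"
  by (simp add: subseteq_mset_def count_base)

lemma base_cong: "(\<And>x. min 2 (count \<mu> x) = min 2 (count \<mu>' x)) \<Longrightarrow> base \<mu> = base \<mu>'"
  by (rule multiset_eqI) (simp add: count_base)

text \<open>A sorted list runs through its set in increasing order, so it is determined by the set
  and the positions at which it moves on.\<close>

lemma sorted_eq_pattern:
  assumes s: "sorted w" "sorted w'" and len: "length w = length w'" and set: "set w = set (w' :: nat list)"
    and pat: "\<And>i. Suc i < length w \<Longrightarrow> w ! i = w ! Suc i \<longleftrightarrow> w' ! i = w' ! Suc i"
  shows "w = w'"
proof (rule nth_equalityI[OF len])
  fix i assume "i < length w"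
  then show "w ! i = w' ! i"
  proof (induction i)
    case 0
    have le: "u ! 0 \<le> v ! 0" if "sorted u" "set u = set v" "0 < length u" "0 < length v" for u v :: "nat list"
    proof -
      have "v ! 0 \<in> set u" using that by simp
      then obtain k where "k < length u" "u ! k = v ! 0" by (metis in_set_conv_nth)
      then show ?thesis using sorted_nth_mono[OF that(1), of 0 k] by simp
    qed
    show ?case using le[of w w'] le[of w' w] s set 0 len by simp
  next
    case (Suc i)
    have lt: False if h: "sorted u" "sorted v" "set u = set v" "length u = length v" "Suc i < length u"
      "u ! i = v ! i" "u ! Suc i < v ! Suc i" "u ! i = u ! Suc i \<longleftrightarrow> v ! i = v ! Suc i" for u v :: "nat list"
    proof -
      have "u ! i < u ! Suc i" using h sorted_nth_mono[OF h(1), of i "Suc i"] by auto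
      have "u ! Suc i \<in> set v" using h nth_mem by blast
      then obtain k where k: "k < length v" "v ! k = u ! Suc i" by (metis in_set_conv_nth)
      show False
      proof (cases "k \<le> i")
        case True then show False using sorted_nth_mono[OF h(2), of k i] k h \<open>u ! i < u ! Suc i\<close> by simp
      next
        case False then show False using sorted_nth_mono[OF h(2), of "Suc i" k] k h by simp
      qed
    qed
    have ih: "w ! i = w' ! i" using Suc by simp
    show ?case
      using lt[OF s set len Suc.prems ih _ pat[OF Suc.prems]]
        lt[OF s(2,1) set[symmetric] len[symmetric] _ ih[symmetric] _ pat[OF Suc.prems, symmetric]] Suc.prems len
      by (metis linorder_neqE_nat)
  qed
qed

text \<open>By \<open>sep\<close> the label changes exactly where successive vertices are no twins,
  so the graph shows the pattern required by \<open>sorted_eq_pattern\<close>.\<close>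

lemma blow_inj:
  assumes s: "sep K \<mu>" "sep K \<mu>'" and set: "set_mset \<mu> = set_mset \<mu>'" and sz: "size \<mu> = size \<mu>'"
    and e: "blow K \<mu> = blow K \<mu>'"
  shows "\<mu> = \<mu>'"
proof -
  have "word \<mu> = word \<mu>'"
    by (rule sorted_eq_pattern) (use set sz sepD[OF s(1)] sepD[OF s(2)] e in auto)
  then show ?thesis by (metis mset_sorted_list_of_multiset)
qed

section \<open>Every graph arises from its blocks\<close>

fun start :: "(nat \<Rightarrow> nat \<Rightarrow> bool) \<Rightarrow> nat \<Rightarrow> nat" where
  "start g 0 = 0"
| "start g (Suc y) = (if twin g y then start g y else Suc y)"

lemma start_le: "start g y \<le> y"
  by (induction y) auto

lemma start_mono: "i \<le> j \<Longrightarrow> start g i \<le> start g j"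
proof (induction j rule: dec_induct)
  case (step j)
  then show ?case using start_le[of g j] by auto
qed simp

lemma start_twin: "start g y \<le> x \<Longrightarrow> x < y \<Longrightarrow> twin g x"
  by (induction y) (auto split: if_splits simp: less_Suc_eq)

lemma start_same: "start g j \<le> i \<Longrightarrow> i \<le> j \<Longrightarrow> start g i = start g j"
  by (induction j) (auto split: if_splits simp: le_Suc_eq)

lemma start_adj: "x < start g i \<or> i < x \<Longrightarrow> g i x = g (start g i) x"
proof (induction i)
  case (Suc i)
  then show ?case using twinD[of g i x] start_le[of g i] by (auto split: if_splits)
qed simp

text \<open>Each vertex is labelled by the first vertex of its block, computed by
  \<open>start\<close>.\<close>

lemma blow_exists:
  assumes g: "g \<in> adjs n"
  obtains K \<mu> where "\<And>c d. K c d = K d c" "size \<mu> = n" "g = blow K \<mu>" "sep K \<mu>"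
proof -
  note sym = adjs_sym[OF g]
  \<comment> \<open>The diagonal holds the adjacency inside a block; for a block with one vertex it
    is never read.\<close>
  define K where "K c d = (if c = d then g c (Suc c) else g c d)" for c d
  define w where "w = map (start g) [0..<n]"
  have K: "K c d = K d c" for c d using sym by (auto simp: K_def)
  have sw: "sorted w" unfolding w_def by (auto simp: sorted_iff_nth_mono intro: start_mono)
  have wn: "w ! i = start g i" if "i < n" for i using that by (simp add: w_def)
  have lw: "length w = n" by (simp add: w_def)
  have lt: "g i j = K (start g i) (start g j)" if "i < j" for i j
  proof (cases "start g i = start g j")
    case False
    then have "i < start g j" using start_same[of g j i] that by (meson leI less_imp_le)
    then have "g i j = g i (start g j)" using start_adj[of i g j] sym by metis
    also have "\<dots> = g (start g i) (start g j)" using start_adj[of "start g j" g i] \<open>i < start g j\<close> by simp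
    finally show ?thesis using False by (simp add: K_def)
  next
    case True
    define s where "s = start g j"
    have tw: "twin g x" if "s \<le> x" "x < j" for x using start_twin[of g j x] that by (simp add: s_def)
    have si: "s \<le> i" using start_le[of g i] True by (simp add: s_def)
    have "g i j = g i (Suc i)"
    proof (rule const_step[of "Suc i" j "g i"])
      fix y assume "Suc i \<le> y" "y < j"
      then show "g i (Suc y) = g i y" using twinD'[OF g tw[of y], of i] si by simp
    qed (use that in auto)
    also have "\<dots> = g s (Suc s)"
    proof (rule const_step[of s i "\<lambda>x. g x (Suc x)"])
      fix y assume y: "s \<le> y" "y < i"
      have "g y (Suc (Suc y)) = g (Suc y) (Suc (Suc y))" using twinD[OF tw[of y], of "Suc (Suc y)"] y that by simp
      moreover have "g y (Suc y) = g y (Suc (Suc y))" using twinD'[OF g tw[of "Suc y"], of y] y that by simp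
      ultimately show "g (Suc y) (Suc (Suc y)) = g y (Suc y)" by simp
    qed (use si in auto)
    finally show ?thesis using True by (simp add: K_def s_def)
  qed
  have gw: "g = pull K w"
  proof (intro ext)
    fix i j
    show "g i j = pull K w i j"
    proof (cases "i < n \<and> j < n \<and> i \<noteq> j")
      case False
      then show ?thesis using adjsD[OF g, of i j] by (auto simp: pull_def lw)
    next
      case True
      then show ?thesis using lt[of i j] lt[of j i] sym[of i j] K by (cases i j rule: linorder_cases) (auto simp: pull_def lw wn)
    qed
  qed
  have ww: "word (mset w) = w" by (rule word_unique[OF sw])
  have gb: "g = blow K (mset w)" using gw ww by (simp add: blow_def)
  have "sep K (mset w)"
  proof (rule sepI)
    fix i assume i: "Suc i < size (mset w)" "twin (blow K (mset w)) i"
    then have "twin g i" "Suc i < n" using gb lw by simp_all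
    then show "word (mset w) ! i = word (mset w) ! Suc i" unfolding ww by (simp add: wn)
  qed
  then show ?thesis using that[of K "mset w"] K gb lw by simp
qed

lemma count_word: "count \<mu> p = card {i. i < size \<mu> \<and> word \<mu> ! i = p}"
proof -
  have "count \<mu> p = count (mset (word \<mu>)) p" by simp
  also have "\<dots> = length (filter ((=) p) (word \<mu>))" by (simp only: count_mset count_list_eq_length_filter)
  also have "\<dots> = card {i. i < size \<mu> \<and> p = word \<mu> ! i}" by (simp add: length_filter_conv_card)
  finally show ?thesis by (simp add: eq_commute)
qed

lemma word_three:
  assumes "3 \<le> count \<mu> p"
  obtains v where "0 < v" "Suc v < size \<mu>" "word \<mu> ! (v - 1) = p" "word \<mu> ! v = p" "word \<mu> ! Suc v = p"
proof -
  have "3 \<le> card {i. i < size \<mu> \<and> word \<mu> ! i = p}" using assms by (simp add: count_word)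
  then obtain a b c where abc: "a < size \<mu>" "word \<mu> ! a = p" "b < size \<mu>" "word \<mu> ! b = p"
    "c < size \<mu>" "word \<mu> ! c = p" "a < b" "b < c" by (rule obtain_three) auto
  have "word \<mu> ! (b - 1) = p" using word_mono[of a "b - 1" \<mu>] word_mono[of "b - 1" b \<mu>] abc by simp
  moreover have "word \<mu> ! Suc b = p" using word_mono[of b "Suc b" \<mu>] word_mono[of "Suc b" c \<mu>] abc by simp
  ultimately show ?thesis using that[of b] abc by simp
qed

lemma three_count:
  assumes "0 < v" "Suc v < size \<mu>" "word \<mu> ! (v - 1) = p" "word \<mu> ! v = p" "word \<mu> ! Suc v = p"
  shows "3 \<le> count \<mu> p"
proof -
  have "{v - 1, v, Suc v} \<subseteq> {i. i < size \<mu> \<and> word \<mu> ! i = p}" using assms by auto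
  then have "card {v - 1, v, Suc v} \<le> card {i. i < size \<mu> \<and> word \<mu> ! i = p}" by (intro card_mono) auto
  moreover have "card {v - 1, v, Suc v} = 3" using assms(1) by (cases v) auto
  ultimately show ?thesis by (simp add: count_word)
qed

text \<open>Deleting a mid vertex changes neither the number of block ends nor \<open>base\<close>.
  When no label occurs three times, all vertices are block ends and
  \<open>base \<mu> = \<mu>\<close>.\<close>

lemma card_ends_blow:
  assumes K: "\<And>c d. K c d = K d c" and s: "sep K \<mu>"
  shows "card (ends (size \<mu>) (blow K \<mu>)) = size (base \<mu>)"
  using s
proof (induction "size \<mu>" arbitrary: \<mu>)
  case 0
  then show ?case by (simp add: ends_def base_def)
next
  case (Suc m)
  show ?case
  proof (cases "\<exists>p. 3 \<le> count \<mu> p")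
    case True
    then obtain p where p: "3 \<le> count \<mu> p" by blast
    obtain v where v: "0 < v" "Suc v < size \<mu>" "word \<mu> ! (v - 1) = p" "word \<mu> ! v = p" "word \<mu> ! Suc v = p"
      using word_three[OF p] .
    have "twin (blow K \<mu>) (v - 1)" using sepD[OF Suc.prems, of "v - 1"] v by simp
    moreover have "twin (blow K \<mu>) v" using sepD[OF Suc.prems, of v] v by simp
    ultimately have m: "mid (size \<mu>) (blow K \<mu>) v" using v by (simp add: mid_def)
    have pm: "p \<in># \<mu>" using p by (simp add: count_greater_zero_iff[symmetric] del: count_greater_zero_iff)
    have c: "min 2 (count \<mu> x) = min 2 (count (\<mu> - {#p#}) x)" for x using p by auto
    have sz: "size (\<mu> - {#p#}) = size \<mu> - 1" using pm by (simp add: size_Diff_singleton)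
    have "card (ends (size \<mu>) (blow K \<mu>)) = card (ends (size \<mu> - 1) (del (blow K \<mu>) v))"
      using ends_del_mid[OF blow_adjs[OF K] m] by simp
    also have "del (blow K \<mu>) v = blow K (\<mu> - {#p#})" using del_blow[of v \<mu> K] v by simp
    also have "card (ends (size \<mu> - 1) (blow K (\<mu> - {#p#}))) = size (base (\<mu> - {#p#}))"
      using Suc.hyps(1)[of "\<mu> - {#p#}"] sep_cong[OF Suc.prems c] sz Suc.hyps(2) by simp
    also have "base (\<mu> - {#p#}) = base \<mu>" by (rule base_cong) (use c in simp)
    finally show ?thesis .
  next
    case False
    then have "count \<mu> x \<le> 2" for x by (metis not_less_eq_eq numeral_2_eq_2 numeral_3_eq_3)
    then have "base \<mu> = \<mu>" by (intro multiset_eqI) (simp add: count_base min_absorb2)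
    moreover have "ends (size \<mu>) (blow K \<mu>) = {..<size \<mu>}"
    proof -
      have "\<not> mid (size \<mu>) (blow K \<mu>) v" if "v < size \<mu>" for v
      proof
        assume m: "mid (size \<mu>) (blow K \<mu>) v"
        then have "0 < v" "Suc v < size \<mu>" by (simp_all add: mid_def)
        moreover from this have "word \<mu> ! (v - 1) = word \<mu> ! v" "word \<mu> ! v = word \<mu> ! Suc v"
          using sepD[OF Suc.prems, of "v - 1"] sepD[OF Suc.prems, of v] m by (simp_all add: mid_def)
        ultimately show False using three_count[of v \<mu> "word \<mu> ! v"] False by metis
      qed
      then show ?thesis by (auto simp: ends_def)
    qed
    ultimately show ?thesis by simp
  qed
qed

text \<open>A vertex with twins on both sides can be reconstructed: towards \<open>y - 1\<close> it
  behaves like \<open>y + 1\<close>, and towards all other vertices like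
  \<open>y - 1\<close>.\<close>

lemma blow_insert:
  assumes g: "g \<in> adjs (Suc m)" and mid: "mid (Suc m) g y" and d: "del g y = blow K \<beta>" and sz: "size \<beta> = m"
    and p: "word \<beta> ! (y - 1) = p" "word \<beta> ! y = p" and K: "\<And>c d. K c d = K d c"
  shows "g = blow K (add_mset p \<beta>)"
proof -
  let ?w = "word \<beta>"
  define w where "w = take y ?w @ p # drop y ?w"
  obtain u where u: "y = Suc u" using mid by (cases y) (auto simp: mid_def)
  have y: "y < m" and tw: "twin g u" "twin g y" using mid u by (auto simp: mid_def)
  have wn: "w ! skip y i = ?w ! i" if "i < m" for i
    using that y sz by (auto simp: w_def nth_append skip_def min_def)
  have wy: "w ! y = p" using y sz by (simp add: w_def nth_append min_def)
  have lw: "length w = Suc m" using y sz by (simp add: w_def)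
  have sw: "sorted w"
  proof -
    have e: "?w = take y ?w @ p # drop (Suc y) ?w" using y sz p id_take_nth_drop[of y ?w] by simp
    have "sorted (take y ?w @ p # drop (Suc y) ?w)" using e sorted_word by metis
    moreover have "drop y ?w = p # drop (Suc y) ?w" using y sz p Cons_nth_drop_Suc[of y ?w] by simp
    ultimately show ?thesis by (auto simp: w_def sorted_append)
  qed
  have "mset w = add_mset p (mset (take y ?w @ drop y ?w))"
    unfolding w_def by (simp only: mset_append mset.simps union_mset_add_mset_right)
  also have "mset (take y ?w @ drop y ?w) = \<beta>" by (metis append_take_drop_id mset_sorted_list_of_multiset)
  finally have "mset w = add_mset p \<beta>" .
  then have ww: "word (add_mset p \<beta>) = w" using word_unique[OF sw] by simp
  have dd: "g (skip y i) (skip y j) \<longleftrightarrow> i < m \<and> j < m \<and> i \<noteq> j \<and> K (?w ! i) (?w ! j)" for i j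
    using fun_cong[OF fun_cong[OF d], of i j] sz by (simp add: del_def blow_def pull_def)
  have row: "g y (skip y j) \<longleftrightarrow> j < m \<and> K p (?w ! j)" for j
  proof (cases "j = u")
    case True
    have "g y u = g (Suc y) u" using twinD[OF tw(2), of u] u by simp
    then show ?thesis using dd[of y u] True u y p by simp
  next
    case False
    then have "g u (skip y j) = g y (skip y j)" using twinD[OF tw(1), of "skip y j"] u by (auto simp: skip_def)
    then show ?thesis using dd[of u j] False u y p by auto
  qed
  have "g i j = pull K w i j" for i j
  proof -
    consider "i = y" "j = y" | j' where "i = y" "j = skip y j'" | i' where "j = y" "i = skip y i'"
      | i' j' where "i = skip y i'" "j = skip y j'" using skip_surj by metis
    then show ?thesis
    proof cases
      case 1 then show ?thesis using g by (simp add: pull_def)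
    next
      case (2 j')
      then show ?thesis using row[of j'] wn[of j'] wy lw y skip_less_iff[of y "Suc m" j'] by (auto simp: pull_def)
    next
      case (3 i')
      then show ?thesis using row[of i'] wn[of i'] wy lw y skip_less_iff[of y "Suc m" i'] adjs_sym[OF g, of i j] K
        by (auto simp: pull_def)
    next
      case (4 i' j')
      then show ?thesis using dd[of i' j'] wn[of i'] wn[of j'] lw y
          skip_less_iff[of y "Suc m" i'] skip_less_iff[of y "Suc m" j'] by (auto simp: pull_def)
    qed
  qed
  then have "g = pull K w" by blast
  then show ?thesis using ww by (simp add: blow_def)
qed

text \<open>As no block end can be lost, the shadow is the deletion of a mid vertex \<open>y\<close>
  by \<open>del_cases\<close>. Its two neighbours become successive twins of the shadow, so they
  carry one label, of multiplicity at least 2.\<close>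

lemma blow_parent:
  assumes K: "\<And>c d. K c d = K d c" and s: "sep K \<beta>" and sz: "size \<beta> = m"
    and g: "g \<in> adjs (Suc m)" and v: "v < Suc m" and d: "del g v = blow K \<beta>"
    and le: "card (ends (Suc m) g) \<le> size (base \<beta>)"
  obtains p where "2 \<le> count \<beta> p" "g = blow K (add_mset p \<beta>)"
proof (rule del_cases[OF g v])
  assume "card (ends (Suc m - 1) (del g v)) < card (ends (Suc m) g)"
  then show ?thesis using le d card_ends_blow[OF K s] sz by simp
next
  fix y assume mid: "mid (Suc m) g y" and e: "del g v = del g y"
  have dy: "del g y = blow K \<beta>" using d e by simp
  have y: "twin g (y - 1)" "twin g y" "0 < y" "y < m" using mid by (auto simp: mid_def)
  have "twin (del g y) (y - 1)" using twin_del[OF g y(1-3), of "y - 1"] y by simp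
  then have eq: "word \<beta> ! (y - 1) = word \<beta> ! y" using sepD[OF s, of "y - 1"] dy y sz by simp
  then have "g = blow K (add_mset (word \<beta> ! y) \<beta>)"
    using blow_insert[OF g mid dy sz _ _ K, of "word \<beta> ! y"] by simp
  moreover have "2 \<le> count \<beta> (word \<beta> ! y)"
  proof -
    have "{y - 1, y} \<subseteq> {i. i < size \<beta> \<and> word \<beta> ! i = word \<beta> ! y}" using y sz eq by auto
    then have "card {y - 1, y} \<le> card {i. i < size \<beta> \<and> word \<beta> ! i = word \<beta> ! y}" by (intro card_mono) auto
    moreover have "card {y - 1, y} = 2" using y(3) by auto
    ultimately show ?thesis by (simp add: count_word)
  qed
  ultimately show ?thesis using that by blast
qed

section \<open>Minimal counterexamples\<close>

definition shadF :: "nat \<Rightarrow> (nat \<Rightarrow> nat \<Rightarrow> bool) set \<Rightarrow> (nat \<Rightarrow> nat \<Rightarrow> bool) set" where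
  "shadF n F = (\<Union>g\<in>F. shad n g)"

locale counterexample =
  fixes n :: nat and F :: "(nat \<Rightarrow> nat \<Rightarrow> bool) set"
  assumes n: "136 \<le> n" and F: "F \<subseteq> adjs n" and card_F: "card F < n"
    and counter: "card (shadF n F) < card F"
    and minimal: "\<And>G. G \<subset> F \<Longrightarrow> card G \<le> card (shadF n G)"
begin

lemma finF: "finite F"
  using F finite_adjs finite_subset by blast

lemma finS: "finite (shadF n F)"
  using finF by (simp add: shadF_def)

text \<open>By minimality \<open>F - S\<close> has at least as many shadows as elements, and
  \<open>U\<close> comes in addition to these.\<close>

lemma private_shad:
  assumes S: "S \<subseteq> F" "S \<noteq> {}" and U: "U \<subseteq> shadF n F" "U \<inter> shadF n (F - S) = {}"
  shows "card U < card S"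
proof -
  have "F - S \<subset> F" using S by blast
  then have le: "card (F - S) \<le> card (shadF n (F - S))" by (rule minimal)
  have sub: "shadF n (F - S) \<subseteq> shadF n F" by (auto simp: shadF_def)
  have "card U + card (shadF n (F - S)) = card (U \<union> shadF n (F - S))"
    using U sub finS by (intro card_Un_disjoint[symmetric]) (auto intro: finite_subset)
  also have "\<dots> \<le> card (shadF n F)" using U sub finS by (intro card_mono) auto
  finally have "card U + card (F - S) < card F" using le counter by linarith
  moreover have "card (F - S) = card F - card S" using S finF finite_subset by (intro card_Diff_subset) auto
  moreover have "card S \<le> card F" using S finF by (intro card_mono)
  ultimately show ?thesis by linarith
qed

lemma covered:
  assumes g: "g \<in> F" and h: "h \<in> shad n g"
  obtains g' where "g' \<in> F" "g' \<noteq> g" "h \<in> shad n g'"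
proof -
  have "{h} \<subseteq> shadF n F" using g h by (auto simp: shadF_def)
  then have "{h} \<inter> shadF n (F - {g}) \<noteq> {}" using private_shad[of "{g}" "{h}"] g by auto
  then show ?thesis using that by (auto simp: shadF_def)
qed

text \<open>Inclusion-exclusion; 24 is the bound 8 of \<open>card_shad_Int\<close> for three
  pairs.\<close>

lemma shad_le:
  assumes "g1 \<in> F" "g2 \<in> F" "g3 \<in> F" "g1 \<noteq> g2" "g1 \<noteq> g3" "g2 \<noteq> g3"
  shows "card (shad n g1) + card (shad n g2) + card (shad n g3) \<le> card (shadF n F) + 24"
proof -
  let ?A = "shad n g1" and ?B = "shad n g2" and ?C = "shad n g3"
  have i: "card (?A \<inter> ?B) \<le> 8" "card (?A \<inter> ?C) \<le> 8" "card (?B \<inter> ?C) \<le> 8"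
    using card_shad_Int F assms by blast+
  have "card ?A + card ?B = card (?A \<union> ?B) + card (?A \<inter> ?B)" by (rule card_Un_Int) auto
  moreover have "card (?A \<union> ?B) + card ?C = card (?A \<union> ?B \<union> ?C) + card ((?A \<union> ?B) \<inter> ?C)"
    by (rule card_Un_Int) auto
  moreover have "card ((?A \<union> ?B) \<inter> ?C) \<le> card (?A \<inter> ?C) + card (?B \<inter> ?C)"
    by (metis Int_Un_distrib2 card_Un_le)
  moreover have "card (?A \<union> ?B \<union> ?C) \<le> card (shadF n F)"
    using assms finS by (intro card_mono) (auto simp: shadF_def)
  ultimately show ?thesis using i by linarith
qed

end

section \<open>Loss of block ends under deletion\<close>

lemma ends_witness:
  assumes g: "g \<in> adjs n" and y: "y \<in> ends n g"
  shows "\<exists>B. card B \<le> 4 \<and> finite B \<and> (\<forall>v<n. v \<notin> B \<longrightarrow> y \<in> skip v ` ends (n - 1) (del g v))"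
proof -
  have yn: "y < n" "\<not> mid n g y" using y by (auto simp: ends_def)
  have in_image: "y \<in> skip v ` ends (n - 1) (del g v)"
    if "v < n" "skip v r = y" "\<not> mid (n - 1) (del g v) r" for v r
    using that yn skip_less_iff[of v n r] by (auto simp: ends_def)
  \<comment> \<open>Each alternative is a certificate, on at most three vertices, for
    \<open>y\<close> being a block end. It survives every deletion that avoids these
    vertices.\<close>
  consider "y = 0" | "Suc y = n" | "0 < y" "Suc y < n" "\<not> twin g (y - 1)" | "Suc y < n" "\<not> twin g y"
    using yn unfolding mid_def by (metis Suc_lessI gr0I)
  then show ?thesis
  proof cases
    case 1
    have "y \<in> skip v ` ends (n - 1) (del g v)" if "v < n" "v \<notin> {y}" for v
      using in_image[of v 0] that 1 by (auto simp: mid_def)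
    then show ?thesis by (intro exI[of _ "{y}"]) auto
  next
    case 2
    have "y \<in> skip v ` ends (n - 1) (del g v)" if "v < n" "v \<notin> {y}" for v
      using in_image[of v "y - 1"] that 2 by (auto simp: mid_def)
    then show ?thesis by (intro exI[of _ "{y}"]) auto
  next
    case 3
    then obtain w where w: "w \<noteq> y - 1" "w \<noteq> y" "g (y - 1) w \<noteq> g y w" by (auto simp: twin_def)
    have "y \<in> skip v ` ends (n - 1) (del g v)" if v: "v < n" "v \<notin> {y - 1, y, w}" for v
    proof -
      have "y \<noteq> v" "w \<noteq> v" using v by auto
      then obtain r x where r: "skip v r = y" and x: "skip v x = w"
        using skip_surj[of y v] skip_surj[of w v] by blast
      have r0: "0 < r" using r v(2) 3(1) by (cases r) (auto simp: skip_def split: if_splits)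
      have r1: "skip v (r - 1) = y - 1" using r v r0 by (auto simp: skip_def split: if_splits)
      have "\<not> twin (del g v) (r - 1)"
      proof
        assume t: "twin (del g v) (r - 1)"
        have "x \<noteq> r - 1" "x \<noteq> Suc (r - 1)" using w r r1 x r0 by auto
        from twinD[OF t this] show False using w r r1 x r0 by (simp add: del_def)
      qed
      then show ?thesis using in_image[OF v(1) r] by (auto simp: mid_def)
    qed
    then show ?thesis by (intro exI[of _ "{y - 1, y, w}"]) (auto simp: card_insert_if)
  next
    case 4
    then obtain w where w: "w \<noteq> y" "w \<noteq> Suc y" "g y w \<noteq> g (Suc y) w" by (auto simp: twin_def)
    have "y \<in> skip v ` ends (n - 1) (del g v)" if v: "v < n" "v \<notin> {y, Suc y, w}" for v
    proof -
      have "y \<noteq> v" "w \<noteq> v" using v by auto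
      then obtain r x where r: "skip v r = y" and x: "skip v x = w"
        using skip_surj[of y v] skip_surj[of w v] by blast
      have r1: "skip v (Suc r) = Suc y" using r v by (auto simp: skip_def split: if_splits)
      have "\<not> twin (del g v) r"
      proof
        assume t: "twin (del g v) r"
        have "x \<noteq> r" "x \<noteq> Suc r" using w r r1 x by auto
        from twinD[OF t this] show False using w r r1 x by (simp add: del_def)
      qed
      then show ?thesis using in_image[OF v(1) r] by (auto simp: mid_def)
    qed
    then show ?thesis by (intro exI[of _ "{y, Suc y, w}"]) (auto simp: card_insert_if)
  qed
qed

lemma sum_card_swap:
  assumes "finite V" "finite E"
  shows "(\<Sum>v\<in>V. card {y \<in> E. P v y}) = (\<Sum>y\<in>E. card {v \<in> V. P v y})"
proof -
  have "card {y \<in> E. P v y} = (\<Sum>y\<in>E. of_bool (P v y))" for v using assms by (simp add: sum.If_cases of_bool_def Int_def)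
  moreover have "card {v \<in> V. P v y} = (\<Sum>v\<in>V. of_bool (P v y))" for y using assms by (simp add: sum.If_cases of_bool_def Int_def)
  ultimately show ?thesis using sum.swap[of "\<lambda>v y. of_bool (P v y)" E V] by simp
qed

text \<open>Double counting of the pairs of a deleted vertex \<open>v\<close> and a block end whose
  certificate contains \<open>v\<close>; \<open>k v\<close> is the number of block ends endangered
  by \<open>v\<close>.\<close>

lemma ends_drop:
  assumes g: "g \<in> adjs n"
  obtains k :: "nat \<Rightarrow> nat" where "\<And>v. v < n \<Longrightarrow> card (ends n g) \<le> card (ends (n - 1) (del g v)) + k v"
    "(\<Sum>v<n. k v) \<le> 4 * n"
proof -
  define B where "B y = (SOME B. card B \<le> 4 \<and> finite B \<and> (\<forall>v<n. v \<notin> B \<longrightarrow> y \<in> skip v ` ends (n - 1) (del g v)))" for y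
  have B: "card (B y) \<le> 4 \<and> finite (B y) \<and> (\<forall>v<n. v \<notin> B y \<longrightarrow> y \<in> skip v ` ends (n - 1) (del g v))"
    if "y \<in> ends n g" for y
    unfolding B_def by (rule someI_ex[OF ends_witness[OF g that]])
  define k where "k v = card {y \<in> ends n g. v \<in> B y}" for v
  have "card (ends n g) \<le> card (ends (n - 1) (del g v)) + k v" if v: "v < n" for v
  proof -
    have "ends n g \<subseteq> skip v ` ends (n - 1) (del g v) \<union> {y \<in> ends n g. v \<in> B y}" using B v by blast
    then have "card (ends n g) \<le> card (skip v ` ends (n - 1) (del g v) \<union> {y \<in> ends n g. v \<in> B y})"
      by (intro card_mono) auto
    also have "\<dots> \<le> card (skip v ` ends (n - 1) (del g v)) + k v" unfolding k_def by (rule card_Un_le)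
    finally show ?thesis by (simp add: card_image inj_on_def)
  qed
  moreover have "(\<Sum>v<n. k v) \<le> 4 * n"
  proof -
    have "(\<Sum>v<n. k v) = (\<Sum>y\<in>ends n g. card {v \<in> {..<n}. v \<in> B y})"
      unfolding k_def by (rule sum_card_swap) auto
    also have "\<dots> \<le> (\<Sum>y\<in>ends n g. 4)"
    proof (rule sum_mono)
      fix y assume y: "y \<in> ends n g"
      have "card {v \<in> {..<n}. v \<in> B y} \<le> card (B y)" using B[OF y] by (intro card_mono) auto
      then show "card {v \<in> {..<n}. v \<in> B y} \<le> 4" using B[OF y] by linarith
    qed
    also have "\<dots> \<le> 4 * n"
    proof -
      have "card (ends n g) \<le> card {..<n}" by (intro card_mono) (auto simp: ends_def)
      then show ?thesis by simp
    qed
    finally show ?thesis .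
  qed
  ultimately show ?thesis using that by blast
qed

text \<open>At most 15 deletions destroy more than a quarter of the block ends, so two further members of a
  counterexample have large shadows, and by the codegree bound the three shadows barely overlap.\<close>

lemma (in counterexample) ends_bound:
  assumes g0: "g0 \<in> F"
  shows "card (ends n g0) + 1 < n"
proof (rule ccontr)
  assume "\<not> ?thesis"
  then have E: "n \<le> card (ends n g0) + 1" by simp
  have ga: "g0 \<in> adjs n" using g0 F by blast
  obtain k where k: "\<And>v. v < n \<Longrightarrow> card (ends n g0) \<le> card (ends (n - 1) (del g0 v)) + k v"
    and sk: "(\<Sum>v<n. k v) \<le> 4 * n" using ends_drop[OF ga] by blast
  define bad where "bad = {v. v < n \<and> n < 4 * k v}"
  have fb: "finite bad" by (simp add: bad_def)
  have "card bad * (n + 1) = (\<Sum>v\<in>bad. n + 1)" by simp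
  also have "\<dots> \<le> (\<Sum>v\<in>bad. 4 * k v)" by (intro sum_mono) (auto simp: bad_def)
  also have "\<dots> \<le> (\<Sum>v<n. 4 * k v)" by (intro sum_mono2) (auto simp: bad_def)
  also have "\<dots> \<le> 16 * n" using sk by (simp add: sum_distrib_left[symmetric])
  finally have "card bad * (n + 1) \<le> 16 * n" .
  have "card bad < 16"
  proof (rule ccontr)
    assume "\<not> card bad < 16"
    then have "16 * (n + 1) \<le> card bad * (n + 1)" by (intro mult_le_mono1) simp
    then show False using \<open>card bad * (n + 1) \<le> 16 * n\<close> by simp
  qed
  define good where "good = del g0 ` ({..<n} - bad)"
  have "shad n g0 \<subseteq> good \<union> del g0 ` bad" by (auto simp: shad_def good_def)
  then have "card (shad n g0) \<le> card (good \<union> del g0 ` bad)"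
    using fb by (intro card_mono) (auto simp: good_def)
  also have "\<dots> \<le> card good + card (del g0 ` bad)" by (rule card_Un_le)
  also have "card (del g0 ` bad) \<le> card bad" using fb by (rule card_image_le)
  finally have cg: "card (shad n g0) \<le> card good + card bad" by simp
  have s0: "card (ends n g0) \<le> 2 * card (shad n g0)" by (rule ends_le_shad[OF ga])
  have large: "\<exists>g \<in> F. g \<noteq> g0 \<and> h \<in> shad n g \<and> 3 * n \<le> 8 * card (shad n g) + 4" if h: "h \<in> good" for h
  proof -
    obtain v where v: "v < n" "v \<notin> bad" "h = del g0 v" using h by (auto simp: good_def)
    then have "h \<in> shad n g0" by (auto simp: shad_def)
    then obtain g where g: "g \<in> F" "g \<noteq> g0" "h \<in> shad n g" using covered[OF g0] by blast
    then obtain u where u: "u < n" "h = del g u" by (auto simp: shad_def)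
    have gA: "g \<in> adjs n" using g F by blast
    have "card (ends n g0) \<le> card (ends (n - 1) h) + k v" using k[OF v(1)] v(3) by simp
    also have "card (ends (n - 1) h) \<le> card (ends n g)" using ends_del_le[OF gA u(1)] u(2) by simp
    also have "card (ends n g) \<le> 2 * card (shad n g)" by (rule ends_le_shad[OF gA])
    finally have "n \<le> 2 * card (shad n g) + k v + 1" using E by linarith
    moreover have "4 * k v \<le> n" using v by (simp add: bad_def)
    ultimately have "3 * n \<le> 8 * card (shad n g) + 4" by linarith
    then show ?thesis using g by blast
  qed
  have "0 < card good" using cg s0 E \<open>card bad < 16\<close> n by linarith
  then obtain h1 where h1: "h1 \<in> good" by (metis card_gt_0_iff ex_in_conv)
  obtain g1 where g1: "g1 \<in> F" "g1 \<noteq> g0" "h1 \<in> shad n g1" "3 * n \<le> 8 * card (shad n g1) + 4"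
    using large[OF h1] by blast
  have fg: "finite good" by (simp add: good_def)
  have "good \<subseteq> shad n g0" by (auto simp: good_def shad_def)
  then have "card (good \<inter> shad n g1) \<le> card (shad n g0 \<inter> shad n g1)" by (intro card_mono) auto
  also have "\<dots> \<le> 8" using card_shad_Int[OF ga] F g1 by blast
  finally have "card (good \<inter> shad n g1) \<le> 8" .
  moreover have "card good = card (good \<inter> shad n g1) + card (good - shad n g1)"
    using card_Int_Diff[of good "shad n g1"] fg by simp
  ultimately have "0 < card (good - shad n g1)" using cg s0 E \<open>card bad < 16\<close> n by linarith
  then obtain h2 where h2: "h2 \<in> good" "h2 \<notin> shad n g1" by (metis card_gt_0_iff ex_in_conv DiffE)
  obtain g2 where g2: "g2 \<in> F" "g2 \<noteq> g0" "h2 \<in> shad n g2" "3 * n \<le> 8 * card (shad n g2) + 4"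
    using large[OF h2(1)] by blast
  have "g1 \<noteq> g2" using g2 h2 by blast
  then have "card (shad n g0) + card (shad n g1) + card (shad n g2) \<le> card (shadF n F) + 24"
    using shad_le[OF g0 g1(1) g2(1)] g1 g2 by blast
  \<comment> \<open>The three shadows have at least \<open>(n - 1) / 2 + 2 * (3 * n - 4) / 8\<close>
    elements in total, more than the possible \<open>n - 2 + 24\<close>.\<close>
  then show False using g1(4) g2(4) s0 E counter card_F n by linarith
qed

section \<open>Second moments of shadow multiplicities\<close>

lemma cubic_pos:
  fixes e m :: int
  assumes e: "2 \<le> e" "e \<le> m" and s: "136 \<le> m + e"
  shows "0 < (e - 1) * m\<^sup>2 - 34 * e * m + 4 * m - 32 * e\<^sup>2 + 64 * e"
proof -
  define f where "f x = (e - 1) * x\<^sup>2 - 34 * e * x + 4 * x - 32 * e\<^sup>2 + 64 * e" for x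
  \<comment> \<open>By monotonicity in \<open>m\<close> only the boundary has to be checked:
    \<open>m + e = 136\<close> for \<open>e \<le> 68\<close> and \<open>m = e\<close> for larger
    \<open>e\<close>.\<close>
  have mono: "f x \<le> f m" if x: "x \<le> m" "136 \<le> m + x" for x
  proof -
    have "f m - f x = (m - x) * ((e - 1) * (m + x) - 34 * e + 4)"
      by (simp add: f_def power2_eq_square algebra_simps)
    note * = this
    have "(e - 1) * 136 \<le> (e - 1) * (m + x)" using e x by (intro mult_left_mono) auto
    moreover have "(e - 1) * 136 = 136 * e - 136" by (simp add: algebra_simps)
    then have "34 * e - 4 \<le> (e - 1) * 136" using e(1) by linarith
    ultimately have "34 * e - 4 \<le> (e - 1) * (m + x)" by (rule order_trans[rotated])
    then have "0 \<le> (e - 1) * (m + x) - 34 * e + 4" by simp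
    then have "0 \<le> f m - f x" unfolding * using x(1) by (intro mult_nonneg_nonneg) simp_all
    then show ?thesis by simp
  qed
  show ?thesis
  proof (cases "e \<le> 68")
    case True
    have "f (136 - e) = (e - 2) * (68 - e) * (201 - e) + (9384 - 2 * e)"
      by (simp add: f_def power2_eq_square algebra_simps)
    moreover have "0 \<le> (e - 2) * (68 - e) * (201 - e)" using e True by simp
    ultimately have "0 < f (136 - e)" using True by linarith
    then show ?thesis using mono[of "136 - e"] s True e by (simp add: f_def)
  next
    case False
    have "f e = e * (e * (e - 67) + 68)" by (simp add: f_def power2_eq_square algebra_simps)
    moreover have "0 < e * (e - 67) + 68" using False by (simp add: add_nonneg_pos)
    ultimately have "0 < f e" using False by simp
    moreover have "f e \<le> f m" using mono[of e] e False by simp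
    ultimately show ?thesis by (simp add: f_def)
  qed
qed

text \<open>Nonnegativity of the variance of \<open>d\<close>, multiplied out.\<close>

lemma sum_squared_le:
  fixes d :: "'a \<Rightarrow> real"
  assumes "finite X"
  shows "(\<Sum>h\<in>X. d h)\<^sup>2 \<le> (\<Sum>h\<in>X. (d h)\<^sup>2) * real (card X)"
proof (cases "X = {}")
  case False
  define M where "M = real (card X)"
  define T where "T = (\<Sum>h\<in>X. d h)"
  have M: "0 < M" using False assms by (simp add: M_def card_gt_0_iff)
  have "0 \<le> (\<Sum>h\<in>X. (M * d h - T)\<^sup>2)" by (intro sum_nonneg) simp
  also have "\<dots> = (\<Sum>h\<in>X. M\<^sup>2 * (d h)\<^sup>2 - 2 * M * T * d h + T\<^sup>2)"
    by (intro sum.cong) (simp_all add: power2_eq_square algebra_simps)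
  also have "\<dots> = M\<^sup>2 * (\<Sum>h\<in>X. (d h)\<^sup>2) - 2 * M * T * T + M * T\<^sup>2"
    by (simp add: sum.distrib sum_subtractf sum_distrib_left M_def T_def)
  also have "\<dots> = M * (M * (\<Sum>h\<in>X. (d h)\<^sup>2) - T\<^sup>2)" by (simp add: power2_eq_square algebra_simps)
  finally have "0 \<le> M * (\<Sum>h\<in>X. (d h)\<^sup>2) - T\<^sup>2" using M by (simp add: zero_le_mult_iff)
  then show ?thesis by (simp add: M_def T_def mult.commute)
qed simp

text \<open>Incidences of a graph with a shadow, and of an ordered pair of graphs with a common
  shadow, are counted in two ways.\<close>

lemma sum_shad_squares:
  assumes fin: "finite P" and X: "finite X" "\<And>g. g \<in> P \<Longrightarrow> shad n g \<subseteq> X"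
  shows "(\<Sum>h\<in>X. card {g \<in> P. h \<in> shad n g}) = (\<Sum>g\<in>P. card (shad n g))"
    and "(\<Sum>h\<in>X. (card {g \<in> P. h \<in> shad n g})\<^sup>2) = (\<Sum>g\<in>P. \<Sum>g'\<in>P. card (shad n g \<inter> shad n g'))"
proof -
  have "(\<Sum>h\<in>X. card {g \<in> P. h \<in> shad n g}) = (\<Sum>g\<in>P. card {h \<in> X. h \<in> shad n g})"
    using sum_card_swap[OF X(1) fin] .
  also have "\<dots> = (\<Sum>g\<in>P. card (shad n g))"
    using X(2) by (intro sum.cong refl arg_cong[where f = card]) blast
  finally show "(\<Sum>h\<in>X. card {g \<in> P. h \<in> shad n g}) = (\<Sum>g\<in>P. card (shad n g))" .
  have "(\<Sum>h\<in>X. (card {g \<in> P. h \<in> shad n g})\<^sup>2) = (\<Sum>h\<in>X. card {q \<in> P \<times> P. h \<in> shad n (fst q) \<inter> shad n (snd q)})"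
  proof (rule sum.cong[OF refl])
    fix h
    have "{q \<in> P \<times> P. h \<in> shad n (fst q) \<inter> shad n (snd q)} = {g \<in> P. h \<in> shad n g} \<times> {g \<in> P. h \<in> shad n g}" by auto
    then show "(card {g \<in> P. h \<in> shad n g})\<^sup>2 = card {q \<in> P \<times> P. h \<in> shad n (fst q) \<inter> shad n (snd q)}"
      by (simp add: card_cartesian_product power2_eq_square)
  qed
  also have "\<dots> = (\<Sum>q\<in>P \<times> P. card {h \<in> X. h \<in> shad n (fst q) \<inter> shad n (snd q)})"
    using fin by (intro sum_card_swap X) simp
  also have "\<dots> = (\<Sum>q\<in>P \<times> P. card (shad n (fst q) \<inter> shad n (snd q)))"
    using X(2) by (intro sum.cong refl arg_cong[where f = card]) fastforce
  also have "\<dots> = (\<Sum>g\<in>P. \<Sum>g'\<in>P. card (shad n g \<inter> shad n g'))"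
    by (simp add: sum.cartesian_product split_def)
  finally show "(\<Sum>h\<in>X. (card {g \<in> P. h \<in> shad n g})\<^sup>2) = (\<Sum>g\<in>P. \<Sum>g'\<in>P. card (shad n g \<inter> shad n g'))" .
qed

text \<open>Let \<open>T\<close> be the number of incidences between the \<open>N = e + 1\<close>
  graphs and the \<open>M \<le> n - 2\<close> shadows. The second moment is at most
  \<open>T + 8 * (N * e)\<close>, so Cauchy-Schwarz gives
  \<open>T * T \<le> (T + 8 * (N * e)) * M\<close>. But \<open>T \<ge> N * (n - e) / 2\<close>, as a
  graph has at least half as many shadows as block ends; by \<open>cubic_pos\<close> this is too
  large.\<close>

lemma (in counterexample) many_large:
  assumes P: "P \<subseteq> F" "card P = Suc e" and E: "\<And>g. g \<in> P \<Longrightarrow> n - e \<le> card (ends n g)"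
    and e: "2 \<le> e" "2 * e \<le> n"
  shows False
proof -
  define X where "X = shadF n F"
  define d where "d h = card {g \<in> P. h \<in> shad n g}" for h
  define T where "T = (\<Sum>g\<in>P. card (shad n g))"
  define N where "N = card P"
  define M where "M = card X"
  have fP: "finite P" using P finF finite_subset by blast
  have fX: "finite X" and subX: "\<And>g. g \<in> P \<Longrightarrow> shad n g \<subseteq> X" using finS P by (auto simp: X_def shadF_def)
  note sums = sum_shad_squares[OF fP fX subX]
  have "(\<Sum>h\<in>X. (d h)\<^sup>2) \<le> T + 8 * (N * e)"
  proof -
    have "(\<Sum>h\<in>X. (d h)\<^sup>2) = (\<Sum>g\<in>P. \<Sum>g'\<in>P. card (shad n g \<inter> shad n g'))" using sums(2) by (simp add: d_def)
    also have "\<dots> \<le> (\<Sum>g\<in>P. card (shad n g) + 8 * e)"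
    proof (rule sum_mono)
      fix g assume g: "g \<in> P"
      have "(\<Sum>g'\<in>P. card (shad n g \<inter> shad n g')) = card (shad n g) + (\<Sum>g'\<in>P - {g}. card (shad n g \<inter> shad n g'))"
        using fP g by (simp add: sum.remove)
      also have "(\<Sum>g'\<in>P - {g}. card (shad n g \<inter> shad n g')) \<le> (\<Sum>g'\<in>P - {g}. 8)"
        using P F g by (intro sum_mono card_shad_Int) auto
      also have "\<dots> = 8 * e" using fP g P by simp
      finally show "(\<Sum>g'\<in>P. card (shad n g \<inter> shad n g')) \<le> card (shad n g) + 8 * e" by simp
    qed
    also have "\<dots> = T + 8 * (N * e)" by (simp add: T_def sum.distrib N_def)
    finally show ?thesis .
  qed
  then have sq: "(\<Sum>h\<in>X. (real (d h))\<^sup>2) \<le> real T + 8 * (real N * real e)"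
    by (metis (mono_tags, lifting) of_nat_add of_nat_le_iff of_nat_mult of_nat_numeral of_nat_power of_nat_sum sum.cong)
  have sT: "(\<Sum>h\<in>X. real (d h)) = real T" using sums(1) by (simp add: d_def T_def flip: of_nat_sum)
  have "(real T)\<^sup>2 \<le> (\<Sum>h\<in>X. (real (d h))\<^sup>2) * real M"
    using sum_squared_le[OF fX, of "\<lambda>h. real (d h)"] sT by (simp add: M_def)
  also have "\<dots> \<le> (real T + 8 * (real N * real e)) * real M"
    using sq by (simp add: mult_right_mono)
  finally have main: "(real T)\<^sup>2 \<le> (real T + 8 * (real N * real e)) * real M" .
  have Mn: "real M \<le> real n - 2" using counter card_F n by (simp add: M_def X_def)
  have "(\<Sum>g\<in>P. n - e) \<le> (\<Sum>g\<in>P. 2 * card (shad n g))"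
    using E ends_le_shad P F by (intro sum_mono) (meson le_trans subsetD)
  then have "N * (n - e) \<le> 2 * T" by (simp add: N_def T_def sum_distrib_left)
  then have "real (N * (n - e)) \<le> real (2 * T)" by (simp only: of_nat_le_iff)
  moreover have "e \<le> n" using e by simp
  ultimately have T2: "real N * (real n - real e) \<le> 2 * real T" by (simp add: of_nat_diff)
  define x where "x = real N * (real n - real e) / 2"
  have xT: "x \<le> real T" using T2 by (simp add: x_def)
  have Ne: "real N = real e + 1" using P by (simp add: N_def)
  define m where "m = real n - real e"
  have "0 < (int e - 1) * (int n - int e)\<^sup>2 - 34 * int e * (int n - int e) + 4 * (int n - int e) - 32 * (int e)\<^sup>2 + 64 * int e"
    using cubic_pos[of "int e" "int n - int e"] e n by simp
  then have "0 < real_of_int ((int e - 1) * (int n - int e)\<^sup>2 - 34 * int e * (int n - int e) + 4 * (int n - int e) - 32 * (int e)\<^sup>2 + 64 * int e)"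
    by (simp only: of_int_0_less_iff)
  then have pos: "0 < (real e - 1) * m\<^sup>2 - 34 * real e * m + 4 * m - 32 * (real e)\<^sup>2 + 64 * real e"
    by (simp add: m_def)
  have m0: "0 < m" "0 < real e" "real n = m + real e" using e n by (auto simp: m_def)
  \<comment> \<open>Four times the difference of the two sides is the polynomial of
    \<open>cubic_pos\<close>; the factor \<open>N\<close> has been cancelled.\<close>
  have key: "8 * real e * (real n - 2) < m / 2 * (x - (real n - 2))"
  proof -
    have "m / 2 * (x - (real n - 2)) - 8 * real e * (real n - 2) =
      ((real e - 1) * m\<^sup>2 - 34 * real e * m + 4 * m - 32 * (real e)\<^sup>2 + 64 * real e) / 4"
      by (simp add: x_def Ne m0(3) power2_eq_square field_simps)
    then show ?thesis using pos by simp
  qed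
  have n2: "0 < real n - 2" using n by simp
  have "0 < 8 * real e * (real n - 2)" using m0(2) n2 by simp
  then have "0 < m / 2 * (x - (real n - 2))" using key by linarith
  then have xn: "0 < x - (real n - 2)" using m0(1) by (simp add: zero_less_mult_iff)
  have N0: "0 < real N" using Ne by simp
  have "real N * (8 * real e * (real n - 2)) < real N * (m / 2 * (x - (real n - 2)))"
    using key N0 by (rule mult_strict_left_mono)
  also have "\<dots> = x * (x - (real n - 2))" by (simp add: x_def m_def)
  also have "\<dots> \<le> real T * (real T - (real n - 2))"
    using xT xn n2 by (intro mult_mono) auto
  also have "\<dots> \<le> real T * (real T - real M)" using Mn by (intro mult_left_mono) auto
  also have "\<dots> \<le> 8 * (real N * real e) * real M" using main by (simp add: power2_eq_square algebra_simps)
  also have "\<dots> \<le> 8 * (real N * real e) * (real n - 2)" using Mn N0 m0(2) by (intro mult_left_mono) auto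
  finally show False by (simp add: algebra_simps)
qed

section \<open>Finding the two-block family\<close>

lemma two_mset_swap: "two_mset a i b j = two_mset b j a i"
  by (simp add: two_mset_def add.commute)

lemma (in counterexample) two_family:
  obtains K \<mu> a b e where "\<And>c d. K c d = K d c" "sep K \<mu>" "base \<mu> = \<mu>" "size \<mu> + e = n" "n < 2 * e"
    "\<And>g. g \<in> F \<Longrightarrow> card (ends n g) \<le> size \<mu>"
    "a < b" "count \<mu> a = 2" "count \<mu> b = 2" "\<And>i. i \<le> e \<Longrightarrow> blow K (\<mu> + two_mset a i b (e - i)) \<in> F"
proof -
  have "0 < card F" using counter by simp
  then obtain g0 where g0: "g0 \<in> F" and max: "\<And>g. g \<in> F \<Longrightarrow> card (ends n g) \<le> card (ends n g0)"
    by (rule ex_max_nat[where f = "\<lambda>g. card (ends n g)"]) blast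
  have ga: "g0 \<in> adjs n" using g0 F by blast
  obtain K \<mu>0 where K: "\<And>c d. K c d = K d c" and sz0: "size \<mu>0 = n" and gb: "g0 = blow K \<mu>0" and sep0: "sep K \<mu>0"
    using blow_exists[OF ga] by blast
  define \<mu> where "\<mu> = base \<mu>0"
  have cm: "count \<mu> x = min 2 (count \<mu>0 x)" for x by (simp add: \<mu>_def count_base)
  have bm: "base \<mu> = \<mu>" by (rule multiset_eqI) (simp add: count_base cm)
  have max': "card (ends n g) \<le> size \<mu>" if "g \<in> F" for g
    using max[OF that] card_ends_blow[OF K sep0] gb sz0 by (simp add: \<mu>_def)
  have sub: "\<mu> \<subseteq># \<mu>0" using base_sub by (simp add: \<mu>_def)
  define e where "e = n - size \<mu>"
  have se: "size \<mu> + e = n" using size_mset_mono[OF sub] sz0 by (simp add: e_def)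
  \<comment> \<open>Only blocks with at least two vertices may absorb further ones: a second vertex
    in a block would change \<open>base\<close>.\<close>
  define I where "I = {p. count \<mu> p = 2}"
  have fI: "finite I" by (rule finite_subset[of _ "set_mset \<mu>"]) (auto simp: I_def simp flip: count_greater_zero_iff)
  have c2: "min 2 (count (\<mu> + \<alpha>) x) = count \<mu> x" if "set_mset \<alpha> \<subseteq> I" for \<alpha> x
  proof (cases "x \<in># \<alpha>")
    case True
    then have "count \<mu> x = 2" using that by (auto simp: I_def)
    then show ?thesis by simp
  next
    case False
    then show ?thesis using cm[of x] by (simp add: not_in_iff)
  qed
  have sepa: "sep K (\<mu> + \<alpha>)" if "set_mset \<alpha> \<subseteq> I" for \<alpha>
    by (rule sep_cong[OF sep0]) (simp only: c2[OF that] cm)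
  have basea: "base (\<mu> + \<alpha>) = \<mu>" if "set_mset \<alpha> \<subseteq> I" for \<alpha>
    by (rule multiset_eqI) (simp only: count_base c2[OF that])
  have seta: "set_mset (\<mu> + \<alpha>) = set_mset \<mu>" if "set_mset \<alpha> \<subseteq> I" for \<alpha>
  proof -
    have "I \<subseteq> set_mset \<mu>" by (auto simp: I_def simp flip: count_greater_zero_iff)
    then show ?thesis using that by auto
  qed
  define Q where "Q k = {\<alpha>. size \<alpha> = k \<and> set_mset \<alpha> \<subseteq> I}" for k
  define \<phi> where "\<phi> \<alpha> = blow K (\<mu> + \<alpha>)" for \<alpha>
  have inj: "inj_on \<phi> (Q k)" for k
  proof (rule inj_onI)
    fix \<alpha> \<beta> assume h: "\<alpha> \<in> Q k" "\<beta> \<in> Q k" "\<phi> \<alpha> = \<phi> \<beta>"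
    then have "\<mu> + \<alpha> = \<mu> + \<beta>"
      using blow_inj[OF sepa sepa, of \<alpha> \<beta>] seta[of \<alpha>] seta[of \<beta>] by (simp add: Q_def \<phi>_def)
    then show "\<alpha> = \<beta>" by simp
  qed
  define A where "A = {\<alpha> \<in> Q e. \<phi> \<alpha> \<in> F}"
  have fA: "finite A" by (rule finite_subset[OF _ finite_msets_size[OF fI, of e]]) (auto simp: A_def Q_def)
  have injA: "inj_on \<phi> A" using inj by (rule inj_on_subset) (auto simp: A_def)
  have cA: "card (\<phi> ` A) = card A" by (rule card_image[OF injA])
  have subA: "\<phi> ` A \<subseteq> F" by (auto simp: A_def)
  have a0: "\<mu>0 - \<mu> \<in> A"
  proof -
    have "set_mset (\<mu>0 - \<mu>) \<subseteq> I"
    proof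
      fix x assume "x \<in># \<mu>0 - \<mu>"
      then have "count \<mu> x < count \<mu>0 x" by (simp add: in_diff_count)
      then show "x \<in> I" using cm[of x] by (simp add: I_def)
    qed
    moreover have "\<mu> + (\<mu>0 - \<mu>) = \<mu>0" using sub by simp
    moreover have "size (\<mu>0 - \<mu>) = e" using sub sz0 by (simp add: size_Diff_submset e_def)
    ultimately show ?thesis using g0 gb by (simp add: A_def Q_def \<phi>_def)
  qed
  define B where "B = {\<beta>. \<exists>p. add_mset p \<beta> \<in> A}"
  have subB: "B \<subseteq> Q (e - 1)" by (auto simp: B_def A_def Q_def)
  \<comment> \<open>By the maximality of \<open>size \<mu>\<close>, \<open>blow_parent\<close> finds
    all parents of these shadows among the images of \<open>A\<close> under \<open>\<phi>\<close>,
    so the shadows are private.\<close>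
  have "card (\<phi> ` B) < card (\<phi> ` A)"
  proof (rule private_shad[OF subA])
    show "\<phi> ` A \<noteq> {}" using a0 by blast
    show "\<phi> ` B \<subseteq> shadF n F"
    proof clarify
      fix \<beta> assume "\<beta> \<in> B"
      then obtain p where p: "add_mset p \<beta> \<in> A" by (auto simp: B_def)
      have "blow K (\<mu> + add_mset p \<beta> - {#p#}) \<in> shad n (blow K (\<mu> + add_mset p \<beta>))"
        using p se by (intro blow_shad) (auto simp: A_def Q_def)
      then show "\<phi> \<beta> \<in> shadF n F" using p by (auto simp: shadF_def A_def \<phi>_def)
    qed
    show "\<phi> ` B \<inter> shadF n (F - \<phi> ` A) = {}"
    proof (rule ccontr)
      assume "\<not> ?thesis"
      then obtain \<beta> g where b: "\<beta> \<in> B" and g: "g \<in> F" "g \<notin> \<phi> ` A" "\<phi> \<beta> \<in> shad n g"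
        by (auto simp: shadF_def)
      obtain v where v: "v < n" "del g v = \<phi> \<beta>" using g(3) by (auto simp: shad_def)
      obtain p' where p': "add_mset p' \<beta> \<in> A" using b by (auto simp: B_def)
      then have sb: "set_mset \<beta> \<subseteq> I" "Suc (size \<beta>) = e" by (auto simp: A_def Q_def)
      define m where "m = size (\<mu> + \<beta>)"
      have nm: "n = Suc m" using sb se by (simp add: m_def)
      have gA: "g \<in> adjs (Suc m)" using g F nm by blast
      have "card (ends (Suc m) g) \<le> size (base (\<mu> + \<beta>))" using max'[OF g(1)] nm basea[OF sb(1)] by simp
      then obtain p where p: "2 \<le> count (\<mu> + \<beta>) p" "g = blow K (add_mset p (\<mu> + \<beta>))"
        using blow_parent[OF K sepa[OF sb(1)] m_def[symmetric] gA, of v] v nm by (auto simp: \<phi>_def)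
      have "p \<in> I" using p(1) c2[OF sb(1), of p] by (simp add: I_def)
      then have "add_mset p \<beta> \<in> A" using sb p(2) g(1) by (simp add: A_def Q_def \<phi>_def)
      moreover have "g = \<phi> (add_mset p \<beta>)" using p(2) by (simp add: \<phi>_def)
      ultimately show False using g(2) by blast
    qed
  qed
  moreover have "card (\<phi> ` B) = card B" using inj_on_subset[OF inj subB] by (rule card_image)
  ultimately have BA: "card B < card A" using cA by simp
  have szA: "size \<alpha> = e" if "\<alpha> \<in> A" for \<alpha> using that by (simp add: A_def Q_def)
  note fam = mset_family[OF fA szA BA[unfolded B_def]]
  have e2: "2 \<le> e" using ends_bound[OF g0] se card_ends_blow[OF K sep0] gb sz0 by (simp add: \<mu>_def)
  have n2e: "n < 2 * e"
  proof (rule ccontr)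
    assume "\<not> ?thesis"
    then have le: "2 * e \<le> n" by simp
    have "Suc e \<le> card (\<phi> ` A)" using fam(1) cA by simp
    then obtain P where P: "P \<subseteq> \<phi> ` A" "card P = Suc e" by (metis obtain_subset_with_card_n)
    show False
    proof (rule many_large[OF _ P(2) _ e2 le])
      show "P \<subseteq> F" using P subA by blast
      fix g assume "g \<in> P"
      then obtain \<alpha> where a: "\<alpha> \<in> A" "g = \<phi> \<alpha>" using P by blast
      then have s: "set_mset \<alpha> \<subseteq> I" "size (\<mu> + \<alpha>) = n" using se by (auto simp: A_def Q_def)
      show "n - e \<le> card (ends n g)"
        using card_ends_blow[OF K sepa[OF s(1)]] s basea[OF s(1)] a se by (simp add: \<phi>_def)
    qed
  qed
  have "card A \<le> card F" using cA card_mono[OF finF subA] by simp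
  \<comment> \<open>From \<open>card F \<le> n - 1\<close> and \<open>n \<le> 2 * e - 1\<close>:
    this is where the cut at \<open>e = n / 2\<close> meets the bound of
    \<open>mset_family\<close>.\<close>
  then have "card A + 2 \<le> 2 * e" using card_F n2e by linarith
  then obtain a b where ab: "a \<noteq> b" "\<And>i. i \<le> e \<Longrightarrow> two_mset a i b (e - i) \<in> A" using fam(2) by blast
  have ba: "two_mset b i a (e - i) \<in> A" if "i \<le> e" for i
    using ab(2)[of "e - i"] that two_mset_swap[of b i a "e - i"] by simp
  have "a \<in> I" "b \<in> I" using ab(2)[of e] ba[of e] e2 by (auto simp: A_def Q_def two_mset_def)
  then have c: "count \<mu> a = 2" "count \<mu> b = 2" by (auto simp: I_def)
  have sepm: "sep K \<mu>" using sepa[of "{#}"] by simp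
  consider "a < b" | "b < a" using ab(1) by linarith
  then show ?thesis
  proof cases
    case 1
    then show ?thesis
      using that[of K \<mu> e a b] K sepm bm se n2e max' c ab(2) by (auto simp: A_def \<phi>_def)
  next
    case 2
    then show ?thesis
      using that[of K \<mu> e b a] K sepm bm se n2e max' c ba by (auto simp: A_def \<phi>_def)
  qed
qed

lemma count_le_base: "base \<mu> = \<mu> \<Longrightarrow> count \<mu> x \<le> 2"
  using count_base[of \<mu> x] by simp

text \<open>A mid vertex at or beside the deleted one would carry the label \<open>p\<close>
  together with both of its neighbours, but \<open>p\<close> occurs at most twice.\<close>

lemma ends_remove_less:
  assumes K: "\<And>c d. K c d = K d c" and s: "sep K \<mu>" and p: "p \<in># \<mu>" "count \<mu> p \<le> 2"
  shows "card (ends (size \<mu> - 1) (blow K (\<mu> - {#p#}))) < size (base \<mu>)"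
proof -
  obtain v where v: "v < size \<mu>" "word \<mu> ! v = p" using word_pos p(1) by blast
  have nm: False if m: "mid (size \<mu>) (blow K \<mu>) y" and y: "y = v \<or> y = Suc v \<or> Suc y = v" for y
  proof -
    have y0: "0 < y" "Suc y < size \<mu>" using m by (simp_all add: mid_def)
    have eq: "word \<mu> ! (y - 1) = word \<mu> ! y" "word \<mu> ! y = word \<mu> ! Suc y"
      using sepD[OF s, of "y - 1"] sepD[OF s, of y] m y0 by (simp_all add: mid_def)
    have "word \<mu> ! y = p" using y eq v(2) by auto
    then show False using three_count[OF y0, of p] eq p(2) by simp
  qed
  have "card (ends (size \<mu> - 1) (del (blow K \<mu>) v)) < card (ends (size \<mu>) (blow K \<mu>))"
    by (rule ends_del_less[OF blow_adjs[OF K] v(1)]) (use nm[of v] nm[of "Suc v"] nm[of "v - 1"] in auto)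
  then show ?thesis using del_blow[OF v(1), of K] v(2) card_ends_blow[OF K s] by simp
qed

section \<open>Merging two blocks\<close>

lemma region_hom:
  assumes g: "g \<in> adjs n" and t: "\<And>x. s \<le> x \<Longrightarrow> x < t \<Longrightarrow> twin g x"
  shows "s \<le> x \<Longrightarrow> x \<le> t \<Longrightarrow> z < s \<or> t < z \<Longrightarrow> g x z = g s z"
    and "s \<le> x \<Longrightarrow> x \<le> t \<Longrightarrow> s \<le> y \<Longrightarrow> y \<le> t \<Longrightarrow> x \<noteq> y \<Longrightarrow> g x y = g s (Suc s)"
proof -
  show "g x z = g s z" if "s \<le> x" "x \<le> t" "z < s \<or> t < z"
  proof (rule const_step[of s t "\<lambda>x. g x z"])
    fix y assume "s \<le> y" "y < t"
    then show "g (Suc y) z = g y z" using twinD[OF t[of y], of z] that by auto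
  qed (use that in auto)
  have lt: "g x y = g s (Suc s)" if xy: "s \<le> x" "x < y" "y \<le> t" for x y
  proof -
    have "g x y = g x (Suc x)"
    proof (rule const_step[of "Suc x" t "g x"])
      fix z assume "Suc x \<le> z" "z < t"
      then show "g x (Suc z) = g x z" using twinD'[OF g t[of z], of x] xy by simp
    qed (use xy in auto)
    also have "\<dots> = g s (Suc s)"
    proof (rule const_step[of s x "\<lambda>x. g x (Suc x)"])
      fix z assume z: "s \<le> z" "z < x"
      have "g z (Suc (Suc z)) = g (Suc z) (Suc (Suc z))" using twinD[OF t[of z], of "Suc (Suc z)"] z xy by simp
      moreover have "g z (Suc z) = g z (Suc (Suc z))" using twinD'[OF g t[of "Suc z"], of z] z xy by simp
      ultimately show "g (Suc z) (Suc (Suc z)) = g z (Suc z)" by simp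
    qed (use xy in auto)
    finally show ?thesis .
  qed
  show "g x y = g s (Suc s)" if "s \<le> x" "x \<le> t" "s \<le> y" "y \<le> t" "x \<noteq> y"
    using lt[of x y] lt[of y x] that adjs_sym[OF g, of x y] by (cases x y rule: linorder_cases) auto
qed

lemma count_two_mset: "a \<noteq> b \<Longrightarrow> count (two_mset a i b j) x = (if x = a then i else if x = b then j else 0)"
  by (simp add: two_mset_def)

lemma word_split:
  assumes "a < b" "a \<notin># \<nu>" "b \<notin># \<nu>"
  shows "word (\<nu> + two_mset a i b j) = word (filter_mset (\<lambda>x. x < a) \<nu>) @ replicate i a @
    word (filter_mset (\<lambda>x. a < x \<and> x < b) \<nu>) @ replicate j b @ word (filter_mset (\<lambda>x. b < x) \<nu>)"
    (is "_ = ?w")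
proof -
  have "sorted ?w" using assms(1) by (auto simp: sorted_append)
  moreover have "mset ?w = \<nu> + two_mset a i b j"
  proof (rule multiset_eqI)
    fix x
    have "count \<nu> a = 0" "count \<nu> b = 0" using assms by (simp_all add: not_in_iff)
    then show "count (mset ?w) x = count (\<nu> + two_mset a i b j) x"
      using assms(1) by (cases "x = a"; cases "x = b") (auto simp: two_mset_def not_less)
  qed
  ultimately show ?thesis using word_unique by metis
qed

text \<open>The two conclusions say that in the common graph everything from the first \<open>a\<close> to the last \<open>b\<close>
  belongs to a single block.\<close>

lemma merge:
  assumes K: "\<And>c d. K c d = K d c" and ab: "a < b" "a \<notin># \<nu>" "b \<notin># \<nu>"
    and i: "2 \<le> i" "i < i'" "i + j = i' + j'" "2 \<le> j'"
    and eq: "blow K (\<nu> + two_mset a i b j) = blow K (\<nu> + two_mset a i' b j')"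
  shows "\<And>c l. c \<in># \<nu> + two_mset a 2 b 2 \<Longrightarrow> a \<le> c \<Longrightarrow> c \<le> b \<Longrightarrow> l \<in># \<nu> \<Longrightarrow> l < a \<or> b < l \<Longrightarrow> K c l = K a l"
    and "\<And>c d. {#c, d#} \<subseteq># \<nu> + two_mset a 2 b 2 \<Longrightarrow> a \<le> c \<Longrightarrow> c \<le> b \<Longrightarrow> a \<le> d \<Longrightarrow> d \<le> b \<Longrightarrow> K c d = K a a"
proof -
  define X where "X = word (filter_mset (\<lambda>x. x < a) \<nu>)"
  define Y where "Y = word (filter_mset (\<lambda>x. a < x \<and> x < b) \<nu>)"
  define Z where "Z = word (filter_mset (\<lambda>x. b < x) \<nu>)"
  define L where "L = length X"
  define m where "m = length Y"
  define s where "s = a # Y @ [b]"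
  define w where "w i j = word (\<nu> + two_mset a i b j)" for i j
  have w: "w i j = X @ replicate i a @ Y @ replicate j b @ Z" for i j
    using word_split[OF ab] by (simp add: w_def X_def Y_def Z_def)
  have sz: "size (\<nu> + two_mset a i b j) = L + i + m + j + length Z" for i j
    using arg_cong[OF w[of i j], of length] by (simp add: w_def L_def m_def)
  have wa: "w i j ! x = a" if "L \<le> x" "x < L + i" for i j x
  proof -
    have "\<not> x < length X" "x - length X < i" using that by (auto simp: L_def)
    then show ?thesis by (simp add: w nth_append)
  qed
  have wb: "w i j ! x = b" if "L + i + m \<le> x" "x < L + i + m + j" for i j x
  proof -
    have "\<not> x < length X" "\<not> x - length X < i" "\<not> x - length X - i < length Y" "x - length X - i - length Y < j"
      using that by (auto simp: L_def m_def)
    then show ?thesis by (simp add: w nth_append)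
  qed
  have ws: "w i j ! (L + i - 1 + k) = s ! k" if "k \<le> Suc m" "1 \<le> i" "1 \<le> j" for i j k
  proof -
    consider "k = 0" | "0 < k" "k \<le> m" | "k = Suc m" using \<open>k \<le> Suc m\<close> by linarith
    then show ?thesis
    proof cases
      case 1 then show ?thesis using wa[of "L + i - 1" i j] that by (simp add: s_def)
    next
      case 2 then show ?thesis using that by (cases k) (simp_all add: w nth_append L_def m_def s_def)
    next
      case 3 then show ?thesis using wb[of i "L + i + m" j] that by (simp add: s_def m_def nth_append)
    qed
  qed
  \<comment> \<open>Being twins, on the level of labels. For distinct labels only one copy of each
    is removed, so any multiplicities of at least 2 may be replaced by 2, as in
    \<open>sep_cong\<close>.\<close>
  define T where "T c d \<longleftrightarrow> c = d \<or> (\<forall>l\<in>#\<nu> + two_mset a 2 b 2 - {#c, d#}. K c l = K d l)" for c d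
  have tw: "twin (blow K (\<nu> + two_mset a i b j)) x \<longleftrightarrow> T (w i j ! x) (w i j ! Suc x)"
    if "2 \<le> i" "2 \<le> j" "Suc x < L + i + m + j + length Z" for i j x
  proof -
    have "Suc x < size (\<nu> + two_mset a i b j)" unfolding sz using that by simp
    note tb = twin_blow[OF this, of K, folded w_def]
    show ?thesis
    proof (cases "w i j ! x = w i j ! Suc x")
      case True
      then show ?thesis unfolding tb T_def by simp
    next
      case False
      have "l \<in># \<nu> + two_mset a i b j - {#w i j ! x, w i j ! Suc x#} \<longleftrightarrow>
          l \<in># \<nu> + two_mset a 2 b 2 - {#w i j ! x, w i j ! Suc x#}" for l
        using False that(1,2) ab(1) by (auto simp: in_diff_count count_two_mset)
      then show ?thesis unfolding tb T_def using False by blast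
    qed
  qed
  \<comment> \<open>Position \<open>L + i - 1 + k\<close> reads the pair \<open>k\<close> of
    \<open>s\<close> in the first word. In the second word \<open>s\<close> begins
    \<open>i' - i\<close> positions later, so there it reads two copies of \<open>a\<close> or an
    earlier pair of \<open>s\<close>, known to be twins by induction. The graphs are equal, so the
    pair \<open>k\<close> consists of twins too.\<close>
  have bd: "T (s ! k) (s ! Suc k)" if "k \<le> m" for k
    using that
  proof (induction k rule: less_induct)
    case (less k)
    define x where "x = L + i - 1 + k"
    have Sx: "Suc x = L + i - 1 + Suc k" using i by (simp add: x_def)
    have xb: "Suc x < L + i + m + j + length Z" using less.prems i by (simp add: x_def)
    have j2: "2 \<le> j" using i by simp
    have "T (w i' j' ! x) (w i' j' ! Suc x)"
    proof (cases "k < i' - i")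
      case True
      then have "w i' j' ! x = a" "w i' j' ! Suc x = a" using i by (auto intro!: wa simp: x_def)
      then show ?thesis by (simp add: T_def)
    next
      case False
      define k' where "k' = k - (i' - i)"
      have k': "k' < k" "k' \<le> m" "x = L + i' - 1 + k'" "Suc x = L + i' - 1 + Suc k'"
        using False i less.prems by (auto simp: k'_def x_def)
      have "w i' j' ! x = s ! k'" unfolding k'(3) by (rule ws) (use k' i in auto)
      moreover have "w i' j' ! Suc x = s ! Suc k'" unfolding k'(4) by (rule ws) (use k' i in auto)
      ultimately show ?thesis using less.IH[OF k'(1,2)] by simp
    qed
    then have "twin (blow K (\<nu> + two_mset a i' b j')) x" using tw[of i' j' x] i xb by simp
    then have "T (w i j ! x) (w i j ! Suc x)" using tw[OF i(1) j2 xb] eq by simp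
    moreover have "w i j ! x = s ! k" unfolding x_def by (rule ws) (use less.prems i j2 in auto)
    moreover have "w i j ! Suc x = s ! Suc k" unfolding Sx by (rule ws) (use less.prems i j2 in auto)
    ultimately show ?case by simp
  qed
  let ?\<mu> = "\<nu> + two_mset a 2 b 2"
  let ?g = "blow K ?\<mu>"
  have gA: "?g \<in> adjs (size ?\<mu>)" by (rule blow_adjs[OF K])
  have tws: "twin ?g x" if x: "L \<le> x" "x < L + m + 3" for x
  proof -
    consider "x = L" | k where "x = L + 2 - 1 + k" "Suc x = L + 2 - 1 + Suc k" "k \<le> m" | "x = L + m + 2"
    proof -
      assume a1: "x = L \<Longrightarrow> thesis" and a2: "\<And>k. x = L + 2 - 1 + k \<Longrightarrow> Suc x = L + 2 - 1 + Suc k \<Longrightarrow> k \<le> m \<Longrightarrow> thesis"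
        and a3: "x = L + m + 2 \<Longrightarrow> thesis"
      show thesis using a1 a2[of "x - L - 1"] a3 x by linarith
    qed
    then have "T (w 2 2 ! x) (w 2 2 ! Suc x)"
    proof cases
      case 1
      then show ?thesis using wa[of x 2 2] wa[of "Suc x" 2 2] by (simp add: T_def)
    next
      case (2 k)
      have "w 2 2 ! x = s ! k" unfolding 2(1) by (rule ws) (use 2 in auto)
      moreover have "w 2 2 ! Suc x = s ! Suc k" unfolding 2(2) by (rule ws) (use 2 in auto)
      ultimately show ?thesis using bd[OF 2(3)] by simp
    next
      case 3
      then show ?thesis using wb[of 2 x 2] wb[of 2 "Suc x" 2] by (simp add: T_def)
    qed
    then show ?thesis using tw[of 2 2 x] x by simp
  qed
  note hom = region_hom[OF gA, of L "L + m + 3", OF tws]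
  have in_region: "L \<le> x \<and> x \<le> L + m + 3" if x: "x < size ?\<mu>" "a \<le> w 2 2 ! x" "w 2 2 ! x \<le> b" for x
  proof (rule ccontr)
    assume n: "\<not> ?thesis"
    show False
    proof (cases "x < L")
      case True
      then have "w 2 2 ! x \<in> set X" by (simp add: w nth_append L_def)
      then show False using x by (simp add: X_def)
    next
      case False
      then have xm: "L + m + 4 \<le> x" using n by linarith
      define k where "k = x - (L + m + 4)"
      have xk: "x = length X + length Y + 4 + k" using xm by (simp add: k_def L_def m_def)
      have "k < length Z" using x(1)[unfolded sz] xk by (simp add: L_def m_def)
      moreover have "w 2 2 ! x = Z ! k" unfolding xk by (simp add: w nth_append)
      ultimately have "w 2 2 ! x \<in> set Z" by simp
      then show False using x by (simp add: Z_def)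
    qed
  qed
  have gK: "?g x y = K (w 2 2 ! x) (w 2 2 ! y)" if "x < size ?\<mu>" "y < size ?\<mu>" "x \<noteq> y" for x y
    using that by (simp add: blow_def pull_def w_def)
  have L2: "L < size ?\<mu>" "Suc L < size ?\<mu>" using sz[of 2 2] by simp_all
  have wL: "w 2 2 ! L = a" "w 2 2 ! Suc L = a" using wa[of _ 2 2] by simp_all
  show "K c l = K a l" if c: "c \<in># ?\<mu>" "a \<le> c" "c \<le> b" "l \<in># \<nu>" "l < a \<or> b < l" for c l
  proof -
    obtain x where x: "x < size ?\<mu>" "w 2 2 ! x = c" using word_pos[OF c(1)] by (auto simp: w_def)
    have "l \<in># ?\<mu>" using c by simp
    then obtain z where z: "z < size ?\<mu>" "w 2 2 ! z = l" using word_pos[of l ?\<mu>] by (auto simp: w_def)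
    have rx: "L \<le> x \<and> x \<le> L + m + 3" using in_region[OF x(1)] x c by simp
    have rz: "z < L \<or> L + m + 3 < z"
    proof (rule ccontr)
      assume "\<not> ?thesis"
      then have zr: "L \<le> z" "z \<le> L + m + 3" by auto
      have "a \<le> w 2 2 ! z" using word_mono[of L z ?\<mu>] zr z wL by (simp add: w_def)
      moreover have "w 2 2 ! z \<le> b" using word_mono[of z "L + m + 3" ?\<mu>] zr sz[of 2 2] wb[of 2 "L + m + 3" 2] by (simp add: w_def)
      ultimately show False using z c by simp
    qed
    have "?g x z = ?g L z" using hom(1)[of x z] rx rz by blast
    moreover have "z \<noteq> x" "z \<noteq> L" using rx rz by auto
    ultimately show ?thesis using gK[of x z] gK[of L z] x z L2 wL by simp
  qed
  show "K c d = K a a" if cd: "{#c, d#} \<subseteq># ?\<mu>" "a \<le> c" "c \<le> b" "a \<le> d" "d \<le> b" for c d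
  proof -
    have "\<exists>x y. x < size ?\<mu> \<and> y < size ?\<mu> \<and> x \<noteq> y \<and> w 2 2 ! x = c \<and> w 2 2 ! y = d"
    proof (cases "c = d")
      case True
      have "2 \<le> count ?\<mu> c" using mset_subset_eq_count[OF cd(1), of c] True by simp
      then have "\<not> card {i. i < size ?\<mu> \<and> word ?\<mu> ! i = c} \<le> Suc 0" by (simp only: count_word)
      moreover have "finite {i. i < size ?\<mu> \<and> word ?\<mu> ! i = c}" by (rule finite_subset[of _ "{..<size ?\<mu>}"]) auto
      ultimately obtain x y where "x \<in> {i. i < size ?\<mu> \<and> word ?\<mu> ! i = c}"
          "y \<in> {i. i < size ?\<mu> \<and> word ?\<mu> ! i = c}" "x \<noteq> y"
        using card_le_Suc0_iff_eq by blast
      then show ?thesis using True by (auto simp: w_def)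
    next
      case False
      have "c \<in># ?\<mu>" "d \<in># ?\<mu>" using mset_subset_eqD[OF cd(1)] by simp_all
      then show ?thesis using word_pos[of c ?\<mu>] word_pos[of d ?\<mu>] False by (auto simp: w_def)
    qed
    then obtain x y where xy: "x < size ?\<mu>" "y < size ?\<mu>" "x \<noteq> y" "w 2 2 ! x = c" "w 2 2 ! y = d" by blast
    have "?g x y = ?g L (Suc L)"
      using hom(2)[of x y] in_region[OF xy(1)] in_region[OF xy(2)] xy cd by blast
    then show ?thesis using gK[of x y] gK[of L "Suc L"] xy L2 wL by simp
  qed
qed

section \<open>The two-block family\<close>

locale two_block_family = counterexample +
  fixes K :: "nat \<Rightarrow> nat \<Rightarrow> bool" and \<mu> :: "nat multiset" and a b e :: nat
  assumes K: "\<And>c d. K c d = K d c" and sep: "sep K \<mu>" and bm: "base \<mu> = \<mu>" and sz: "size \<mu> + e = n" and ne: "n < 2 * e"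
    and top: "\<And>g. g \<in> F \<Longrightarrow> card (ends n g) \<le> size \<mu>"
    and ab: "a < b" and ca: "count \<mu> a = 2" and cb: "count \<mu> b = 2"
    and fam: "\<And>i. i \<le> e \<Longrightarrow> blow K (\<mu> + two_mset a i b (e - i)) \<in> F"
begin

text \<open>\<open>fam_set\<close> is the known part of \<open>F\<close> and \<open>fam_in\<close> is the part of its shadow with the same number of block ends;
  by \<open>private_shad\<close> the rest \<open>extra\<close> of the shadow is at most as large as the rest of \<open>F\<close>.\<close>

definition \<nu> where "\<nu> = \<mu> - two_mset a 2 b 2"
definition q where "q = size \<nu>"
definition ext where "ext i j = blow K (\<nu> + two_mset a i b j)"
definition fam_in where "fam_in = (\<lambda>i. ext (Suc (Suc i)) (e + 1 - i)) ` {..<e}"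
definition fam_set where "fam_set = (\<lambda>i. ext (Suc (Suc i)) (e + 2 - i)) ` {..e}"
definition extra where "extra = shadF n F - fam_in"

lemma mu_split: "\<mu> = \<nu> + two_mset a 2 b 2"
  using ab ca cb unfolding \<nu>_def by (intro multiset_eqI) (simp add: count_two_mset)

lemma count_mu: "count \<mu> x = count \<nu> x + (if x = a \<or> x = b then 2 else 0)"
  using arg_cong[OF mu_split, of "\<lambda>m. count m x"] ab by (simp add: count_two_mset)

lemma nu_ab: "a \<notin># \<nu>" "b \<notin># \<nu>"
  using ab ca cb by (simp_all add: \<nu>_def count_two_mset not_in_iff)

lemma count_nu: "count \<nu> x \<le> 2"
  using count_le_base[OF bm, of x] by (simp add: \<nu>_def)

lemma size_two_mset [simp]: "size (two_mset c i d j) = i + j"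
  by (simp add: two_mset_def)

lemma size_mu: "size \<mu> = q + 4"
  using mu_split by (metis q_def size_two_mset size_union numeral_Bit0)

lemma n_eq: "n = q + e + 4"
  using sz size_mu by simp

lemma base_ext: "base (\<nu> + two_mset a (Suc (Suc i)) b (Suc (Suc j))) = \<mu>"
  using ab ca cb nu_ab count_le_base[OF bm] unfolding \<nu>_def
  by (intro multiset_eqI) (auto simp: count_base count_two_mset)

lemma sep_ext: "sep K (\<nu> + two_mset a (Suc (Suc i)) b (Suc (Suc j)))"
  using sep
proof (rule sep_cong)
  fix x
  show "min 2 (count \<mu> x) = min 2 (count (\<nu> + two_mset a (Suc (Suc i)) b (Suc (Suc j))) x)"
    using count_base[of \<mu> x] count_base[of "\<nu> + two_mset a (Suc (Suc i)) b (Suc (Suc j))" x] base_ext[of i j] bm by simp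
qed

lemma size_ext: "size (\<nu> + two_mset a i b j) = q + i + j"
  by (simp add: q_def)

lemma ends_ext: "card (ends (q + i + j + 4) (ext (Suc (Suc i)) (Suc (Suc j)))) = q + 4"
proof -
  have "size (\<nu> + two_mset a (Suc (Suc i)) b (Suc (Suc j))) = q + i + j + 4" unfolding size_ext by simp
  then show ?thesis using card_ends_blow[OF K sep_ext[of i j]] size_mu unfolding ext_def base_ext by metis
qed

lemma ext_inj:
  assumes "ext (Suc (Suc i)) (Suc (Suc j)) = ext (Suc (Suc i')) (Suc (Suc j'))" "i + j = i' + j'"
  shows "i = i'"
proof -
  have st: "set_mset (\<nu> + two_mset a (Suc (Suc i)) b (Suc (Suc j))) = set_mset \<nu> \<union> {a, b}" for i j
    by (auto simp: two_mset_mem)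
  have "\<nu> + two_mset a (Suc (Suc i)) b (Suc (Suc j)) = \<nu> + two_mset a (Suc (Suc i')) b (Suc (Suc j'))"
    by (rule blow_inj[OF sep_ext sep_ext]) (use assms st size_ext in \<open>simp_all add: ext_def\<close>)
  then have "count (two_mset a (Suc (Suc i)) b (Suc (Suc j))) a = count (two_mset a (Suc (Suc i')) b (Suc (Suc j'))) a" by simp
  then show ?thesis using ab by (simp add: count_two_mset)
qed

lemma card_fam_in: "card fam_in = e"
proof -
  have "inj_on (\<lambda>i. ext (Suc (Suc i)) (e + 1 - i)) {..<e}"
  proof (rule inj_onI)
    fix i i' assume h: "i \<in> {..<e}" "i' \<in> {..<e}" "ext (Suc (Suc i)) (e + 1 - i) = ext (Suc (Suc i')) (e + 1 - i')"
    have "e + 1 - i = Suc (Suc (e - 1 - i))" "e + 1 - i' = Suc (Suc (e - 1 - i'))" using h by auto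
    then show "i = i'" using ext_inj[of i "e - 1 - i" i' "e - 1 - i'"] h by auto
  qed
  then show ?thesis by (simp add: fam_in_def card_image)
qed

lemma card_fam_set: "card fam_set = Suc e"
proof -
  have "inj_on (\<lambda>i. ext (Suc (Suc i)) (e + 2 - i)) {..e}"
  proof (rule inj_onI)
    fix i i' assume h: "i \<in> {..e}" "i' \<in> {..e}" "ext (Suc (Suc i)) (e + 2 - i) = ext (Suc (Suc i')) (e + 2 - i')"
    have "e + 2 - i = Suc (Suc (e - i))" "e + 2 - i' = Suc (Suc (e - i'))" using h by auto
    then show "i = i'" using ext_inj[of i "e - i" i' "e - i'"] h by auto
  qed
  then show ?thesis by (simp add: fam_set_def card_image)
qed

lemma ext_fam: "2 \<le> i \<Longrightarrow> 2 \<le> j \<Longrightarrow> i + j = e + 4 \<Longrightarrow> ext i j \<in> F"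
proof -
  assume h: "2 \<le> i" "2 \<le> j" "i + j = e + 4"
  obtain i' j' where ij: "i = 2 + i'" "j = 2 + j'" using le_Suc_ex[OF h(1)] le_Suc_ex[OF h(2)] by blast
  then have e: "e = i' + j'" using h(3) by simp
  have "\<mu> + two_mset a i' b (e - i') = \<nu> + two_mset a i b j"
    unfolding ij e using ab nu_ab by (intro multiset_eqI) (simp add: count_two_mset count_mu not_in_iff)
  then show ?thesis using fam[of i'] e by (simp add: ext_def)
qed

lemma fam_set_eq: "g \<in> fam_set \<longleftrightarrow> (\<exists>i j. 2 \<le> i \<and> 2 \<le> j \<and> i + j = e + 4 \<and> g = ext i j)"
proof
  assume "g \<in> fam_set"
  then obtain i where "i \<le> e" "g = ext (Suc (Suc i)) (e + 2 - i)" by (auto simp: fam_set_def)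
  then show "\<exists>i j. 2 \<le> i \<and> 2 \<le> j \<and> i + j = e + 4 \<and> g = ext i j"
    by (intro exI[of _ "Suc (Suc i)"] exI[of _ "e + 2 - i"]) auto
next
  assume "\<exists>i j. 2 \<le> i \<and> 2 \<le> j \<and> i + j = e + 4 \<and> g = ext i j"
  then obtain i j where h: "2 \<le> i" "2 \<le> j" "i + j = e + 4" "g = ext i j" by blast
  have "i = Suc (Suc (i - 2))" "j = e + 2 - (i - 2)" using h by auto
  then show "g \<in> fam_set" unfolding fam_set_def using h by (intro image_eqI[of _ _ "i - 2"]) auto
qed

lemma fam_in_eq: "g \<in> fam_in \<longleftrightarrow> (\<exists>i j. 2 \<le> i \<and> 2 \<le> j \<and> i + j = e + 3 \<and> g = ext i j)"
proof
  assume "g \<in> fam_in"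
  then obtain i where "i < e" "g = ext (Suc (Suc i)) (e + 1 - i)" by (auto simp: fam_in_def)
  then show "\<exists>i j. 2 \<le> i \<and> 2 \<le> j \<and> i + j = e + 3 \<and> g = ext i j"
    by (intro exI[of _ "Suc (Suc i)"] exI[of _ "e + 1 - i"]) auto
next
  assume "\<exists>i j. 2 \<le> i \<and> 2 \<le> j \<and> i + j = e + 3 \<and> g = ext i j"
  then obtain i j where h: "2 \<le> i" "2 \<le> j" "i + j = e + 3" "g = ext i j" by blast
  have "i = Suc (Suc (i - 2))" "j = e + 1 - (i - 2)" using h by auto
  then show "g \<in> fam_in" unfolding fam_in_def using h by (intro image_eqI[of _ _ "i - 2"]) auto
qed

lemma fam_set_sub: "fam_set \<subseteq> F"
proof
  fix g assume "g \<in> fam_set"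
  then obtain i j where "2 \<le> i" "2 \<le> j" "i + j = e + 4" "g = ext i j" using fam_set_eq[of g] by blast
  then show "g \<in> F" using ext_fam[of i j] by simp
qed

lemma ends_fam_in: "h \<in> fam_in \<Longrightarrow> card (ends (n - 1) h) = q + 4"
proof -
  assume "h \<in> fam_in"
  then obtain i j where h: "2 \<le> i" "2 \<le> j" "i + j = e + 3" "h = ext i j" by (auto simp: fam_in_eq)
  obtain i' j' where ij: "i = Suc (Suc i')" "j = Suc (Suc j')"
    using le_Suc_ex[OF h(1)] le_Suc_ex[OF h(2)] by (metis add_2_eq_Suc)
  then have "q + i' + j' + 4 = n - 1" using h n_eq by simp
  then show ?thesis using ends_ext[of i' j'] h ij by simp
qed

lemma ext_shad: "p \<in># \<nu> + two_mset a i b j \<Longrightarrow> i + j = e + 4 \<Longrightarrow> ext i j \<in> F \<Longrightarrow>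
    blow K (\<nu> + two_mset a i b j - {#p#}) \<in> shadF n F"
  using blow_shad[of p "\<nu> + two_mset a i b j" n K] size_ext[of i j] n_eq by (auto simp: shadF_def ext_def)

lemma fam_in_sub: "fam_in \<subseteq> shadF n F"
proof
  fix h assume "h \<in> fam_in"
  then obtain i j where h: "2 \<le> i" "2 \<le> j" "i + j = e + 3" "h = ext i j" by (auto simp: fam_in_eq)
  have "\<nu> + two_mset a (Suc i) b j - {#a#} = \<nu> + two_mset a i b j" by (simp add: two_mset_def)
  then show "h \<in> shadF n F" using ext_shad[of a "Suc i" j] ext_fam[of "Suc i" j] h by (simp add: two_mset_mem ext_def)
qed

text \<open>\<open>fam_in\<close> has one element fewer than \<open>fam_set\<close>, and the shadow
  of \<open>F\<close> has at least one fewer than \<open>F\<close>. The bound \<open>q + 2\<close>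
  is \<open>n - 1 = q + e + 3\<close> minus \<open>e + 1\<close>.\<close>

lemma card_extra: "card extra \<le> card (F - fam_set)" "card (F - fam_set) \<le> q + 2"
proof -
  have "card (F - fam_set) = card F - Suc e" using card_Diff_subset[OF finite_subset[OF fam_set_sub finF] fam_set_sub] card_fam_set by simp
  moreover have "card extra = card (shadF n F) - e"
    unfolding extra_def using card_Diff_subset[OF finite_subset[OF fam_in_sub finS] fam_in_sub] card_fam_in by simp
  ultimately show "card extra \<le> card (F - fam_set)" "card (F - fam_set) \<le> q + 2"
    using counter card_F n_eq by linarith+
qed

lemma finite_extra: "finite extra"
  using finS by (simp add: extra_def)

text \<open>The deleted vertex lies in a block of at most two vertices, so block ends are lost,
  whereas every member of \<open>fam_in\<close> has \<open>q + 4\<close> of them.\<close>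

lemma extraI:
  assumes "2 \<le> i" "2 \<le> j" "i + j = e + 4" "p \<in># \<nu> + two_mset a i b j" "count (\<nu> + two_mset a i b j) p \<le> 2"
  shows "blow K (\<nu> + two_mset a i b j - {#p#}) \<in> extra"
proof -
  obtain i' j' where ij: "i = Suc (Suc i')" "j = Suc (Suc j')"
    using le_Suc_ex[OF assms(1)] le_Suc_ex[OF assms(2)] by (metis add_2_eq_Suc)
  have "size (\<nu> + two_mset a i b j) = n" unfolding size_ext n_eq using assms(3) by simp
  then have "card (ends (n - 1) (blow K (\<nu> + two_mset a i b j - {#p#}))) < q + 4"
    using ends_remove_less[OF K sep_ext[of i' j', folded ij] assms(4,5)] base_ext[of i' j', folded ij] size_mu by metis
  then have "blow K (\<nu> + two_mset a i b j - {#p#}) \<notin> fam_in" using ends_fam_in by (metis less_irrefl)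
  then show ?thesis using ext_shad[OF assms(4,3) ext_fam[OF assms(1-3)]] by (simp add: extra_def)
qed

text \<open>The shadows obtained by deleting a vertex labelled \<open>c\<close> from the members of the family lie in \<open>extra\<close>, which is
  too small for them to be distinct; so \<open>merge\<close> applies.\<close>

lemma merge_nu:
  assumes c: "c \<in># \<nu>"
  shows "\<And>d l. d \<in># \<nu> - {#c#} + two_mset a 2 b 2 \<Longrightarrow> a \<le> d \<Longrightarrow> d \<le> b \<Longrightarrow> l \<in># \<nu> - {#c#} \<Longrightarrow> l < a \<or> b < l \<Longrightarrow> K d l = K a l"
    and "\<And>d d'. {#d, d'#} \<subseteq># \<nu> - {#c#} + two_mset a 2 b 2 \<Longrightarrow> a \<le> d \<Longrightarrow> d \<le> b \<Longrightarrow> a \<le> d' \<Longrightarrow> d' \<le> b \<Longrightarrow> K d d' = K a a"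
proof -
  define f where "f i = blow K (\<nu> - {#c#} + two_mset a (i + 2) b (e + 2 - i))" for i
  have fe: "f i = blow K (\<nu> + two_mset a (i + 2) b (e + 2 - i) - {#c#})" for i using c by (simp add: f_def)
  have "f ` {..e} \<subseteq> extra"
  proof clarify
    fix i assume "i \<le> e"
    moreover have "a \<noteq> c" "b \<noteq> c" using c nu_ab by auto
    ultimately show "f i \<in> extra"
      unfolding fe using c count_nu[of c] ab by (intro extraI) (simp_all add: count_two_mset)
  qed
  then have "card (f ` {..e}) \<le> card extra" by (rule card_mono[OF finite_extra])
  then have "card (f ` {..e}) \<le> q + 2" using card_extra by simp
  \<comment> \<open>The \<open>e + 1\<close> values do not fit: \<open>q + 4 < e\<close> follows
    from \<open>n = q + e + 4\<close> and \<open>n < 2 * e\<close>.\<close>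
  then have "\<not> inj_on f {..e}" using card_image[of f "{..e}"] n_eq ne by auto
  then obtain i i' where i: "i \<le> e" "i' \<le> e" "i < i'" "f i = f i'"
    unfolding inj_on_def by (metis atMost_iff linorder_neqE_nat)
  have nc: "a \<notin># \<nu> - {#c#}" "b \<notin># \<nu> - {#c#}" using nu_ab by (auto dest: in_diffD)
  have h: "2 \<le> i + 2" "i + 2 < i' + 2" "i + 2 + (e + 2 - i) = i' + 2 + (e + 2 - i')" "2 \<le> e + 2 - i'" using i by auto
  note m = merge[OF K ab nc h i(4)[unfolded f_def]]
  show "\<And>d l. d \<in># \<nu> - {#c#} + two_mset a 2 b 2 \<Longrightarrow> a \<le> d \<Longrightarrow> d \<le> b \<Longrightarrow> l \<in># \<nu> - {#c#} \<Longrightarrow> l < a \<or> b < l \<Longrightarrow> K d l = K a l"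
    using m(1) by blast
  show "\<And>d d'. {#d, d'#} \<subseteq># \<nu> - {#c#} + two_mset a 2 b 2 \<Longrightarrow> a \<le> d \<Longrightarrow> d \<le> b \<Longrightarrow> a \<le> d' \<Longrightarrow> d' \<le> b \<Longrightarrow> K d d' = K a a"
    using m(2) by blast
qed

text \<open>By \<open>sep\<close> some label \<open>l\<close> distinguishes \<open>a\<close> from
  the next label \<open>d\<close>. If \<open>l\<close> is outside \<open>[a, b]\<close>, it violates
  the first conclusion of \<open>merge\<close>, otherwise one of \<open>K a l\<close> and
  \<open>K d l\<close> violates the second.\<close>

lemma not_merged:
  obtains c l where "c \<in># \<mu>" "a \<le> c" "c \<le> b" "l \<in># \<nu>" "l < a \<or> b < l" "K c l \<noteq> K a l"
    | c d where "{#c, d#} \<subseteq># \<mu>" "a \<le> c" "c \<le> b" "a \<le> d" "d \<le> b" "K c d \<noteq> K a a"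
proof -
  have mem: "a \<in># \<mu>" "b \<in># \<mu>" using ca cb by (simp_all add: count_greater_zero_iff[symmetric] del: count_greater_zero_iff)
  have ex: "\<exists>d. d \<in># \<mu> \<and> a < d" using mem ab by blast
  define d where "d = (LEAST d. d \<in># \<mu> \<and> a < d)"
  have d: "d \<in># \<mu>" "a < d" using LeastI_ex[OF ex] by (simp_all add: d_def)
  have dl: "d \<le> x" if "x \<in># \<mu>" "a < x" for x using Least_le[of "\<lambda>d. d \<in># \<mu> \<and> a < d" x] that by (simp add: d_def)
  then have "\<forall>x\<in>#\<mu>. \<not> (a < x \<and> x < d)" by (meson not_le)
  then obtain l where l: "l \<in># \<mu> - {#a, d#}" "K a l \<noteq> K d l" using sep mem(1) d unfolding sep_def by blast
  have db: "a \<le> d" "d \<le> b" using d dl[OF mem(2)] ab by auto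
  have lm: "l \<in># \<mu>" using l(1) by (rule in_diffD)
  show ?thesis
  proof (cases "l < a \<or> b < l")
    case True
    then have "l \<in># \<nu>" using lm ab by (auto simp: \<nu>_def in_diff_count count_two_mset)
    then show ?thesis using that(1)[of d l] d db True l(2) by metis
  next
    case False
    have c: "count {#a, d#} l < count \<mu> l" using l(1) by (simp add: in_diff_count)
    have "{#a, l#} \<subseteq># \<mu>" "{#d, l#} \<subseteq># \<mu>"
      using c mem(1) d by (auto simp: subseteq_mset_def Suc_le_eq count_greater_zero_iff split: if_splits)
    then show ?thesis using that(2)[of a l] that(2)[of d l] l(2) False db ab by (metis less_imp_le not_less order_refl)
  qed
qed

text \<open>A violation from \<open>not_merged\<close> involves at most two vertices of
  \<open>\<nu>\<close>. If there were a third one, its deletion would leave the violation intact,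
  against \<open>merge_nu\<close>.\<close>

lemma q_le: "q \<le> 2"
proof (rule ccontr)
  assume "\<not> ?thesis"
  then have q3: "3 \<le> size \<nu>" by (simp add: q_def)
  have ex: "\<exists>t. t \<in># \<nu> - {#c, d#}" for c d
  proof -
    have "size \<nu> - size {#c, d#} \<le> size (\<nu> - {#c, d#})" by (rule diff_size_le_size_Diff)
    then have "\<nu> - {#c, d#} \<noteq> {#}" using q3 by auto
    then show ?thesis by (meson multiset_nonemptyE)
  qed
  show False
  proof (rule not_merged)
    fix c l assume h: "c \<in># \<mu>" "a \<le> c" "c \<le> b" "l \<in># \<nu>" "l < a \<or> b < l" "K c l \<noteq> K a l"
    obtain t where t: "t \<in># \<nu> - {#c, l#}" using ex by blast
    then have tc: "count {#c, l#} t < count \<nu> t" by (simp add: in_diff_count)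
    have tn: "t \<in># \<nu>" using t by (rule in_diffD)
    have "c \<in># \<nu> + two_mset a 2 b 2" by (subst mu_split[symmetric]) (rule h(1))
    then have "c \<in># \<nu> - {#t#} + two_mset a 2 b 2"
      using tc by (cases "c = t") (auto simp: in_diff_count two_mset_mem split: if_splits)
    moreover have "l \<in># \<nu> - {#t#}" using h(4) tc by (cases "l = t") (auto simp: in_diff_count split: if_splits)
    ultimately show False using merge_nu(1)[OF tn] h by blast
  next
    fix c d assume h: "{#c, d#} \<subseteq># \<mu>" "a \<le> c" "c \<le> b" "a \<le> d" "d \<le> b" "K c d \<noteq> K a a"
    obtain t where t: "t \<in># \<nu> - {#c, d#}" using ex by blast
    then have tc: "count {#c, d#} t < count \<nu> t" by (simp add: in_diff_count)
    have tn: "t \<in># \<nu>" using t by (rule in_diffD)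
    have sub: "{#c, d#} \<subseteq># \<nu> + two_mset a 2 b 2" by (subst mu_split[symmetric]) (rule h(1))
    have "{#c, d#} \<subseteq># \<nu> - {#t#} + two_mset a 2 b 2"
      unfolding subseteq_mset_def
    proof
      fix x
      show "count {#c, d#} x \<le> count (\<nu> - {#t#} + two_mset a 2 b 2) x"
        using mset_subset_eq_count[OF sub, of x] tc by (cases "x = t") auto
    qed
    then show False using merge_nu(2)[OF tn] h by blast
  qed
qed

end

lemma pull_neq:
  assumes "K (w ! x) (w ! y) \<noteq> K (w' ! x) (w' ! y)" "x \<noteq> y"
    "x < length w" "y < length w" "x < length w'" "y < length w'"
  shows "pull K w \<noteq> pull K w'"
proof
  assume "pull K w = pull K w'"
  then have "pull K w x y = pull K w' x y" by simp
  then show False using assms by (simp add: pull_def)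
qed

lemma pull_notin:
  assumes "x \<noteq> y" "x < length w" "y < length w"
    and "\<And>w'. w' \<in> set ws \<Longrightarrow> x < length w' \<and> y < length w' \<and> K (w ! x) (w ! y) \<noteq> K (w' ! x) (w' ! y)"
  shows "pull K w \<notin> pull K ` set ws"
proof
  assume "pull K w \<in> pull K ` set ws"
  then obtain w' where w': "w' \<in> set ws" "pull K w = pull K w'" by blast
  then have "pull K w x y = pull K w' x y" by simp
  then show False using assms(1-3) assms(4)[OF w'(1)] by (simp add: pull_def)
qed

context two_block_family
begin

section \<open>Graphs outside the two-block family\<close>

text \<open>The shadow of the family member \<open>ext 2 (e + 2)\<close> at a vertex labelled
  \<open>c\<close>. By \<open>merge_nu\<close> everything from \<open>a\<close> to \<open>b\<close>
  is a single block in it.\<close>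

definition core where "core c = blow K (\<nu> - {#c#} + two_mset a 2 b (e + 2))"

lemma blow_pull: "sorted w \<Longrightarrow> mset w = M \<Longrightarrow> blow K M = pull K w"
  using word_unique[of w] by (simp add: blow_def)

text \<open>The argument of \<open>q_le\<close>, made precise: a vertex of \<open>\<nu>\<close> that
  takes no part in the violation could be deleted without destroying it. So the violation uses up
  \<open>\<nu>\<close>.\<close>

lemma tight_outer:
  assumes h: "c \<in># \<mu>" "a \<le> c" "c \<le> b" "l \<in># \<nu>" "l < a \<or> b < l" "K c l \<noteq> K a l"
  shows "\<nu> \<subseteq># {#c, l#}"
proof (rule ccontr)
  assume "\<not> ?thesis"
  then obtain t where tc: "count {#c, l#} t < count \<nu> t" by (auto simp: subseteq_mset_def not_le)
  then have tn: "t \<in># \<nu>" by (metis count_greater_zero_iff gr_implies_not0 neq0_conv)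
  have "c \<in># \<nu> + two_mset a 2 b 2" by (subst mu_split[symmetric]) (rule h(1))
  then have "c \<in># \<nu> - {#t#} + two_mset a 2 b 2"
    using tc by (cases "c = t") (auto simp: in_diff_count two_mset_mem split: if_splits)
  moreover have "l \<in># \<nu> - {#t#}" using h(4) tc by (cases "l = t") (auto simp: in_diff_count split: if_splits)
  ultimately show False using merge_nu(1)[OF tn] h by blast
qed

lemma tight_inner:
  assumes h: "{#c, d#} \<subseteq># \<mu>" "a \<le> c" "c \<le> b" "a \<le> d" "d \<le> b" "K c d \<noteq> K a a"
  shows "\<nu> \<subseteq># {#c, d#}"
proof (rule ccontr)
  assume "\<not> ?thesis"
  then obtain t where tc: "count {#c, d#} t < count \<nu> t" by (auto simp: subseteq_mset_def not_le)
  then have tn: "t \<in># \<nu>" by (metis count_greater_zero_iff gr_implies_not0 neq0_conv)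
  have sub: "{#c, d#} \<subseteq># \<nu> + two_mset a 2 b 2" by (subst mu_split[symmetric]) (rule h(1))
  have "{#c, d#} \<subseteq># \<nu> - {#t#} + two_mset a 2 b 2"
    unfolding subseteq_mset_def
  proof
    fix x
    show "count {#c, d#} x \<le> count (\<nu> - {#t#} + two_mset a 2 b 2) x"
      using mset_subset_eq_count[OF sub, of x] tc by (cases "x = t") auto
  qed
  then show False using merge_nu(2)[OF tn] h by blast
qed

text \<open>A single deletion from \<open>\<nu>\<close> already merges \<open>a\<close> and
  \<open>b\<close>, so no violation involves these two labels alone.\<close>

lemma kappa:
  assumes "\<nu> \<noteq> {#}"
  shows "K a b = K a a" "K b b = K a a"
proof -
  obtain c where c: "c \<in># \<nu>" using assms by (meson multiset_nonemptyE)
  have "{#a, b#} \<subseteq># \<nu> - {#c#} + two_mset a 2 b 2" "{#b, b#} \<subseteq># \<nu> - {#c#} + two_mset a 2 b 2"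
    using ab by (auto simp: subseteq_mset_def count_two_mset)
  then show "K a b = K a a" "K b b = K a a" using merge_nu(2)[OF c] ab by auto
qed

lemma kappa_mid:
  assumes "\<nu> = {#c, d#}" "a \<le> c" "c \<le> b"
  shows "K a c = K a a" "K c b = K a a"
proof -
  have "c \<noteq> a" "c \<noteq> b" using nu_ab assms(1) by auto
  then have "{#a, c#} \<subseteq># \<nu> - {#d#} + two_mset a 2 b 2" "{#c, b#} \<subseteq># \<nu> - {#d#} + two_mset a 2 b 2"
    using ab assms by (auto simp: subseteq_mset_def count_two_mset)
  then show "K a c = K a a" "K c b = K a a" using merge_nu(2)[of d] assms ab by auto
qed

text \<open>The candidates all turn out to lie in \<open>extra\<close>, which has at most \<open>q + 2\<close> elements: \<open>Z\<close> gives the final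
  contradiction, while \<open>B\<close> leaves no room for two further elements with several long blocks.\<close>

definition distinct_pieces where
  "distinct_pieces \<longleftrightarrow> (\<exists>Z B. Z \<subseteq> {ext 0 (e + 3), ext 1 (e + 2), ext (e + 2) 1, ext (e + 3) 0} \<union> core ` set_mset \<nu> \<and>
     B \<subseteq> {ext 1 (e + 2), ext (e + 2) 1} \<union> core ` set_mset \<nu> \<and> q + 3 \<le> card Z \<and> min 3 (q + 2) \<le> card B)"

section \<open>Distinct candidates, by the shape of \<open>\<nu>\<close>\<close>

lemma e_large: "68 < e"
  using n ne by simp

text \<open>For \<open>q = 0\<close> three candidates suffice: the two with a single odd vertex and
  one of the two homogeneous graphs, chosen according to which adjacency differs from
  \<open>K a a\<close>.\<close>

lemma pieces_0:
  assumes "\<nu> = {#}" and neq: "K a b \<noteq> K a a \<or> K b b \<noteq> K a a"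
  shows distinct_pieces
proof -
  have x: "ext i j = pull K (replicate i a @ replicate j b)" for i j
    unfolding ext_def using ab assms(1) by (intro blow_pull) (auto simp: sorted_append two_mset_def)
  have 1: "ext 1 (e + 2) \<noteq> ext (e + 2) 1"
  proof (cases "K a b = K a a")
    case True
    then show ?thesis unfolding x using neq by (intro pull_neq[where x = 1 and y = 2]) (auto simp: nth_append)
  next
    case False
    then show ?thesis unfolding x by (intro pull_neq[where x = 0 and y = 1]) (auto simp: nth_append)
  qed
  have "\<exists>g \<in> {ext 0 (e + 3), ext (e + 3) 0}. g \<noteq> ext 1 (e + 2) \<and> g \<noteq> ext (e + 2) 1"
  proof (cases "K a b = K a a")
    case True
    have "ext 0 (e + 3) \<noteq> ext 1 (e + 2)" "ext 0 (e + 3) \<noteq> ext (e + 2) 1"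
      unfolding x using neq True by (intro pull_neq[where x = 0 and y = 1]; auto simp: nth_append)+
    then show ?thesis by blast
  next
    case False
    have "ext (e + 3) 0 \<noteq> ext 1 (e + 2)"
      unfolding x using False by (intro pull_neq[where x = 0 and y = 1]) (auto simp: nth_append)
    moreover have "ext (e + 3) 0 \<noteq> ext (e + 2) 1"
      unfolding x using False by (intro pull_neq[where x = 0 and y = "e + 2"]) (auto simp: nth_append)
    ultimately show ?thesis by blast
  qed
  then obtain g where g: "g \<in> {ext 0 (e + 3), ext (e + 3) 0}" "g \<noteq> ext 1 (e + 2)" "g \<noteq> ext (e + 2) 1" by blast
  have "q = 0" using assms by (simp add: q_def)
  moreover have "card {g, ext 1 (e + 2), ext (e + 2) 1} = 3" "card {ext 1 (e + 2), ext (e + 2) 1} = 2" using 1 g by auto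
  ultimately show ?thesis unfolding distinct_pieces_def using g(1)
    by (intro exI[of _ "{g, ext 1 (e + 2), ext (e + 2) 1}"] exI[of _ "{ext 1 (e + 2), ext (e + 2) 1}"]) auto
qed

lemma piecesI:
  assumes Z: "set zs \<subseteq> {ext 0 (e + 3), ext 1 (e + 2), ext (e + 2) 1, ext (e + 3) 0} \<union> core ` set_mset \<nu>"
    and d: "distinct zs" "length zs = q + 3" and c: "c \<in># \<nu>"
    and neq: "ext 1 (e + 2) \<noteq> ext (e + 2) 1" "core c \<noteq> ext 1 (e + 2)" "core c \<noteq> ext (e + 2) 1"
  shows distinct_pieces
proof -
  have "card {ext 1 (e + 2), ext (e + 2) 1, core c} = 3" using neq by auto
  moreover have "card (set zs) = q + 3" using d distinct_card by metis
  ultimately show ?thesis unfolding distinct_pieces_def using Z c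
    by (intro exI[of _ "set zs"] exI[of _ "{ext 1 (e + 2), ext (e + 2) 1, core c}"]) auto
qed

lemma core_1: "\<nu> = {#t#} \<Longrightarrow> core t = pull K (replicate 2 a @ replicate (e + 2) b)"
  unfolding core_def using ab by (intro blow_pull) (auto simp: sorted_append two_mset_def numeral_2_eq_2)

text \<open>The row of the first vertex \<open>t\<close> shows how many vertices are labelled
  \<open>a\<close>. The graph \<open>core t\<close> lacks \<open>t\<close> and is homogeneous by
  \<open>kappa\<close>, whereas in \<open>ext 1 (e + 2)\<close> and \<open>ext (e + 2) 1\<close> the
  row of \<open>t\<close> is not constant.\<close>

lemma pieces_1_left:
  assumes nu: "\<nu> = {#t#}" and t: "t < a" and neq: "K t a \<noteq> K t b"
  shows distinct_pieces
proof -
  have x: "ext i j = pull K (t # replicate i a @ replicate j b)" for i j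
    unfolding ext_def using ab nu t by (intro blow_pull) (auto simp: sorted_append two_mset_def)
  note c = core_1[OF nu] and k = kappa[unfolded nu]
  have n01: "ext 0 (e + 3) \<noteq> ext 1 (e + 2)" and n02: "ext 0 (e + 3) \<noteq> ext (e + 2) 1"
    and n03: "ext 0 (e + 3) \<noteq> ext (e + 3) 0"
    unfolding x using neq by (intro pull_neq[where x = 0 and y = 1]; auto simp: nth_append)+
  have n12: "ext 1 (e + 2) \<noteq> ext (e + 2) 1" and n13: "ext 1 (e + 2) \<noteq> ext (e + 3) 0"
    unfolding x using neq by (intro pull_neq[where x = 0 and y = 2]; auto simp: nth_append nth_Cons')+
  have n23: "ext (e + 2) 1 \<noteq> ext (e + 3) 0"
    unfolding x using neq by (intro pull_neq[where x = 0 and y = "e + 3"]) (auto simp: nth_append)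
  have c1: "core t \<noteq> ext 1 (e + 2)"
  proof (cases "K t a = K a a")
    case True
    then show ?thesis unfolding x c using neq k by (intro pull_neq[where x = 0 and y = 2]) (auto simp: nth_append nth_Cons')
  next
    case False
    then show ?thesis unfolding x c using neq k by (intro pull_neq[where x = 0 and y = 1]) (auto simp: nth_append nth_Cons')
  qed
  have c2: "core t \<noteq> ext (e + 2) 1"
  proof (cases "K t a = K a a")
    case True
    then show ?thesis unfolding x c using neq k by (intro pull_neq[where x = 0 and y = "e + 3"]) (auto simp: nth_append nth_Cons')
  next
    case False
    then show ?thesis unfolding x c using neq k by (intro pull_neq[where x = 0 and y = 1]) (auto simp: nth_append nth_Cons')
  qed
  show ?thesis
    by (rule piecesI[of "[ext 0 (e + 3), ext 1 (e + 2), ext (e + 2) 1, ext (e + 3) 0]" t])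
      (use n01 n02 n03 n12 n13 n23 c1 c2 nu in \<open>auto simp: q_def\<close>)
qed

lemma pieces_1_right:
  assumes nu: "\<nu> = {#t#}" and t: "b < t" and neq: "K t a \<noteq> K t b"
  shows distinct_pieces
proof -
  have x: "ext i j = pull K (replicate i a @ replicate j b @ [t])" for i j
    unfolding ext_def using ab nu t by (intro blow_pull) (auto simp: sorted_append two_mset_def)
  note c = core_1[OF nu] and k = kappa[unfolded nu]
  have neq': "K a t \<noteq> K b t" using neq K by metis
  have n01: "ext 0 (e + 3) \<noteq> ext 1 (e + 2)" and n02: "ext 0 (e + 3) \<noteq> ext (e + 2) 1"
    and n03: "ext 0 (e + 3) \<noteq> ext (e + 3) 0"
    unfolding x using neq' by (intro pull_neq[where x = 0 and y = "e + 3"]; auto simp: nth_append)+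
  have n12: "ext 1 (e + 2) \<noteq> ext (e + 2) 1" and n13: "ext 1 (e + 2) \<noteq> ext (e + 3) 0"
    unfolding x using neq' by (intro pull_neq[where x = 1 and y = "e + 3"]; auto simp: nth_append nth_Cons')+
  have n23: "ext (e + 2) 1 \<noteq> ext (e + 3) 0"
    unfolding x using neq' by (intro pull_neq[where x = "e + 2" and y = "e + 3"]) (auto simp: nth_append)
  have c1: "core t \<noteq> ext 1 (e + 2)"
  proof (cases "K a t = K a a")
    case True
    then show ?thesis unfolding x c using neq' k by (intro pull_neq[where x = 1 and y = "e + 3"]) (auto simp: nth_append nth_Cons')
  next
    case False
    then show ?thesis unfolding x c using neq' k by (intro pull_neq[where x = 0 and y = "e + 3"]) (auto simp: nth_append nth_Cons')
  qed
  have c2: "core t \<noteq> ext (e + 2) 1"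
  proof (cases "K a t = K a a")
    case True
    then show ?thesis unfolding x c using neq' k e_large
      by (intro pull_neq[where x = "e + 2" and y = "e + 3"]) (auto simp: nth_append nth_Cons')
  next
    case False
    then show ?thesis unfolding x c using neq' k by (intro pull_neq[where x = 0 and y = "e + 3"]) (auto simp: nth_append nth_Cons')
  qed
  show ?thesis
    by (rule piecesI[of "[ext 0 (e + 3), ext 1 (e + 2), ext (e + 2) 1, ext (e + 3) 0]" t])
      (use n01 n02 n03 n12 n13 n23 c1 c2 nu in \<open>auto simp: q_def\<close>)
qed

text \<open>The position of \<open>t\<close> shows in the row of the last vertex if
  \<open>K t b\<close> is exceptional, and in the row of the first vertex otherwise. The candidate
  in which \<open>t\<close> is that vertex itself is left out, and the homogeneous graph
  \<open>core t\<close> takes its place.\<close>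

lemma pieces_1_mid:
  assumes nu: "\<nu> = {#t#}" and t: "a \<le> t" "t \<le> b" and neq: "K a t \<noteq> K a a \<or> K t b \<noteq> K a a"
  shows distinct_pieces
proof -
  have x: "ext i j = pull K (replicate i a @ t # replicate j b)" for i j
    unfolding ext_def using ab nu t by (intro blow_pull) (auto simp: sorted_append two_mset_def)
  note c = core_1[OF nu] and k = kappa[unfolded nu]
  show ?thesis
  proof (cases "K t b = K a a")
    case False
    have n01: "ext 0 (e + 3) \<noteq> ext 1 (e + 2)" and n02: "ext 0 (e + 3) \<noteq> ext (e + 2) 1"
      and n03: "ext 0 (e + 3) \<noteq> core t"
      unfolding x c using False k by (intro pull_neq[where x = 0 and y = "e + 3"]; auto simp: nth_append nth_Cons')+
    have n12: "ext 1 (e + 2) \<noteq> ext (e + 2) 1" and n13: "ext 1 (e + 2) \<noteq> core t"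
      unfolding x c using False k by (intro pull_neq[where x = 1 and y = "e + 3"]; auto simp: nth_append nth_Cons')+
    have n23: "ext (e + 2) 1 \<noteq> core t"
      unfolding x c using False k e_large by (intro pull_neq[where x = "e + 2" and y = "e + 3"]) (auto simp: nth_append nth_Cons')
    show ?thesis
      by (rule piecesI[of "[ext 0 (e + 3), ext 1 (e + 2), ext (e + 2) 1, core t]" t])
        (use n01 n02 n03 n12 n13 n23 nu in \<open>auto simp: q_def\<close>)
  next
    case True
    then have False: "K a t \<noteq> K a a" using neq by simp
    have n01: "ext (e + 3) 0 \<noteq> ext 1 (e + 2)" and n02: "ext (e + 3) 0 \<noteq> ext (e + 2) 1"
      and n03: "ext (e + 3) 0 \<noteq> core t"
      unfolding x c using False k by (intro pull_neq[where x = 0 and y = "e + 3"]; auto simp: nth_append nth_Cons')+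
    have n12: "ext (e + 2) 1 \<noteq> ext 1 (e + 2)" and n13: "ext (e + 2) 1 \<noteq> core t"
      unfolding x c using False k by (intro pull_neq[where x = 0 and y = "e + 2"]; auto simp: nth_append nth_Cons')+
    have n23: "ext 1 (e + 2) \<noteq> core t"
      unfolding x c using False k by (intro pull_neq[where x = 0 and y = 1]) (auto simp: nth_append nth_Cons')
    show ?thesis
      by (rule piecesI[of "[ext (e + 3) 0, ext 1 (e + 2), ext (e + 2) 1, core t]" t])
        (use n01 n02 n03 n12 n13 n23 nu in \<open>auto simp: q_def\<close>)
  qed
qed

text \<open>Among the vertices labelled \<open>a\<close>, \<open>b\<close> or \<open>c\<close>, the
  adjacency to \<open>l\<close> singles out the one labelled \<open>c\<close>, whose position
  distinguishes the candidates; \<open>core c\<close> has no such vertex.\<close>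

lemma pieces_2_outer:
  assumes nu: "\<nu> = {#c, l#}" and c: "a \<le> c" "c \<le> b" and l: "l < a \<or> b < l"
    and K1: "K a l = K b l" and K2: "K c l \<noteq> K a l"
  shows distinct_pieces
proof -
  show ?thesis
  proof (cases "l < a")
    case True
    define W where "W i j = l # replicate i a @ c # replicate j b" for i j :: nat
    have x: "ext i j = pull K (W i j)" for i j
      unfolding ext_def W_def using ab nu c True by (intro blow_pull) (auto simp: sorted_append two_mset_def)
    define C where "C = l # replicate 2 a @ replicate (e + 2) b"
    have y: "core c = pull K C"
      unfolding core_def C_def using ab nu True by (intro blow_pull) (auto simp: sorted_append two_mset_def numeral_2_eq_2)
    have k: "K l a = K l b" "K l c \<noteq> K l b" "K l c \<noteq> K l a" using K1 K2 K by metis+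
    have n0: "pull K (W 0 (e + 3)) \<notin> pull K ` set [W 1 (e + 2), W (e + 2) 1, W (e + 3) 0, C]"
      using k e_large by (intro pull_notin[where x = 0 and y = 1]) (auto simp: W_def C_def nth_append nth_Cons')
    have n1: "pull K (W 1 (e + 2)) \<notin> pull K ` set [W (e + 2) 1, W (e + 3) 0, C]"
      using k e_large by (intro pull_notin[where x = 0 and y = 2]) (auto simp: W_def C_def nth_append nth_Cons')
    have n2: "pull K (W (e + 2) 1) \<notin> pull K ` set [W (e + 3) 0, C]"
      using k e_large by (intro pull_notin[where x = 0 and y = "e + 3"]) (auto simp: W_def C_def nth_append nth_Cons')
    have n3: "pull K (W (e + 3) 0) \<notin> pull K ` set [C]"
      using k e_large by (intro pull_notin[where x = 0 and y = "e + 4"]) (auto simp: W_def C_def nth_append nth_Cons')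
    show ?thesis
      by (rule piecesI[of "[ext 0 (e + 3), ext 1 (e + 2), ext (e + 2) 1, ext (e + 3) 0, core c]" c])
        (use n0 n1 n2 n3 nu in \<open>auto simp: q_def x y\<close>)
  next
    case False
    then have bl: "b < l" using l by simp
    define W where "W i j = replicate i a @ c # replicate j b @ [l]" for i j :: nat
    have x: "ext i j = pull K (W i j)" for i j
      unfolding ext_def W_def using ab nu c bl by (intro blow_pull) (auto simp: sorted_append two_mset_def)
    define C where "C = replicate 2 a @ replicate (e + 2) b @ [l]"
    have y: "core c = pull K C"
      unfolding core_def C_def using ab nu bl by (intro blow_pull) (auto simp: sorted_append two_mset_def numeral_2_eq_2)
    have k: "K a l = K b l" "K c l \<noteq> K b l" "K c l \<noteq> K a l" using K1 K2 by auto
    have n0: "pull K (W 0 (e + 3)) \<notin> pull K ` set [W 1 (e + 2), W (e + 2) 1, W (e + 3) 0, C]"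
      using k e_large by (intro pull_notin[where x = 0 and y = "e + 4"]) (auto simp: W_def C_def nth_append nth_Cons')
    have n1: "pull K (W 1 (e + 2)) \<notin> pull K ` set [W (e + 2) 1, W (e + 3) 0, C]"
      using k e_large by (intro pull_notin[where x = 1 and y = "e + 4"]) (auto simp: W_def C_def nth_append nth_Cons')
    have n2: "pull K (W (e + 2) 1) \<notin> pull K ` set [W (e + 3) 0, C]"
      using k e_large by (intro pull_notin[where x = "e + 2" and y = "e + 4"]) (auto simp: W_def C_def nth_append nth_Cons')
    have n3: "pull K (W (e + 3) 0) \<notin> pull K ` set [C]"
      using k e_large by (intro pull_notin[where x = "e + 3" and y = "e + 4"]) (auto simp: W_def C_def nth_append nth_Cons')
    show ?thesis
      by (rule piecesI[of "[ext 0 (e + 3), ext 1 (e + 2), ext (e + 2) 1, ext (e + 3) 0, core c]" c])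
        (use n0 n1 n2 n3 nu in \<open>auto simp: q_def x y\<close>)
  qed
qed

text \<open>The only exceptional adjacency is the one between \<open>c\<close> and \<open>d\<close>,
  at the positions \<open>i\<close> and \<open>i + 1\<close> of \<open>ext i j\<close>;
  \<open>core c\<close> is homogeneous.\<close>

lemma pieces_2_inner:
  assumes nu: "\<nu> = {#c, d#}" and cd: "a \<le> c" "c \<le> d" "d \<le> b" and neq: "K c d \<noteq> K a a"
  shows distinct_pieces
proof -
  define W where "W i j = replicate i a @ c # d # replicate j b" for i j :: nat
  have x: "ext i j = pull K (W i j)" for i j
    unfolding ext_def W_def using ab nu cd by (intro blow_pull) (auto simp: sorted_append two_mset_def)
  define C where "C = replicate 2 a @ d # replicate (e + 2) b"
  have y: "core c = pull K C"
    unfolding core_def C_def using ab nu cd by (intro blow_pull) (auto simp: sorted_append two_mset_def numeral_2_eq_2)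
  have k0: "\<nu> \<noteq> {#}" using nu by simp
  have nu': "\<nu> = {#d, c#}" using nu by (simp add: add_mset_commute)
  note k = kappa[OF k0] kappa_mid[OF nu] kappa_mid[OF nu']
  have k': "K a c = K a a" "K c b = K a a" "K a d = K a a" "K d b = K a a" "K a b = K a a" "K b b = K a a"
    using k cd by auto
  have n0: "pull K (W 0 (e + 3)) \<notin> pull K ` set [W 1 (e + 2), W (e + 2) 1, W (e + 3) 0, C]"
    using k' neq e_large by (intro pull_notin[where x = 0 and y = 1]) (auto simp: W_def C_def nth_append nth_Cons')
  have n1: "pull K (W 1 (e + 2)) \<notin> pull K ` set [W (e + 2) 1, W (e + 3) 0, C]"
    using k' neq e_large by (intro pull_notin[where x = 1 and y = 2]) (auto simp: W_def C_def nth_append nth_Cons')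
  have n2: "pull K (W (e + 2) 1) \<notin> pull K ` set [W (e + 3) 0, C]"
    using k' neq e_large by (intro pull_notin[where x = "e + 2" and y = "e + 3"]) (auto simp: W_def C_def nth_append nth_Cons')
  have n3: "pull K (W (e + 3) 0) \<notin> pull K ` set [C]"
    using k' neq e_large by (intro pull_notin[where x = "e + 3" and y = "e + 4"]) (auto simp: W_def C_def nth_append nth_Cons')
  show ?thesis
    by (rule piecesI[of "[ext 0 (e + 3), ext 1 (e + 2), ext (e + 2) 1, ext (e + 3) 0, core c]" c])
      (use n0 n1 n2 n3 nu in \<open>auto simp: q_def x y\<close>)
qed

end

lemma sub_pair:
  assumes "\<nu> \<subseteq># {#c, d#}"
  shows "\<nu> = {#} \<or> \<nu> = {#c#} \<or> \<nu> = {#d#} \<or> \<nu> = {#c, d#}"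
proof -
  consider "size \<nu> = 0" | "size \<nu> = 1" | "2 \<le> size \<nu>" by linarith
  then show ?thesis
  proof cases
    case 1 then show ?thesis by simp
  next
    case 2
    then obtain x where x: "\<nu> = {#x#}" by (metis One_nat_def size_1_singleton_mset)
    then have "x \<in># {#c, d#}" using assms mset_subset_eqD[of \<nu> "{#c, d#}" x] by simp
    then show ?thesis using x by auto
  next
    case 3
    have "\<not> \<nu> \<subset># {#c, d#}" using 3 mset_subset_size[of \<nu> "{#c, d#}"] by auto
    then show ?thesis using assms by (simp add: subset_mset.le_less)
  qed
qed

text \<open>The violation given by \<open>not_merged\<close> uses up \<open>\<nu>\<close>, by
  \<open>tight_outer\<close> and \<open>tight_inner\<close>, so that only a few shapes of
  \<open>\<nu>\<close> are possible.\<close>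

lemma (in two_block_family) pieces: distinct_pieces
proof (rule not_merged)
  fix c l assume h: "c \<in># \<mu>" "a \<le> c" "c \<le> b" "l \<in># \<nu>" "l < a \<or> b < l" "K c l \<noteq> K a l"
  from sub_pair[OF tight_outer[OF h]] h(4)
  consider "\<nu> = {#l#}" | "\<nu> = {#c, l#}" | "\<nu> = {#c#}" "c = l" by auto
  then show ?thesis
  proof cases
    case 1
    have "0 < count \<mu> c" using h(1) by simp
    then have "c = a \<or> c = b \<or> 0 < count \<nu> c" using count_mu[of c] by (auto split: if_splits)
    moreover have "\<not> 0 < count \<nu> c" using 1 h(2,3,5) by auto
    ultimately have "c = b" using h(6) by auto
    then have "K l a \<noteq> K l b" using h(6) K by metis
    then show ?thesis using pieces_1_left[OF 1] pieces_1_right[OF 1] h(5) by blast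
  next
    case 2
    have "b \<in># \<nu> - {#c#} + two_mset a 2 b 2" "l \<in># \<nu> - {#c#}" using 2 by (simp_all add: two_mset_mem)
    then have "K b l = K a l" using merge_nu(1)[of c b l] 2 ab h(5) by simp
    then show ?thesis using pieces_2_outer[OF 2 h(2,3,5)] h(6) by simp
  next
    case 3
    then show ?thesis using h by auto
  qed
next
  fix c d assume h: "{#c, d#} \<subseteq># \<mu>" "a \<le> c" "c \<le> b" "a \<le> d" "d \<le> b" "K c d \<noteq> K a a"
  have single: distinct_pieces
    if s: "\<nu> = {#c#}" "{#c, d#} \<subseteq># \<mu>" "a \<le> c" "c \<le> b" "K c d \<noteq> K a a" for c d
  proof -
    have nab: "c \<noteq> a" "c \<noteq> b" using nu_ab s(1) by auto
    have "count {#c, d#} d \<le> count \<mu> d" using s(2) by (rule mset_subset_eq_count)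
    then have "d = a \<or> d = b" using count_mu[of d] s(1) nab by (auto split: if_splits)
    then show ?thesis using pieces_1_mid[OF s(1,3,4)] s(5) K by metis
  qed
  from sub_pair[OF tight_inner[OF h]]
  consider "\<nu> = {#}" | "\<nu> = {#c#}" | "\<nu> = {#d#}" | "\<nu> = {#c, d#}" by blast
  then show ?thesis
  proof cases
    case 1
    have "c \<in># \<mu>" "d \<in># \<mu>" using mset_subset_eqD[OF h(1)] by simp_all
    then have "0 < count \<mu> c" "0 < count \<mu> d" by simp_all
    then have "(c = a \<or> c = b) \<and> (d = a \<or> d = b)" using count_mu[of c] count_mu[of d] 1 by (auto split: if_splits)
    then show ?thesis using pieces_0[OF 1] h(6) K by metis
  next
    case 2
    then show ?thesis using single[of c d] h by simp
  next
    case 3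
    have "{#d, c#} \<subseteq># \<mu>" using h(1) by (simp add: add_mset_commute)
    then show ?thesis using single[of d c] 3 h K by metis
  next
    case 4
    show ?thesis
    proof (cases "c \<le> d")
      case True
      then show ?thesis using pieces_2_inner[OF 4] h by simp
    next
      case False
      have "\<nu> = {#d, c#}" using 4 by (simp add: add_mset_commute)
      then show ?thesis using pieces_2_inner[of d c] False h K by (metis nat_le_linear)
    qed
  qed
qed

text \<open>\<open>big m h\<close> says that all but at most three of the \<open>m\<close> vertices of \<open>h\<close> lie in one block.\<close>

definition run :: "nat \<Rightarrow> (nat \<Rightarrow> nat \<Rightarrow> bool) \<Rightarrow> nat \<Rightarrow> nat \<Rightarrow> bool" where
  "run n g y k \<longleftrightarrow> k \<le> y \<and> y + k < n \<and> (\<forall>x. y \<le> x + k \<and> x < y + k \<longrightarrow> twin g x)"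

definition big :: "nat \<Rightarrow> (nat \<Rightarrow> nat \<Rightarrow> bool) \<Rightarrow> bool" where
  "big m h \<longleftrightarrow> (\<exists>s t. t \<le> m \<and> m \<le> t - s + 3 \<and> (\<forall>x. s \<le> x \<and> Suc x < t \<longrightarrow> twin h x))"

lemma runD: "run n g y k \<Longrightarrow> y \<le> x + k \<Longrightarrow> x < y + k \<Longrightarrow> twin g x"
  by (auto simp: run_def)

lemma run_mono: "run n g y k \<Longrightarrow> j \<le> k \<Longrightarrow> run n g y j"
  by (auto simp: run_def)

lemma run_mid:
  assumes "run n g y k" "1 \<le> k"
  shows "mid n g y"
proof -
  have "twin g (y - 1)" "twin g y" using assms by (intro runD[OF assms(1)]; simp add: run_def)+
  then show ?thesis using assms by (simp add: run_def mid_def)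
qed

text \<open>A position between the two stretches is at distance at least five from both ends of the
  graph, hence inside the block that misses at most three vertices.\<close>

lemma big_between:
  assumes "big m h" and r1: "\<And>x. p1 \<le> x \<Longrightarrow> x < p1 + 5 \<Longrightarrow> twin h x" and r2: "\<And>x. p2 \<le> x \<Longrightarrow> x < p2 + 5 \<Longrightarrow> twin h x"
    and "p2 + 5 < m" and x: "p1 \<le> x" "x < p2 + 5"
  shows "twin h x"
proof -
  obtain s t where st: "t \<le> m" "m \<le> t - s + 3" "\<And>x. s \<le> x \<and> Suc x < t \<Longrightarrow> twin h x"
    using assms(1) by (auto simp: big_def)
  consider "x < p1 + 5" | "p2 \<le> x" | "p1 + 5 \<le> x" "x < p2" by linarith
  then show ?thesis
  proof cases
    case 1 then show ?thesis using r1 x by blast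
  next
    case 2 then show ?thesis using r2 x by blast
  next
    case 3
    then have "s \<le> x \<and> Suc x < t" using st(1,2) assms(4) by linarith
    then show ?thesis by (rule st(3))
  qed
qed

lemma twin_del_mid:
  assumes "g \<in> adjs n" "mid n g v"
  shows "twin (del g v) x \<longleftrightarrow> (if Suc x < v then twin g x else if Suc x = v then True else twin g (Suc x))"
  using twin_del[OF assms(1), of v x] assms(2) by (simp add: mid_def)

text \<open>If all pairs from \<open>y1\<close> up to \<open>x\<close> are twins, the deletions of
  \<open>y1\<close>, \<open>x\<close> and \<open>y2\<close> agree, and \<open>del_eq_three\<close>
  applies to the middle vertex \<open>x\<close>.\<close>

lemma del_eq_twins:
  assumes g: "g \<in> adjs n" and e: "del g y1 = del g y2" and t: "twin g y1" and x: "y1 \<le> x" "x < y2"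
  shows "twin g x"
  using x
proof (induction x rule: less_induct)
  case (less x)
  show ?case
  proof (cases "x = y1")
    case False
    have "del g x = del g y1" by (rule del_twins[OF g]) (use less in auto)
    then show ?thesis using del_eq_three(2)[OF g, of y1 x y2] e less False by simp
  qed (use t in simp)
qed

text \<open>By \<open>blow_insert\<close> both graphs arise from the common shadow by thickening a
  block, and \<open>t\<close> says that it is the same block.\<close>

lemma parent_unique:
  assumes g: "g \<in> adjs n" "g' \<in> adjs n" and m: "mid n g y" "mid n g' y'" and e: "del g y = del g' y'"
    and le: "y \<le> y'" and t: "\<And>x. y - 1 \<le> x \<Longrightarrow> x < y' \<Longrightarrow> twin (del g y) x"
  shows "g = g'"
proof -
  obtain k where n: "n = Suc k" using m by (cases n) (auto simp: mid_def)
  have y: "0 < y" "y < k" "0 < y'" "y' < k" using m n by (auto simp: mid_def)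
  have "del g y \<in> adjs k" using del_adjs[OF g(1), of y] y n by simp
  then obtain K \<beta> where K: "\<And>c d. K c d = K d c" and sz: "size \<beta> = k" and b: "del g y = blow K \<beta>" and s: "sep K \<beta>"
    using blow_exists by blast
  have eq: "word \<beta> ! x = word \<beta> ! (y - 1)" if "y - 1 \<le> x" "x \<le> y'" for x
    using that
  proof (induction x rule: dec_induct)
    case (step x)
    have "twin (blow K \<beta>) x" using t[of x] step b by simp
    then show ?case using sepD[OF s, of x] step y sz by simp
  qed simp
  have "g = blow K (add_mset (word \<beta> ! (y - 1)) \<beta>)"
    by (rule blow_insert[of _ k y]) (use g m n b sz eq[of y] y le K in auto)
  moreover have "g' = blow K (add_mset (word \<beta> ! (y - 1)) \<beta>)"
    by (rule blow_insert[of _ k y']) (use g m n b e sz eq[of y'] eq[of "y' - 1"] y le K in auto)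
  ultimately show ?thesis by simp
qed

context two_block_family
begin

section \<open>Recovering graphs from their shadows\<close>

lemma adj: "g \<in> F \<Longrightarrow> g \<in> adjs n"
  using F by blast

text \<open>There are at most \<open>q + 4 \<le> 6\<close> block ends, so one of seven disjoint
  segments of seven vertices contains none. Seven successive mid vertices give eight pairs of twins,
  which is a run of radius 4.\<close>

lemma run_exists:
  assumes g: "g \<in> F"
  shows "\<exists>y. run n g y 4"
proof -
  have "card ((\<lambda>y. y div 7) ` ends n g) \<le> card (ends n g)" by (rule card_image_le) simp
  also have "\<dots> \<le> 6" using top[OF g] size_mu q_le by simp
  finally have c: "card ((\<lambda>y. y div 7) ` ends n g) \<le> 6" .
  have "\<not> {1..7} \<subseteq> (\<lambda>y. y div 7) ` ends n g"
  proof
    assume "{1..7} \<subseteq> (\<lambda>y. y div 7) ` ends n g"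
    then have "card {1..7::nat} \<le> card ((\<lambda>y. y div 7) ` ends n g)" by (intro card_mono) auto
    then show False using c by simp
  qed
  then obtain k where "k \<in> {1..7}" and k3: "k \<notin> (\<lambda>y. y div 7) ` ends n g" by blast
  then have k: "1 \<le> k" "k \<le> 7" by simp_all
  have mid: "mid n g z" if "7 * k \<le> z" "z < 7 * k + 7" for z
  proof (rule ccontr)
    assume "\<not> mid n g z"
    then have "z \<in> ends n g" using that k n by (simp add: ends_def)
    moreover have "z div 7 = k" using that by linarith
    ultimately show False using k3 by blast
  qed
  have "twin g x" if x: "7 * k + 3 \<le> x + 4" "x < 7 * k + 3 + 4" for x
  proof (cases "x < 7 * k")
    case True
    then have "x = 7 * k - 1" using x by simp
    then show ?thesis using mid[of "7 * k"] by (simp add: mid_def)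
  next
    case False
    then show ?thesis using mid[of x] x by (simp add: mid_def)
  qed
  then have "run n g (7 * k + 3) 4" using k n by (auto simp: run_def)
  then show ?thesis by blast
qed

text \<open>If the shadow were in \<open>fam_in\<close>, then \<open>g\<close> would arise from some
  \<open>ext i j\<close> by thickening a block of at least three vertices. Labels of
  \<open>\<nu>\<close> occur at most twice, so this is the block of \<open>a\<close> or of
  \<open>b\<close>, and \<open>g\<close> belongs to the family.\<close>

lemma run_del_extra:
  assumes g: "g \<in> F" "g \<notin> fam_set" and r: "run n g y 3"
  shows "del g y \<in> extra"
proof -
  have m: "mid n g y" using run_mid[OF r] by simp
  have yn: "y < n" using r by (simp add: run_def)
  have "del g y \<notin> fam_in"
  proof
    assume "del g y \<in> fam_in"
    then obtain i j where h: "2 \<le> i" "2 \<le> j" "i + j = e + 3" "del g y = ext i j" by (auto simp: fam_in_eq)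
    obtain i' j' where ij: "i = Suc (Suc i')" "j = Suc (Suc j')"
      using le_Suc_ex[OF h(1)] le_Suc_ex[OF h(2)] by (metis add_2_eq_Suc)
    define \<beta> where "\<beta> = \<nu> + two_mset a i b j"
    have d: "del g y = blow K \<beta>" using h(4) by (simp add: ext_def \<beta>_def)
    have sb: "sep K \<beta>" unfolding \<beta>_def ij by (rule sep_ext)
    have szb: "size \<beta> = n - 1" unfolding \<beta>_def size_ext using h(3) n_eq by simp
    obtain k where nk: "n = Suc k" using yn by (cases n) auto
    have tw: "twin (blow K \<beta>) x" if "y \<le> x + 3" "x < y + 2" for x
      using twin_del_mid[OF adj[OF g(1)] m, of x] runD[OF r, of x] runD[OF r, of "Suc x"] that
      unfolding d by (auto split: if_splits)
    have y3: "3 \<le> y" "y + 3 < n" using r by (simp_all add: run_def)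
    have eq: "word \<beta> ! (y - 1) = word \<beta> ! y" "word \<beta> ! y = word \<beta> ! Suc y"
      using sepD[OF sb, of "y - 1"] sepD[OF sb, of y] tw[of "y - 1"] tw[of y] y3 szb by auto
    define p where "p = word \<beta> ! y"
    have gb: "g = blow K (add_mset p \<beta>)"
      by (rule blow_insert[of _ k y]) (use adj[OF g(1)] m nk d szb eq K in \<open>auto simp: p_def\<close>)
    have y1: "0 < y" "Suc y < size \<beta>" using y3 szb by linarith+
    have p1: "word \<beta> ! (y - 1) = p" "word \<beta> ! Suc y = p" using eq unfolding p_def by metis+
    have "3 \<le> count \<beta> p" by (rule three_count[OF y1 p1(1) p_def[symmetric] p1(2)])
    moreover have "count \<beta> p \<le> 2" if "p \<noteq> a" "p \<noteq> b"
      using count_nu[of p] that by (simp add: \<beta>_def two_mset_def)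
    ultimately consider "p = a" | "p = b" by linarith
    then have "g = ext (Suc i) j \<or> g = ext i (Suc j)"
    proof cases
      case 1
      have "add_mset a \<beta> = \<nu> + two_mset a (Suc i) b j" by (simp add: \<beta>_def two_mset_def)
      then show ?thesis using gb 1 by (simp add: ext_def)
    next
      case 2
      have "add_mset b \<beta> = \<nu> + two_mset a i b (Suc j)" by (simp add: \<beta>_def two_mset_def)
      then show ?thesis using gb 2 by (simp add: ext_def)
    qed
    moreover have "2 \<le> Suc i \<and> Suc i + j = e + 4" "2 \<le> Suc j \<and> i + Suc j = e + 4" using h by simp_all
    ultimately have "g \<in> fam_set" unfolding fam_set_eq using h(1,2) by blast
    then show False using g(2) by blast
  qed
  moreover have "del g y \<in> shadF n F" using g(1) yn by (auto simp: shadF_def shad_def)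
  ultimately show ?thesis by (simp add: extra_def)
qed

lemma run_a: "a \<notin># \<nu>' \<Longrightarrow> b \<notin># \<nu>' \<Longrightarrow> \<exists>s. s + i \<le> size (\<nu>' + two_mset a i b j) \<and> (\<forall>x. s \<le> x \<and> x < s + i \<longrightarrow> word (\<nu>' + two_mset a i b j) ! x = a)"
proof -
  assume nab: "a \<notin># \<nu>'" "b \<notin># \<nu>'"
  define X where "X = word (filter_mset (\<lambda>x. x < a) \<nu>')"
  obtain R where w: "word (\<nu>' + two_mset a i b j) = X @ replicate i a @ R"
    using word_split[OF ab nab, of i j] by (auto simp: X_def)
  have "length X + i \<le> size (\<nu>' + two_mset a i b j)" using arg_cong[OF w, of length] by simp
  moreover have "(X @ replicate i a @ R) ! x = a" if "length X \<le> x" "x < length X + i" for x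
  proof -
    have "\<not> x < length X" "x - length X < i" using that by auto
    then show ?thesis by (simp add: nth_append)
  qed
  ultimately show ?thesis unfolding w by blast
qed

lemma run_b: "a \<notin># \<nu>' \<Longrightarrow> b \<notin># \<nu>' \<Longrightarrow> \<exists>s. s + j \<le> size (\<nu>' + two_mset a i b j) \<and> (\<forall>x. s \<le> x \<and> x < s + j \<longrightarrow> word (\<nu>' + two_mset a i b j) ! x = b)"
proof -
  assume nab: "a \<notin># \<nu>'" "b \<notin># \<nu>'"
  define X where "X = word (filter_mset (\<lambda>x. x < a) \<nu>') @ replicate i a @ word (filter_mset (\<lambda>x. a < x \<and> x < b) \<nu>')"
  obtain R where w: "word (\<nu>' + two_mset a i b j) = X @ replicate j b @ R"
    using word_split[OF ab nab, of i j] by (auto simp: X_def)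
  have "length X + j \<le> size (\<nu>' + two_mset a i b j)" using arg_cong[OF w, of length] by simp
  moreover have "(X @ replicate j b @ R) ! x = b" if "length X \<le> x" "x < length X + j" for x
  proof -
    have "\<not> x < length X" "x - length X < j" using that by auto
    then show ?thesis by (simp add: nth_append)
  qed
  ultimately show ?thesis unfolding w by blast
qed

lemma label_run_twin:
  assumes "s + k \<le> size M" "\<And>x. s \<le> x \<and> x < s + k \<Longrightarrow> word M ! x = p" "s \<le> x" "Suc x < s + k"
  shows "twin (blow K M) x"
proof -
  have "word M ! x = word M ! Suc x" "Suc x < size M" using assms(1) assms(2)[of x] assms(2)[of "Suc x"] assms(3,4) by auto
  then show ?thesis using twin_blow[of x M K] by simp
qed

lemma big_label_run:
  assumes "s + k \<le> size M" "\<And>x. s \<le> x \<and> x < s + k \<Longrightarrow> word M ! x = p" "size M \<le> k + 3"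
  shows "big (size M) (blow K M)"
  unfolding big_def using assms label_run_twin[OF assms(1,2)]
  by (intro exI[of _ s] exI[of _ "s + k"]) auto

text \<open>By \<open>merge_nu\<close> everything from the first \<open>a\<close> to the last
  \<open>b\<close> is homogeneous; further copies of \<open>b\<close> bring no new condition. At
  most one vertex remains outside.\<close>

lemma big_core:
  assumes c: "c \<in># \<nu>"
  shows "big (n - 1) (core c)"
proof -
  define \<nu>' where "\<nu>' = \<nu> - {#c#}"
  have nab: "a \<notin># \<nu>'" "b \<notin># \<nu>'" using nu_ab by (auto simp: \<nu>'_def dest: in_diffD)
  define M where "M = \<nu>' + two_mset a 2 b (e + 2)"
  define X where "X = word (filter_mset (\<lambda>x. x < a) \<nu>')"
  define Y where "Y = word (filter_mset (\<lambda>x. a < x \<and> x < b) \<nu>')"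
  define Z where "Z = word (filter_mset (\<lambda>x. b < x) \<nu>')"
  have w: "word M = X @ (replicate 2 a @ Y @ replicate (e + 2) b) @ Z"
    using word_split[OF ab nab] by (simp add: M_def X_def Y_def Z_def)
  let ?R = "replicate 2 a @ Y @ replicate (e + 2) b"
  have szn: "Suc (size \<nu>') = q" using c by (simp add: \<nu>'_def q_def size_Diff_singleton) (metis Suc_pred nonempty_has_size empty_iff set_mset_empty)
  then have szM: "size M = n - 1" using n_eq by (simp add: M_def)
  have len: "length X + length ?R + length Z = size M" using arg_cong[OF w, of length] by simp
  have lR: "e + 4 \<le> length ?R" by simp
  have reg: "a \<le> word M ! x \<and> word M ! x \<le> b" if "length X \<le> x" "x < length X + length ?R" for x
  proof -
    have "\<not> x < length X" "x - length X < length ?R" using that by auto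
    then have "word M ! x = ?R ! (x - length X)" unfolding w by (simp add: nth_append del: append_assoc replicate_Suc)
    moreover have "?R ! (x - length X) \<in> set ?R" using \<open>x - length X < length ?R\<close> by (rule nth_mem)
    ultimately have "word M ! x \<in> set ?R" by simp
    then show ?thesis using ab by (auto simp: Y_def)
  qed
  have Kreg: "K d l = (if l < a \<or> b < l then K a l else K a a)"
    if d: "{#d, l#} \<subseteq># M" "a \<le> d" "d \<le> b" for d l
  proof (cases "l < a \<or> b < l")
    case True
    have "d \<in># M" "l \<in># M" using mset_subset_eqD[OF d(1)] by simp_all
    then have "d \<in># \<nu>' + two_mset a 2 b 2" "l \<in># \<nu>'" using True ab by (auto simp: M_def two_mset_mem)
    then show ?thesis using merge_nu(1)[OF c, of d l] d True by (simp add: \<nu>'_def)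
  next
    case False
    have "{#d, l#} \<subseteq># \<nu>' + two_mset a 2 b 2"
      unfolding subseteq_mset_def
    proof
      fix x
      have "count {#d, l#} x \<le> count M x" using d(1) by (rule mset_subset_eq_count)
      then show "count {#d, l#} x \<le> count (\<nu>' + two_mset a 2 b 2) x"
        using ab by (auto simp: M_def count_two_mset split: if_splits)
    qed
    then show ?thesis using merge_nu(2)[OF c, of d l] d False by (simp add: \<nu>'_def not_less)
  qed
  have tw: "twin (blow K M) x" if x: "length X \<le> x" "Suc x < length X + length ?R" for x
  proof -
    have xs: "Suc x < size M" using x len by linarith
    have r: "a \<le> word M ! x" "word M ! x \<le> b" "a \<le> word M ! Suc x" "word M ! Suc x \<le> b"
      using reg[of x] reg[of "Suc x"] x by auto
    have "K (word M ! x) l = K (word M ! Suc x) l" if l: "l \<in># M - {#word M ! x, word M ! Suc x#}" for l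
    proof -
      have cl: "count {#word M ! x, word M ! Suc x#} l < count M l" using l by (simp add: in_diff_count)
      have mem: "word M ! x \<in># M" "word M ! Suc x \<in># M" using word_nth_in xs by simp_all
      then have pos: "0 < count M (word M ! x)" "0 < count M (word M ! Suc x)" by simp_all
      have "{#word M ! x, l#} \<subseteq># M" "{#word M ! Suc x, l#} \<subseteq># M"
        unfolding subseteq_mset_def using cl pos by (auto simp: Suc_le_eq split: if_splits)
      then show ?thesis using Kreg[of "word M ! x" l] Kreg[of "word M ! Suc x" l] r by simp
    qed
    then show ?thesis using twin_blow[OF xs] by blast
  qed
  have "q \<le> 2" by (rule q_le)
  then have "size M \<le> length ?R + 3" using szM n_eq lR szn by linarith
  then have "big (size M) (blow K M)"
    unfolding big_def using tw len by (intro exI[of _ "length X"] exI[of _ "length X + length ?R"]) auto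
  moreover have "core c = blow K M" by (simp add: core_def M_def \<nu>'_def)
  ultimately show ?thesis using szM by simp
qed

text \<open>Outside the run of \<open>e + 2\<close> equal labels there are
  \<open>q + 1 \<le> 3\<close> vertices, which accounts for the three in \<open>big\<close>.\<close>

lemma big_one: "big (n - 1) (ext 1 (e + 2))" "big (n - 1) (ext (e + 2) 1)"
proof -
  have s: "size (\<nu> + two_mset a 1 b (e + 2)) = n - 1" "size (\<nu> + two_mset a (e + 2) b 1) = n - 1"
    unfolding size_ext using n_eq by simp_all
  obtain s1 where "s1 + (e + 2) \<le> size (\<nu> + two_mset a 1 b (e + 2))"
    "\<And>x. s1 \<le> x \<and> x < s1 + (e + 2) \<Longrightarrow> word (\<nu> + two_mset a 1 b (e + 2)) ! x = b"
    using run_b[OF nu_ab, of "e + 2" 1] by blast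
  from big_label_run[OF this, unfolded s(1)] show "big (n - 1) (ext 1 (e + 2))" using q_le n_eq by (simp add: ext_def)
  obtain s2 where "s2 + (e + 2) \<le> size (\<nu> + two_mset a (e + 2) b 1)"
    "\<And>x. s2 \<le> x \<and> x < s2 + (e + 2) \<Longrightarrow> word (\<nu> + two_mset a (e + 2) b 1) ! x = a"
    using run_a[OF nu_ab, of "e + 2" 1] by blast
  from big_label_run[OF this, unfolded s(2)] show "big (n - 1) (ext (e + 2) 1)" using q_le n_eq by (simp add: ext_def)
qed

lemma extra_one: "ext 1 (e + 2) \<in> extra" "ext (e + 2) 1 \<in> extra"
proof -
  have "\<nu> + two_mset a 2 b (e + 2) - {#a#} = \<nu> + two_mset a 1 b (e + 2)"
    "\<nu> + two_mset a (e + 2) b 2 - {#b#} = \<nu> + two_mset a (e + 2) b 1"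
    by (simp_all add: two_mset_def numeral_2_eq_2)
  moreover have "count (\<nu> + two_mset a 2 b (e + 2)) a = 2" "count (\<nu> + two_mset a (e + 2) b 2) b = 2"
    using nu_ab ab by (simp_all add: count_two_mset not_in_iff)
  ultimately show "ext 1 (e + 2) \<in> extra" "ext (e + 2) 1 \<in> extra"
    using extraI[of 2 "e + 2" a] extraI[of "e + 2" 2 b] by (simp_all add: ext_def two_mset_mem)
qed

lemma extra_core: "c \<in># \<nu> \<Longrightarrow> core c \<in> extra"
proof -
  assume c: "c \<in># \<nu>"
  have "c \<noteq> a" "c \<noteq> b" using c nu_ab by auto
  then have "count (\<nu> + two_mset a 2 b (e + 2)) c \<le> 2" using count_nu[of c] ab by (simp add: count_two_mset)
  from extraI[OF _ _ _ _ this] c show ?thesis by (simp add: core_def)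
qed

text \<open>Two long blocks give two distinct shadows that are not \<open>big\<close>, in addition to the \<open>big\<close> ones in \<open>B\<close>.\<close>

lemma one_run:
  assumes g: "g \<in> F" "g \<notin> fam_set" and r1: "run n g y1 3" and r2: "run n g y2 3" and x: "y1 \<le> x0" "x0 < y2"
  shows "twin g x0"
proof (rule ccontr)
  assume nt: "\<not> twin g x0"
  note gA = adj[OF g(1)]
  have far: "y1 + 3 \<le> x0" "x0 + 3 < y2"
    using runD[OF r1, of x0] runD[OF r2, of x0] nt x by (meson le_add1 not_less order_trans less_imp_le leI)+
  have m: "mid n g y1" "mid n g y2" using run_mid r1 r2 by simp_all
  have yb: "3 \<le> y1" "y2 + 3 < n" using r1 r2 by (simp_all add: run_def)
  note t1 = twin_del_mid[OF gA m(1)] and t2 = twin_del_mid[OF gA m(2)]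
  have ne: "del g y1 \<noteq> del g y2" using del_eq_twins[OF gA, of y1 y2 x0] runD[OF r1, of y1] nt x by auto
  have nb1: "\<not> big (n - 1) (del g y1)"
  proof
    assume b: "big (n - 1) (del g y1)"
    have "twin (del g y1) (x0 - 1)"
    proof (rule big_between[OF b, of "y1 - 3" "y2 - 3"])
      fix x assume "y1 - 3 \<le> x" "x < y1 - 3 + 5"
      then show "twin (del g y1) x" using t1[of x] runD[OF r1, of x] runD[OF r1, of "Suc x"] yb by auto
    next
      fix x assume "y2 - 3 \<le> x" "x < y2 - 3 + 5"
      then show "twin (del g y1) x" using t1[of x] runD[OF r2, of "Suc x"] yb far by auto
    qed (use far yb in auto)
    then show False using t1[of "x0 - 1"] nt far by auto
  qed
  have nb2: "\<not> big (n - 1) (del g y2)"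
  proof
    assume b: "big (n - 1) (del g y2)"
    have "twin (del g y2) x0"
    proof (rule big_between[OF b, of "y1 - 3" "y2 - 3"])
      fix x assume "y1 - 3 \<le> x" "x < y1 - 3 + 5"
      then show "twin (del g y2) x" using t2[of x] runD[OF r1, of x] yb far by auto
    next
      fix x assume "y2 - 3 \<le> x" "x < y2 - 3 + 5"
      then show "twin (del g y2) x" using t2[of x] runD[OF r2, of x] runD[OF r2, of "Suc x"] yb far by auto
    qed (use far yb in auto)
    then show False using t2[of x0] nt far by auto
  qed
  obtain B where B: "B \<subseteq> {ext 1 (e + 2), ext (e + 2) 1} \<union> core ` set_mset \<nu>" "min 3 (q + 2) \<le> card B"
    using pieces unfolding distinct_pieces_def by blast
  have Bx: "B \<subseteq> extra" using B extra_one extra_core by blast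
  have fB: "finite B" using Bx finite_extra finite_subset by blast
  have Bb: "big (n - 1) h" if "h \<in> B" for h using that B big_one big_core by blast
  have "card (B \<union> {del g y1, del g y2}) = card B + card {del g y1, del g y2}"
    using fB Bb nb1 nb2 by (intro card_Un_disjoint) auto
  moreover have "card (B \<union> {del g y1, del g y2}) \<le> card extra"
    using Bx run_del_extra[OF g r1] run_del_extra[OF g r2] finite_extra by (intro card_mono) auto
  ultimately have "card B + 2 \<le> q + 2" using card_extra ne by simp
  \<comment> \<open>\<open>min 3 (q + 2)\<close> exceeds \<open>q\<close> because
    \<open>q \<le> 2\<close>.\<close>
  then show False using B(2) q_le by linarith
qed

definition centre where "centre g = (SOME y. run n g y 4)"

lemma run_centre: "g \<in> F \<Longrightarrow> run n g (centre g) 4"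
  unfolding centre_def using run_exists by (rule someI_ex)

text \<open>A graph of \<open>F\<close> outside the family can be recovered by thickening the only long block of the shadow.
  By counting, this matches those graphs with \<open>extra\<close>.\<close>

lemma parent_inj: "inj_on (\<lambda>g. del g (centre g)) (F - fam_set)"
proof -
  have main: "g = g'" if g: "g \<in> F - fam_set" "g' \<in> F - fam_set" and e: "del g (centre g) = del g' (centre g')"
    and le: "centre g \<le> centre g'" for g g'
  proof -
    define y where "y = centre g"
    define y' where "y' = centre g'"
    have r: "run n g y 4" "run n g' y' 4" using g run_centre by (auto simp: y_def y'_def)
    have m: "mid n g y" "mid n g' y'" using run_mid r by simp_all
    have gA: "g \<in> adjs n" "g' \<in> adjs n" using g adj by blast+
    have de: "del g y = del g' y'" using e by (simp add: y_def y'_def)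
    have yb: "4 \<le> y" "y' + 4 < n" using r by (simp_all add: run_def)
    note t = twin_del_mid[OF gA(1) m(1)] and t' = twin_del_mid[OF gA(2) m(2)]
    have near: "twin (del g y) x" if "y \<le> x + 4" "x < y + 3" for x
      using t[of x] runD[OF r(1), of x] runD[OF r(1), of "Suc x"] that by auto
    have near': "twin (del g y) x" if "y' \<le> x + 4" "x < y' + 3" for x
      unfolding de using t'[of x] runD[OF r(2), of x] runD[OF r(2), of "Suc x"] that by auto
    show ?thesis
    proof (rule parent_unique[OF gA m de le[folded y_def y'_def]])
      fix x assume x: "y - 1 \<le> x" "x < y'"
      show "twin (del g y) x"
      proof (rule ccontr)
        assume nt: "\<not> twin (del g y) x"
        have far: "y + 3 \<le> x" "x + 4 < y'" using near[of x] near'[of x] nt x yb by linarith+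
        \<comment> \<open>Positions beyond \<open>y\<close> move up by one on the way from
          \<open>del g y\<close> back to \<open>g\<close>. The seven pairs of twins known in the
          shadow leave room for radius 3 only.\<close>
        have "run n g (y' + 1) 3"
          unfolding run_def
        proof (intro conjI allI impI)
          fix z assume z: "y' + 1 \<le> z + 3 \<and> z < y' + 1 + 3"
          have z1: "y' \<le> z - 1 + 4" "z - 1 < y' + 3" "Suc (z - 1) = z" "\<not> z < y" "z \<noteq> y" using z far by linarith+
          show "twin g z" using t[of "z - 1"] near'[OF z1(1,2)] z1(3-5) by simp
        qed (use far yb in auto)
        then have "twin g (Suc x)"
          using one_run[of g y "y' + 1" "Suc x"] g run_mono[OF r(1), of 3] far by simp
        then show False using t[of x] nt far by auto
      qed
    qed
  qed
  show ?thesis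
  proof (rule inj_onI)
    fix g g' assume "g \<in> F - fam_set" "g' \<in> F - fam_set" "del g (centre g) = del g' (centre g')"
    then show "g = g'" using main[of g g'] main[of g' g] by (metis nat_le_linear)
  qed
qed

lemma parent_surj: "(\<lambda>g. del g (centre g)) ` (F - fam_set) = extra"
proof (rule card_seteq[OF finite_extra])
  show "(\<lambda>g. del g (centre g)) ` (F - fam_set) \<subseteq> extra"
    using run_del_extra run_mono[OF run_centre, of _ 3] by auto
  show "card extra \<le> card ((\<lambda>g. del g (centre g)) ` (F - fam_set))"
    using card_extra(1) card_image[OF parent_inj] by simp
qed

text \<open>This produces new members of \<open>F\<close>. By \<open>parent_surj\<close> some
  \<open>g\<close> in \<open>F\<close> has the same shadow, and as the shadow is \<open>big\<close>,
  the runs of \<open>g\<close> and \<open>g'\<close> lie in the same block, so that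
  \<open>parent_unique\<close> identifies the two graphs.\<close>

lemma parent_big:
  assumes h: "del g' y' \<in> extra" "big (n - 1) (del g' y')" and g': "g' \<in> adjs n" and r': "run n g' y' 4"
  shows "g' \<in> F"
proof -
  have "del g' y' \<in> (\<lambda>g. del g (centre g)) ` (F - fam_set)" unfolding parent_surj by (rule h(1))
  then obtain g where g: "g \<in> F - fam_set" "del g (centre g) = del g' y'" by (rule imageE) simp
  define y where "y = centre g"
  have r: "run n g y 4" using g run_centre by (simp add: y_def)
  have gA: "g \<in> adjs n" using g adj by blast
  have m: "mid n g y" "mid n g' y'" using run_mid r r' by simp_all
  have de: "del g y = del g' y'" using g by (simp add: y_def)
  have yb: "4 \<le> y" "y + 4 < n" "4 \<le> y'" "y' + 4 < n" using r r' by (simp_all add: run_def)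
  note t = twin_del_mid[OF gA m(1)] and t' = twin_del_mid[OF g' m(2)]
  have near: "twin (del g y) x" if "y - 3 \<le> x" "x < y - 3 + 5" for x
    using t[of x] runD[OF r, of x] runD[OF r, of "Suc x"] that yb by auto
  have near': "twin (del g y) x" if "y' - 3 \<le> x" "x < y' - 3 + 5" for x
    unfolding de using t'[of x] runD[OF r', of x] runD[OF r', of "Suc x"] that yb by auto
  have b: "big (n - 1) (del g y)" using h de by simp
  have "g = g'"
  proof (cases "y \<le> y'")
    case True
    show ?thesis
    proof (rule parent_unique[OF gA g' m de True])
      fix x assume "y - 1 \<le> x" "x < y'"
      then have "y - 3 \<le> x" "x < y' - 3 + 5" "y' - 3 + 5 < n - 1" using yb by linarith+
      then show "twin (del g y) x" using big_between[OF b near near'] by blast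
    qed
  next
    case False
    then have le: "y' \<le> y" by simp
    have "g' = g"
    proof (rule parent_unique[OF g' gA m(2,1) de[symmetric] le])
      fix x assume "y' - 1 \<le> x" "x < y"
      then have "y' - 3 \<le> x" "x < y - 3 + 5" "y - 3 + 5 < n - 1" using yb by linarith+
      then show "twin (del g' y') x" unfolding de[symmetric] using big_between[OF b near' near] by blast
    qed
    then show ?thesis ..
  qed
  then show ?thesis using g by blast
qed

text \<open>Nine equal labels form a run of radius 4 around position \<open>s + 4\<close>.\<close>

lemma label_run_parent:
  assumes M: "size M = n" and s: "s + k \<le> n" "\<And>x. s \<le> x \<and> x < s + k \<Longrightarrow> word M ! x = p" and k: "9 \<le> k"
    and h: "blow K (M - {#p#}) \<in> extra" "big (n - 1) (blow K (M - {#p#}))"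
  shows "blow K M \<in> F"
proof (rule parent_big[of _ "s + 4"])
  have "del (blow K M) (s + 4) = blow K (M - {#p#})" using del_blow[of "s + 4" M] s(2)[of "s + 4"] s(1) k M by simp
  then show "del (blow K M) (s + 4) \<in> extra" "big (n - 1) (del (blow K M) (s + 4))" using h by simp_all
  show "blow K M \<in> adjs n" using blow_adjs[of K M] K M by simp
  have "twin (blow K M) x" if "s \<le> x" "x < s + 8" for x
    by (rule label_run_twin[of s k M p]) (use s k M that in auto)
  then show "run n (blow K M) (s + 4) 4" using s k by (auto simp: run_def)
qed

text \<open>Both graphs arise by thickening the long block of a \<open>big\<close> member of
  \<open>extra\<close>.\<close>

lemma one_in_F: "ext 1 (e + 3) \<in> F" "ext (e + 3) 1 \<in> F"
proof -
  have e9: "9 \<le> e + 3" using e_large n by linarith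
  obtain s1 where s1: "s1 + (e + 3) \<le> size (\<nu> + two_mset a 1 b (e + 3))"
    "\<And>x. s1 \<le> x \<and> x < s1 + (e + 3) \<Longrightarrow> word (\<nu> + two_mset a 1 b (e + 3)) ! x = b"
    using run_b[OF nu_ab, of "e + 3" 1] by blast
  have m1: "\<nu> + two_mset a 1 b (e + 3) - {#b#} = \<nu> + two_mset a 1 b (e + 2)"
    by (simp add: two_mset_def numeral_3_eq_3)
  have z1: "size (\<nu> + two_mset a 1 b (e + 3)) = n" unfolding size_ext using n_eq by simp
  show "ext 1 (e + 3) \<in> F"
    unfolding ext_def
    using label_run_parent[OF z1 s1[unfolded z1]] extra_one(1) big_one(1) e9 unfolding m1 ext_def by blast
  obtain s2 where s2: "s2 + (e + 3) \<le> size (\<nu> + two_mset a (e + 3) b 1)"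
    "\<And>x. s2 \<le> x \<and> x < s2 + (e + 3) \<Longrightarrow> word (\<nu> + two_mset a (e + 3) b 1) ! x = a"
    using run_a[OF nu_ab, of "e + 3" 1] by blast
  have m2: "\<nu> + two_mset a (e + 3) b 1 - {#a#} = \<nu> + two_mset a (e + 2) b 1"
    by (simp add: two_mset_def numeral_3_eq_3)
  have z2: "size (\<nu> + two_mset a (e + 3) b 1) = n" unfolding size_ext using n_eq by simp
  show "ext (e + 3) 1 \<in> F"
    unfolding ext_def
    using label_run_parent[OF z2 s2[unfolded z2]] extra_one(2) big_one(2) e9 unfolding m2 ext_def by blast
qed

text \<open>Without \<open>sep\<close> for \<open>ext 1 (e + 3)\<close> its block ends cannot be
  counted by \<open>card_ends_blow\<close>. They are bounded by viewing it as a shadow of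
  \<open>ext 2 (e + 3)\<close>, on \<open>n + 1\<close> vertices, at a vertex in a block of size
  two; a further deletion does not increase them.\<close>

lemma zero_extra: "ext 0 (e + 3) \<in> extra" "ext (e + 3) 0 \<in> extra"
proof -
  have key: "blow K (M - {#p#}) \<in> extra"
    if M: "M = \<nu> + two_mset a i b j" "i + j = e + 4" "p \<in># M" "blow K M \<in> F"
      and N: "M = \<nu> + two_mset a (Suc (Suc i')) b (Suc (Suc j')) - {#p#}"
      "count (\<nu> + two_mset a (Suc (Suc i')) b (Suc (Suc j'))) p = 2" "i' + j' = e + 1" for M i j p i' j'
  proof -
    let ?N = "\<nu> + two_mset a (Suc (Suc i')) b (Suc (Suc j'))"
    have sz: "size ?N = Suc n" unfolding size_ext using N(3) n_eq by simp
    have pN: "p \<in># ?N" using N(2) by (metis count_greater_zero_iff zero_less_numeral)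
    have "card (ends n (blow K M)) < q + 4"
      using ends_remove_less[OF K sep_ext[of i' j'] pN] N(2) base_ext[of i' j'] size_mu
      unfolding sz N(1)[symmetric] by simp
    moreover have szM: "size M = n" unfolding M(1) size_ext using M(2) n_eq by simp
    obtain v where v: "v < n" "word M ! v = p" using word_pos[OF M(3)] szM by auto
    have "card (ends (n - 1) (del (blow K M) v)) \<le> card (ends n (blow K M))"
      by (rule ends_del_le[OF adj[OF M(4)] v(1)])
    moreover have d: "del (blow K M) v = blow K (M - {#p#})" using del_blow[of v M] v szM by simp
    ultimately have "card (ends (n - 1) (blow K (M - {#p#}))) < q + 4" by simp
    then have "blow K (M - {#p#}) \<notin> fam_in" using ends_fam_in by (metis less_irrefl)
    moreover have "blow K (M - {#p#}) \<in> shadF n F" using blow_shad[OF M(3) szM, of K] M(4) by (auto simp: shadF_def)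
    ultimately show ?thesis by (simp add: extra_def)
  qed
  have "blow K (\<nu> + two_mset a 1 b (e + 3) - {#a#}) \<in> extra"
    by (rule key[where i = 1 and j = "e + 3" and i' = 0 and j' = "e + 1"])
      (use one_in_F(1) nu_ab ab in \<open>auto simp: ext_def two_mset_mem count_two_mset not_in_iff, auto simp: two_mset_def numeral_3_eq_3\<close>)
  moreover have "\<nu> + two_mset a 1 b (e + 3) - {#a#} = \<nu> + two_mset a 0 b (e + 3)" by (simp add: two_mset_def)
  ultimately show "ext 0 (e + 3) \<in> extra" by (simp add: ext_def)
  have "blow K (\<nu> + two_mset a (e + 3) b 1 - {#b#}) \<in> extra"
    by (rule key[where i = "e + 3" and j = 1 and i' = "e + 1" and j' = 0])
      (use one_in_F(2) nu_ab ab in \<open>auto simp: ext_def two_mset_mem count_two_mset not_in_iff, auto simp: two_mset_def numeral_3_eq_3\<close>)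
  moreover have "\<nu> + two_mset a (e + 3) b 1 - {#b#} = \<nu> + two_mset a (e + 3) b 0" by (simp add: two_mset_def)
  ultimately show "ext (e + 3) 0 \<in> extra" by (simp add: ext_def)
qed

lemma contradiction: False
proof -
  obtain Z where Z: "Z \<subseteq> {ext 0 (e + 3), ext 1 (e + 2), ext (e + 2) 1, ext (e + 3) 0} \<union> core ` set_mset \<nu>" "q + 3 \<le> card Z"
    using pieces unfolding distinct_pieces_def by blast
  have "Z \<subseteq> extra" using Z(1) zero_extra extra_one extra_core by blast
  then have "card Z \<le> card extra" by (rule card_mono[OF finite_extra])
  then show False using Z(2) card_extra by linarith
qed

end

lemma card_le_shadF:
  assumes n: "136 \<le> n" and F: "F \<subseteq> adjs n" and c: "card F < n"
  shows "card F \<le> card (shadF n F)"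
proof (rule ccontr)
  assume "\<not> ?thesis"
  then have "F \<subseteq> adjs n \<and> card F < n \<and> card (shadF n F) < card F" using F c by simp
  then obtain G where G: "G \<subseteq> adjs n \<and> card G < n \<and> card (shadF n G) < card G"
    and min: "\<And>G'. G' \<subseteq> adjs n \<and> card G' < n \<and> card (shadF n G') < card G' \<Longrightarrow> card G \<le> card G'"
    using ex_has_least_nat[of "\<lambda>G. G \<subseteq> adjs n \<and> card G < n \<and> card (shadF n G) < card G" F card] by blast
  have fG: "finite G" using G finite_adjs finite_subset by blast
  interpret counterexample n G
  proof
    fix H assume H: "H \<subset> G"
    then have lt: "card H < card G" using fG by (rule psubset_card_mono[rotated])
    have "H \<subseteq> adjs n" "card H < n" using H G lt by auto
    then show "card H \<le> card (shadF n H)" using min[of H] lt by (meson not_le)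
  next
    show "136 \<le> n" by (rule n)
  next
    show "G \<subseteq> adjs n" using G by blast
  next
    show "card G < n" using G by blast
  next
    show "card (shadF n G) < card G" using G by blast
  qed
  show False
  proof (rule two_family)
    fix K \<mu> a b e
    assume f: "\<And>c d. K c d = K d c" "sep K \<mu>" "base \<mu> = \<mu>" "size \<mu> + e = n" "n < 2 * e"
      "\<And>g. g \<in> G \<Longrightarrow> card (ends n g) \<le> size \<mu>"
      "a < b" "count \<mu> a = 2" "count \<mu> b = 2" "\<And>i. i \<le> e \<Longrightarrow> blow K (\<mu> + two_mset a i b (e - i)) \<in> G"
    interpret two_block_family n G K \<mu> a b e
      by unfold_locales (fact f)+
    show False by (rule contradiction)
  qed
qed

section \<open>Graphs as adjacency relations\<close>

definition adjacency :: "nat pair_pre_digraph \<Rightarrow> nat \<Rightarrow> nat \<Rightarrow> bool" where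
  "adjacency G i j \<longleftrightarrow> (Suc i, Suc j) \<in> parcs G"

lemma adjacency_adjs: "G \<in> ordered_graphs n \<Longrightarrow> adjacency G \<in> adjs n"
proof -
  assume "G \<in> ordered_graphs n"
  then have "parcs G \<subseteq> {1..n} \<times> {1..n}" "sym (parcs G)" "\<And>v. (v, v) \<notin> parcs G"
    by (auto simp: ordered_graphs_def pair_graph_iff)
  moreover from this(1) have "i < n \<and> j < n" if "(Suc i, Suc j) \<in> parcs G" for i j using that by auto
  ultimately show ?thesis by (auto simp: adjacency_def adjs_def dest: symD)
qed

lemma adjacency_inj: "inj_on adjacency (ordered_graphs n)"
proof (rule inj_onI)
  fix G H assume G: "G \<in> ordered_graphs n" and H: "H \<in> ordered_graphs n" and e: "adjacency G = adjacency H"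
  have sub: "parcs G \<subseteq> {1..n} \<times> {1..n}" "parcs H \<subseteq> {1..n} \<times> {1..n}" "pverts G = pverts H"
    using G H by (auto simp: ordered_graphs_def pair_graph_iff)
  have "(i, j) \<in> parcs G \<longleftrightarrow> (i, j) \<in> parcs H" for i j
  proof (cases "1 \<le> i \<and> 1 \<le> j")
    case True
    then obtain i' j' where "i = Suc i'" "j = Suc j'" by (metis Suc_le_D One_nat_def)
    then show ?thesis using fun_cong[OF fun_cong[OF e], of i' j'] by (simp add: adjacency_def)
  next
    case False
    then show ?thesis using sub by auto
  qed
  then show "G = H" using sub(3) by (intro pair_pre_digraph.equality) auto
qed

text \<open>Counted from 0, the \<open>i\<close>-th vertex other than \<open>Suc v\<close> is
  \<open>Suc (skip v i)\<close>; so \<open>relabel\<close> and \<open>skip\<close> describe the same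
  renumbering.\<close>

lemma rank_in_delete:
  assumes "v < n" "i < n - 1"
  shows "rank_in ({1..n} - {Suc v}) (Suc (skip v i)) = Suc i"
proof -
  have "{u \<in> {1..n} - {Suc v}. u \<le> Suc (skip v i)} = {1..Suc (skip v i)} - {Suc v}"
    using assms skip_less_iff[of v n i] by auto
  then show ?thesis using assms by (cases "i < v") (simp_all add: rank_in_def)
qed

lemma adjacency_delete:
  assumes G: "G \<in> ordered_graphs n" and v: "v < n"
  shows "adjacency (relabel (delete_vertex G (Suc v))) = del (adjacency G) v"
proof (intro ext)
  fix i j
  let ?H = "delete_vertex G (Suc v)"
  have pg: "pair_graph ?H" and pv: "pverts ?H = {1..n} - {Suc v}"
    using G pair_graph_delete_vertex[of G "Suc v"] by (simp_all add: ordered_graphs_def delete_vertex_def)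
  have cd: "card (pverts ?H) = n - 1" using v by (simp add: pv)
  have A: "adjacency (relabel ?H) \<in> adjs (n - 1)"
    using adjacency_adjs[OF relabel_in_ordered_graphs[OF pg]] cd by simp
  have B: "del (adjacency G) v \<in> adjs (n - 1)" using del_adjs[OF adjacency_adjs[OF G] v] .
  show "adjacency (relabel ?H) i j = del (adjacency G) v i j"
  proof (cases "i < n - 1 \<and> j < n - 1")
    case False
    then show ?thesis using adjsD[OF A, of i j] adjsD[OF B, of i j] by blast
  next
    case True
    have mem: "Suc (skip v i) \<in> pverts ?H" "Suc (skip v j) \<in> pverts ?H"
      using True skip_less_iff[OF v, of i] skip_less_iff[OF v, of j] by (auto simp: pv)
    have "adjacency (relabel ?H) i j \<longleftrightarrow> (Suc (skip v i), Suc (skip v j)) \<in> parcs ?H"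
      using relabel_arc_iff[OF pg mem] rank_in_delete[OF v, of i] rank_in_delete[OF v, of j] True
      by (simp add: adjacency_def pv)
    also have "\<dots> \<longleftrightarrow> del (adjacency G) v i j"
      by (simp add: delete_vertex_def del_def adjacency_def)
    finally show ?thesis .
  qed
qed

lemma adjacency_shadow:
  assumes G: "G \<in> ordered_graphs n"
  shows "adjacency ` shadow G = shad n (adjacency G)"
proof -
  have "pverts G = Suc ` {..<n}" using G by (auto simp: ordered_graphs_def image_Suc_lessThan)
  then have "shadow G = (\<lambda>v. relabel (delete_vertex G (Suc v))) ` {..<n}" by (auto simp: shadow_def)
  then show ?thesis using adjacency_delete[OF G] by (auto simp: shad_def image_iff)
qed

theorem theorem1p1:
  fixes n :: nat and \<G> :: "nat pair_pre_digraph set"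
  assumes "n \<ge> 136"
    and "\<G> \<subseteq> ordered_graphs n"
    and "card \<G> < n"
  shows "card (shadow_family \<G>) \<ge> card \<G>"
proof -
  have inj: "inj_on adjacency \<G>" using adjacency_inj assms(2) by (rule inj_on_subset)
  have "adjacency ` shadow_family \<G> = shadF n (adjacency ` \<G>)"
    using adjacency_shadow assms(2) by (force simp: shadow_family_def shadF_def image_UN)
  moreover have "inj_on adjacency (shadow_family \<G>)"
    using adjacency_inj shadow_family_subset[OF assms(2)] by (rule inj_on_subset)
  ultimately have "card (shadow_family \<G>) = card (shadF n (adjacency ` \<G>))" by (metis card_image)
  moreover have "card (adjacency ` \<G>) \<le> card (shadF n (adjacency ` \<G>))"
    using assms adjacency_adjs by (intro card_le_shadF) (auto simp: card_image[OF inj])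
  ultimately show ?thesis by (simp add: card_image[OF inj])
qed

end
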